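(* Let $\mathbf{c},\mathbf{d}\in\mathbb{C}$, not both zero, with $\mathbf{c}\in\mathbb{Z}$, and let $\alpha=\mathbf{d}\,c+\mathbf{c}\,d$. Then the generalized Verma type $\widehat{H}_4$-module $V_{\widehat{H}_4}(1,\mathbf{c},\mathbf{1}_\alpha)$ is irreducible.
   Context: $H_4$ is the complex Lie algebra with basis $a,b,c,d$ and brackets $[a,b]=c$, $[d,a]=a$, $[d,b]=-b$, $[c,d]=[c,a]=[c,b]=0$, with the symmetric bilinear form $(a,b)=1$, $(c,d)=1$, all other pairings of basis vectors $0$. The affine Nappi-Witten algebra is $\widehat{H}_4=H_4\otimes\mathbb{C}[t,t^{-1}]\oplus\mathbb{C}\mathbf{k}$ with $\mathbf k$ central and $[x\otimes t^p,y\otimes t^q]=[x,y]\otimes t^{p+q}+p\,(x,y)\,\delta_{p+q,0}\,\mathbf{k}$. Let $\mathfrak{h}=\mathbb{C}c\oplus\mathbb{C}d$, identified with $\mathfrak h^*$ via the form; thus $\alpha=\mathbf{d}c+\mathbf{c}d$ satisfies $\alpha(c)=\mathbf{c}$, $\alpha(d)=\mathbf{d}$ (here $\mathbf c,\mathbf d$ are complex numbers, $c,d$ elements of $H_4$). For $m\in\mathbb{Z}$ put $$\widehat{H}_4(m,0)=\bigoplus_{n\ge -m}\mathbb{C}\,a\otimes t^n\ \oplus\ \bigoplus_{n\ge m}\mathbb{C}\,b\otimes t^n\ \oplus\ (\mathbb{C}c\oplus\mathbb{C}d)\otimes\mathbb{C}[t]\ \oplus\ \mathbb{C}\mathbf{k},$$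 a subalgebra of $\widehat{H}_4$. For $m=\mathbf{c}\in\mathbb{Z}$ let $\mathbb{C}_\alpha=\mathbb{C}\mathbf{1}_\alpha$ be the one-dimensional $\widehat{H}_4(\mathbf{c},0)$-module on which $a\otimes t^s$ ($s\ge-\mathbf{c}$), $b\otimes t^r$ ($r\ge \mathbf{c}$), $c\otimes t^l$ and $d\otimes t^l$ ($l\ge1$) act as $0$, and $c\otimes t^0,\ d\otimes t^0,\ \mathbf{k}$ act as $\mathbf{c},\mathbf{d},1$ respectively. Define $$V_{\widehat{H}_4}(1,\mathbf{c},\mathbf{1}_\alpha)=U(\widehat{H}_4)\otimes_{U(\widehat{H}_4(\mathbf{c},0))}\mathbb{C}_\alpha .$$ *)

theory Defs
  imports
    "HOL-Algebra.Free_Abelian_Groups"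
    "HOL-Algebra.QuotRing"
    "HOL-Algebra.Generated_Groups"
    "HOL-Algebra.Module"
    "HOL-Analysis.Cartesian_Space"
begin

section \<open>Left modules over a not necessarily commutative ring\<close>

text \<open>
  The locale \<^locale>\<open>module\<close> of the library requires a commutative ring. The record type of modules
  (whose fields for multiplication and unit are irrelevant here) and \<^locale>\<open>submodule\<close> are used as
  they are.
\<close>

locale left_module = R?: ring R + M?: abelian_group M for R and M (structure) +
  assumes smult_closed:
      "\<lbrakk>a \<in> carrier R; x \<in> carrier M\<rbrakk> \<Longrightarrow> a \<odot>\<^bsub>M\<^esub> x \<in> carrier M"
    and smult_l_distr:
      "\<lbrakk>a \<in> carrier R; b \<in> carrier R; x \<in> carrier M\<rbrakk> \<Longrightarrow>
        (a \<oplus>\<^bsub>R\<^esub> b) \<odot>\<^bsub>M\<^esub> x = (a \<odot>\<^bsub>M\<^esub> x) \<oplus>\<^bsub>M\<^esub> (b \<odot>\<^bsub>M\<^esub> x)"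
    and smult_r_distr:
      "\<lbrakk>a \<in> carrier R; x \<in> carrier M; y \<in> carrier M\<rbrakk> \<Longrightarrow>
        a \<odot>\<^bsub>M\<^esub> (x \<oplus>\<^bsub>M\<^esub> y) = (a \<odot>\<^bsub>M\<^esub> x) \<oplus>\<^bsub>M\<^esub> (a \<odot>\<^bsub>M\<^esub> y)"
    and smult_assoc1:
      "\<lbrakk>a \<in> carrier R; b \<in> carrier R; x \<in> carrier M\<rbrakk> \<Longrightarrow>
        (a \<otimes>\<^bsub>R\<^esub> b) \<odot>\<^bsub>M\<^esub> x = a \<odot>\<^bsub>M\<^esub> (b \<odot>\<^bsub>M\<^esub> x)"
    and smult_one:
      "x \<in> carrier M \<Longrightarrow> \<one>\<^bsub>R\<^esub> \<odot>\<^bsub>M\<^esub> x = x"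

definition irreducible_left_module ::
    "('r, 's) ring_scheme \<Rightarrow> ('r, 'm, 't) module_scheme \<Rightarrow> bool" where
  "irreducible_left_module R M \<longleftrightarrow>
     left_module R M \<and> carrier M \<noteq> {\<zero>\<^bsub>M\<^esub>} \<and>
     (\<forall>H. submodule H R M \<longrightarrow> H = {\<zero>\<^bsub>M\<^esub>} \<or> H = carrier M)"

text \<open>
  For a ring homomorphism \<open>\<phi> : B \<rightarrow> A\<close>, which makes \<open>A\<close> a right \<open>B\<close>-module, and a left \<open>B\<close>-module
  \<open>N\<close>: the tensor product of \<open>A\<close> and \<open>N\<close> over \<open>B\<close>, as the quotient of the free abelian group on
  pairs by the balanced bilinearity relations, with \<open>A\<close> acting by left multiplication on the first
  factor.
\<close>

definition tensor_relations ::
    "('r, 's) ring_scheme \<Rightarrow> ('q, 'u) ring_scheme \<Rightarrow> ('q \<Rightarrow> 'r) \<Rightarrow> ('q, 'n, 't) module_scheme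
      \<Rightarrow> ('r \<times> 'n \<Rightarrow>\<^sub>0 int) set" where
  "tensor_relations A B \<phi> N =
     {frag_of (x \<oplus>\<^bsub>A\<^esub> y, n) - frag_of (x, n) - frag_of (y, n) | x y n.
        x \<in> carrier A \<and> y \<in> carrier A \<and> n \<in> carrier N} \<union>
     {frag_of (x, n \<oplus>\<^bsub>N\<^esub> n') - frag_of (x, n) - frag_of (x, n') | x n n'.
        x \<in> carrier A \<and> n \<in> carrier N \<and> n' \<in> carrier N} \<union>
     {frag_of (x \<otimes>\<^bsub>A\<^esub> \<phi> b, n) - frag_of (x, b \<odot>\<^bsub>N\<^esub> n) | x b n.
        x \<in> carrier A \<and> b \<in> carrier B \<and> n \<in> carrier N}"

definition tensor_subgroup ::
    "('r, 's) ring_scheme \<Rightarrow> ('q, 'u) ring_scheme \<Rightarrow> ('q \<Rightarrow> 'r) \<Rightarrow> ('q, 'n, 't) module_scheme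
      \<Rightarrow> ('r \<times> 'n \<Rightarrow>\<^sub>0 int) set" where
  "tensor_subgroup A B \<phi> N =
     generate (free_Abelian_group (carrier A \<times> carrier N)) (tensor_relations A B \<phi> N)"

definition induced_module ::
    "('r, 's) ring_scheme \<Rightarrow> ('q, 'u) ring_scheme \<Rightarrow> ('q \<Rightarrow> 'r) \<Rightarrow> ('q, 'n, 't) module_scheme
      \<Rightarrow> ('r, ('r \<times> 'n \<Rightarrow>\<^sub>0 int) set) module" where
  "induced_module A B \<phi> N =
     (let F = free_Abelian_group (carrier A \<times> carrier N); T = tensor_subgroup A B \<phi> N
      in \<lparr>carrier = carrier (F Mod T), mult = undefined, one = undefined,
          zero = \<one>\<^bsub>F Mod T\<^esub>, add = (\<lambda>X Y. X \<otimes>\<^bsub>F Mod T\<^esub> Y),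
          smult = (\<lambda>u X. the_elem
            ((\<lambda>z. T #>\<^bsub>F\<^esub> frag_extend (\<lambda>(x, n). frag_of (u \<otimes>\<^bsub>A\<^esub> x, n)) z) ` X))\<rparr>)"


section \<open>Complex Lie algebras and their universal enveloping algebras\<close>

text \<open>
  Lie algebras are subspaces \<open>L\<close>, closed under the bracket, of an ambient type with scalar
  multiplication and bracket.
\<close>

locale complex_lie_algebra = vector_space scale
  for scale :: "complex \<Rightarrow> 'g::ab_group_add \<Rightarrow> 'g" +
  fixes bracket :: "'g \<Rightarrow> 'g \<Rightarrow> 'g"
  assumes bracket_add_left: "bracket (x + y) z = bracket x z + bracket y z"
    and bracket_add_right: "bracket x (y + z) = bracket x y + bracket x z"
    and bracket_scale_left: "bracket (scale r x) y = scale r (bracket x y)"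
    and bracket_scale_right: "bracket x (scale r y) = scale r (bracket x y)"
    and bracket_self: "bracket x x = 0"
    and jacobi: "bracket x (bracket y z) + bracket y (bracket z x) + bracket z (bracket x y) = 0"

definition (in complex_lie_algebra) lie_subalgebra :: "'g set \<Rightarrow> bool" where
  "lie_subalgebra L \<longleftrightarrow> subspace L \<and> (\<forall>x\<in>L. \<forall>y\<in>L. bracket x y \<in> L)"

text \<open>
  The free monoid, written additively so that finitely supported functions on it multiply by
  convolution: this is the free associative algebra.
\<close>

datatype 'a free_monoid = Word (letters: "'a list")

instantiation free_monoid :: (type) monoid_add
begin

definition "0 = Word []"

definition "u + v = Word (letters u @ letters v)"

instance
  by standard (auto simp: zero_free_monoid_def plus_free_monoid_def)

end

type_synonym 'g free_algebra = "'g free_monoid \<Rightarrow>\<^sub>0 complex"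

definition gen :: "'g \<Rightarrow> 'g free_algebra" where
  "gen x = Poly_Mapping.single (Word [x]) 1"

definition free_algebra_on :: "'g set \<Rightarrow> 'g free_algebra ring" where
  "free_algebra_on L =
     \<lparr>carrier = {p. \<forall>w\<in>Poly_Mapping.keys p. set (letters w) \<subseteq> L},
      mult = (*), one = 1, zero = 0, add = (+)\<rparr>"

text \<open>
  The first two families of relations turn the free algebra on the set \<open>L\<close> into the tensor algebra
  of the vector space \<open>L\<close>.
\<close>

definition enveloping_relations ::
    "(complex \<Rightarrow> 'g::ab_group_add \<Rightarrow> 'g) \<Rightarrow> ('g \<Rightarrow> 'g \<Rightarrow> 'g) \<Rightarrow> 'g set \<Rightarrow> 'g free_algebra set"
  where
  "enveloping_relations sc br L =
     {gen (x + y) - gen x - gen y | x y. x \<in> L \<and> y \<in> L} \<union>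
     {gen (sc r x) - Poly_Mapping.single 0 r * gen x | r x. x \<in> L} \<union>
     {gen x * gen y - gen y * gen x - gen (br x y) | x y. x \<in> L \<and> y \<in> L}"

definition enveloping_ideal ::
    "(complex \<Rightarrow> 'g::ab_group_add \<Rightarrow> 'g) \<Rightarrow> ('g \<Rightarrow> 'g \<Rightarrow> 'g) \<Rightarrow> 'g set \<Rightarrow> 'g free_algebra set"
  where
  "enveloping_ideal sc br L =
     Idl\<^bsub>free_algebra_on L\<^esub> (enveloping_relations sc br L)"

definition enveloping_algebra ::
    "(complex \<Rightarrow> 'g::ab_group_add \<Rightarrow> 'g) \<Rightarrow> ('g \<Rightarrow> 'g \<Rightarrow> 'g) \<Rightarrow> 'g set \<Rightarrow> 'g free_algebra set ring"
  where
  "enveloping_algebra sc br L =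
     free_algebra_on L Quot enveloping_ideal sc br L"

text \<open>The homomorphism of enveloping algebras induced by an inclusion into \<open>L\<close>.\<close>

definition enveloping_inclusion ::
    "(complex \<Rightarrow> 'g::ab_group_add \<Rightarrow> 'g) \<Rightarrow> ('g \<Rightarrow> 'g \<Rightarrow> 'g) \<Rightarrow> 'g set
      \<Rightarrow> 'g free_algebra set \<Rightarrow> 'g free_algebra set" where
  "enveloping_inclusion sc br L X =
     the_elem ((\<lambda>p. enveloping_ideal sc br L +>\<^bsub>free_algebra_on L\<^esub> p) ` X)"

definition (in complex_lie_algebra) lie_representation ::
    "'g set \<Rightarrow> (complex \<Rightarrow> 'v::ab_group_add \<Rightarrow> 'v) \<Rightarrow> ('g \<Rightarrow> 'v \<Rightarrow> 'v) \<Rightarrow> bool" where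
  "lie_representation L vscale \<rho> \<longleftrightarrow>
     vector_space vscale \<and>
     (\<forall>x\<in>L. Vector_Spaces.linear vscale vscale (\<rho> x)) \<and>
     (\<forall>x\<in>L. \<forall>y\<in>L. \<forall>v. \<rho> (x + y) v = \<rho> x v + \<rho> y v) \<and>
     (\<forall>r. \<forall>x\<in>L. \<forall>v. \<rho> (scale r x) v = vscale r (\<rho> x v)) \<and>
     (\<forall>x\<in>L. \<forall>y\<in>L. \<forall>v. \<rho> (bracket x y) v = \<rho> x (\<rho> y v) - \<rho> y (\<rho> x v))"

definition free_algebra_action ::
    "(complex \<Rightarrow> 'v::ab_group_add \<Rightarrow> 'v) \<Rightarrow> ('g \<Rightarrow> 'v \<Rightarrow> 'v) \<Rightarrow> 'g free_algebra \<Rightarrow> 'v \<Rightarrow> 'v"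
  where
  "free_algebra_action vscale \<rho> p v =
     (\<Sum>w\<in>Poly_Mapping.keys p. vscale (Poly_Mapping.lookup p w) (foldr \<rho> (letters w) v))"

text \<open>
  The module over the enveloping algebra given by a representation \<open>\<rho>\<close>, meaningful when \<open>\<rho>\<close> is a
  representation of the Lie algebra \<open>L\<close> whose enveloping algebra acts.
\<close>

definition enveloping_module ::
    "(complex \<Rightarrow> 'v::ab_group_add \<Rightarrow> 'v) \<Rightarrow> ('g \<Rightarrow> 'v \<Rightarrow> 'v) \<Rightarrow> ('g free_algebra set, 'v) module"
  where
  "enveloping_module vscale \<rho> =
     \<lparr>carrier = UNIV, mult = undefined, one = undefined, zero = 0, add = (+),
      smult = (\<lambda>X v. the_elem ((\<lambda>p. free_algebra_action vscale \<rho> p v) ` X))\<rparr>"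


section \<open>The affine Nappi--Witten algebra\<close>

datatype nw_index = NW_A | NW_B | NW_C | NW_D

lemma UNIV_nw_index: "UNIV = {NW_A, NW_B, NW_C, NW_D}"
  using nw_index.exhaust by auto

instance nw_index :: finite
  by standard (simp add: UNIV_nw_index)

type_synonym nw = "complex ^ nw_index"

abbreviation nw_a :: nw where "nw_a \<equiv> axis NW_A 1"
abbreviation nw_b :: nw where "nw_b \<equiv> axis NW_B 1"
abbreviation nw_c :: nw where "nw_c \<equiv> axis NW_C 1"
abbreviation nw_d :: nw where "nw_d \<equiv> axis NW_D 1"

fun nw_basis_bracket :: "nw_index \<Rightarrow> nw_index \<Rightarrow> nw" where
  "nw_basis_bracket NW_A NW_B = nw_c"
| "nw_basis_bracket NW_B NW_A = - nw_c"
| "nw_basis_bracket NW_D NW_A = nw_a"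
| "nw_basis_bracket NW_A NW_D = - nw_a"
| "nw_basis_bracket NW_D NW_B = - nw_b"
| "nw_basis_bracket NW_B NW_D = nw_b"
| "nw_basis_bracket _ _ = 0"

fun nw_basis_form :: "nw_index \<Rightarrow> nw_index \<Rightarrow> complex" where
  "nw_basis_form NW_A NW_B = 1"
| "nw_basis_form NW_B NW_A = 1"
| "nw_basis_form NW_C NW_D = 1"
| "nw_basis_form NW_D NW_C = 1"
| "nw_basis_form _ _ = 0"

definition nw_bracket :: "nw \<Rightarrow> nw \<Rightarrow> nw" where
  "nw_bracket x y = (\<Sum>i\<in>UNIV. \<Sum>j\<in>UNIV. (x $ i * y $ j) *s nw_basis_bracket i j)"

definition nw_form :: "nw \<Rightarrow> nw \<Rightarrow> complex" where
  "nw_form x y = (\<Sum>i\<in>UNIV. \<Sum>j\<in>UNIV. x $ i * y $ j * nw_basis_form i j)"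

lemma nw_bracket_nth:
  "nw_bracket x y $ NW_A = x $ NW_D * y $ NW_A - x $ NW_A * y $ NW_D"
  "nw_bracket x y $ NW_B = x $ NW_B * y $ NW_D - x $ NW_D * y $ NW_B"
  "nw_bracket x y $ NW_C = x $ NW_A * y $ NW_B - x $ NW_B * y $ NW_A"
  "nw_bracket x y $ NW_D = 0"
  by (simp_all add: nw_bracket_def UNIV_nw_index axis_def)

lemma nw_form_sum:
  "nw_form x y = x $ NW_A * y $ NW_B + x $ NW_B * y $ NW_A + x $ NW_C * y $ NW_D + x $ NW_D * y $ NW_C"
  by (simp add: nw_form_def UNIV_nw_index algebra_simps)

lemma nw_eq_iff:
  "x = y \<longleftrightarrow> x $ NW_A = y $ NW_A \<and> x $ NW_B = y $ NW_B \<and> x $ NW_C = y $ NW_C \<and> x $ NW_D = y $ NW_D"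
  for x y :: nw
proof -
  have "(\<forall>i. P i) \<longleftrightarrow> P NW_A \<and> P NW_B \<and> P NW_C \<and> P NW_D" for P
    by (auto intro: nw_index.induct)
  then show ?thesis
    by (simp add: vec_eq_iff)
qed

lemma nw_bracket_linear:
  "nw_bracket 0 y = 0" "nw_bracket x 0 = 0"
  "nw_bracket (x + x') y = nw_bracket x y + nw_bracket x' y"
  "nw_bracket x (y + y') = nw_bracket x y + nw_bracket x y'"
  by (simp_all add: nw_eq_iff nw_bracket_nth algebra_simps)

lemma nw_form_linear:
  "nw_form 0 y = 0" "nw_form x 0 = 0"
  "nw_form (x + x') y = nw_form x y + nw_form x' y"
  "nw_form x (y + y') = nw_form x y + nw_form x y'"
  by (simp_all add: nw_form_sum algebra_simps)

lemma nw_jacobi: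
  "nw_bracket x (nw_bracket y z) + nw_bracket y (nw_bracket z x) + nw_bracket z (nw_bracket x y) = 0"
  by (simp add: nw_eq_iff nw_bracket_nth algebra_simps)

text \<open>
  A pair \<open>(f, r)\<close> stands for \<open>(\<Sum>p. f p \<otimes> t\<^sup>p) + r k\<close>; so \<open>(Poly_Mapping.single p x, 0)\<close> is
  \<open>x \<otimes> t\<^sup>p\<close> and \<open>(0, 1)\<close> is the central element \<open>k\<close>.
\<close>

type_synonym affine_nw = "(int \<Rightarrow>\<^sub>0 nw) \<times> complex"

definition affine_scale :: "complex \<Rightarrow> affine_nw \<Rightarrow> affine_nw" where
  "affine_scale z u = (Poly_Mapping.map (\<lambda>x. z *s x) (fst u), z * snd u)"

definition affine_bracket :: "affine_nw \<Rightarrow> affine_nw \<Rightarrow> affine_nw" where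
  "affine_bracket u v =
     (\<Sum>p\<in>Poly_Mapping.keys (fst u). \<Sum>q\<in>Poly_Mapping.keys (fst v).
        let x = Poly_Mapping.lookup (fst u) p; y = Poly_Mapping.lookup (fst v) q
        in (Poly_Mapping.single (p + q) (nw_bracket x y),
            if p + q = 0 then of_int p * nw_form x y else 0))"

definition affine_term :: "int \<Rightarrow> int \<Rightarrow> nw \<Rightarrow> nw \<Rightarrow> affine_nw" where
  "affine_term p q x y =
     (Poly_Mapping.single (p + q) (nw_bracket x y),
      if p + q = 0 then of_int p * nw_form x y else 0)"

lemma affine_term_zero [simp]: "affine_term p q 0 y = 0" "affine_term p q x 0 = 0"
  by (simp_all add: affine_term_def nw_bracket_linear nw_form_linear zero_prod_def)

lemma affine_term_add:
  "affine_term p q (x + x') y = affine_term p q x y + affine_term p q x' y"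
  "affine_term p q x (y + y') = affine_term p q x y + affine_term p q x y'"
  by (simp_all add: affine_term_def nw_bracket_linear nw_form_linear single_add distrib_left)

lemma lookup_affine_scale [simp]:
  "Poly_Mapping.lookup (fst (affine_scale z u)) n = z *s Poly_Mapping.lookup (fst u) n"
  by (auto simp: affine_scale_def map.rep_eq when_def)

lemma snd_affine_scale [simp]: "snd (affine_scale z u) = z * snd u"
  by (simp add: affine_scale_def)

lemma affine_eqI:
  "u = v" if "\<And>n. Poly_Mapping.lookup (fst u) n = Poly_Mapping.lookup (fst v) n" "snd u = snd v"
  for u v :: affine_nw
  using that by (simp add: prod_eq_iff poly_mapping_eqI)

lemma affine_term_scale:
  "affine_term p q (z *s x) y = affine_scale z (affine_term p q x y)"
  "affine_term p q x (z *s y) = affine_scale z (affine_term p q x y)"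
  by (rule affine_eqI; auto simp: affine_term_def lookup_single when_def nw_form_sum
      nw_eq_iff nw_bracket_nth algebra_simps)+

lemma affine_bracket_superset:
  assumes "finite S" "Poly_Mapping.keys (fst u) \<subseteq> S" "finite T" "Poly_Mapping.keys (fst v) \<subseteq> T"
  shows "affine_bracket u v = (\<Sum>p\<in>S. \<Sum>q\<in>T.
           affine_term p q (Poly_Mapping.lookup (fst u) p) (Poly_Mapping.lookup (fst v) q))"
proof -
  have "affine_bracket u v = (\<Sum>p\<in>Poly_Mapping.keys (fst u). \<Sum>q\<in>Poly_Mapping.keys (fst v).
           affine_term p q (Poly_Mapping.lookup (fst u) p) (Poly_Mapping.lookup (fst v) q))"
    by (simp add: affine_bracket_def affine_term_def Let_def)
  also have "\<dots> = (\<Sum>p\<in>Poly_Mapping.keys (fst u). \<Sum>q\<in>T.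
           affine_term p q (Poly_Mapping.lookup (fst u) p) (Poly_Mapping.lookup (fst v) q))"
    using assms by (intro sum.cong refl sum.mono_neutral_left) (auto simp: in_keys_iff)
  also have "\<dots> = (\<Sum>p\<in>S. \<Sum>q\<in>T.
           affine_term p q (Poly_Mapping.lookup (fst u) p) (Poly_Mapping.lookup (fst v) q))"
    using assms by (intro sum.mono_neutral_left) (auto simp: in_keys_iff)
  finally show ?thesis .
qed

lemma vector_space_affine: "vector_space affine_scale"
  by standard (rule affine_eqI; auto simp: lookup_add vec_eq_iff algebra_simps)+

lemma affine_bracket_add_left: "affine_bracket (u + u') v = affine_bracket u v + affine_bracket u' v"
proof -
  let ?S = "Poly_Mapping.keys (fst u) \<union> Poly_Mapping.keys (fst u')" and ?T = "Poly_Mapping.keys (fst v)"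
  have "Poly_Mapping.keys (fst u + fst u') \<subseteq> ?S"
    by (rule keys_add)
  then show ?thesis
    by (simp add: affine_bracket_superset[where S = ?S and T = ?T] lookup_add affine_term_add sum.distrib)
qed

lemma affine_bracket_add_right: "affine_bracket v (u + u') = affine_bracket v u + affine_bracket v u'"
proof -
  let ?S = "Poly_Mapping.keys (fst u) \<union> Poly_Mapping.keys (fst u')" and ?T = "Poly_Mapping.keys (fst v)"
  have "Poly_Mapping.keys (fst u + fst u') \<subseteq> ?S"
    by (rule keys_add)
  then show ?thesis
    by (simp add: affine_bracket_superset[where S = ?T and T = ?S] lookup_add affine_term_add sum.distrib)
qed

lemma keys_affine_scale: "Poly_Mapping.keys (fst (affine_scale z u)) \<subseteq> Poly_Mapping.keys (fst u)"
  by (auto simp: in_keys_iff)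

lemma affine_bracket_scale:
  "affine_bracket (affine_scale z u) v = affine_scale z (affine_bracket u v)"
  "affine_bracket u (affine_scale z v) = affine_scale z (affine_bracket u v)"
proof -
  interpret vector_space affine_scale by (rule vector_space_affine)
  show "affine_bracket (affine_scale z u) v = affine_scale z (affine_bracket u v)"
    "affine_bracket u (affine_scale z v) = affine_scale z (affine_bracket u v)"
    by (simp_all add: keys_affine_scale affine_term_scale scale_sum_right
      affine_bracket_superset[where S = "Poly_Mapping.keys (fst u)" and T = "Poly_Mapping.keys (fst v)"])
qed

lemma affine_bracket_monomials:
  "affine_bracket (Poly_Mapping.single p x, r) (Poly_Mapping.single q y, s) =
     (Poly_Mapping.single (p + q) (nw_bracket x y), if p + q = 0 then of_int p * nw_form x y else 0)"
  by (subst affine_bracket_superset[where S = "{p}" and T = "{q}"]) (auto simp: affine_term_def)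

lemma affine_bracket_central [simp]: "affine_bracket (0, r) v = 0" "affine_bracket v (0, r) = 0"
    "affine_bracket 0 v = 0" "affine_bracket v 0 = 0"
  by (simp_all add: affine_bracket_def)

lemma affine_induct [case_names monomial central add]:
  fixes u :: affine_nw
  assumes "\<And>p x. P (Poly_Mapping.single p x, 0)" "\<And>r. P (0, r)" "\<And>u v. P u \<Longrightarrow> P v \<Longrightarrow> P (u + v)"
  shows "P u"
proof -
  have "P (f, 0)" for f
  proof (induction f rule: update_induct)
    case const
    then show ?case using assms by blast
  next
    case (update f a b)
    have "Poly_Mapping.update a b f = f + Poly_Mapping.single a b"
      using update by (intro poly_mapping_eqI) (auto simp: lookup_update lookup_add lookup_single in_keys_iff)
    then show ?case using assms(3)[OF update(3) assms(1)[of a b]] by simp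
  qed
  from assms(3)[OF this[of "fst u"] assms(2)[of "snd u"]] show ?thesis by simp
qed

lemma affine_bracket_anti: "affine_bracket u v + affine_bracket v u = 0"
proof (induction u rule: affine_induct)
  case (monomial p x)
  show ?case
  proof (induction v rule: affine_induct)
    case (monomial q y)
    have "of_int p * nw_form x y + of_int q * nw_form y x = 0" if "p + q = 0"
    proof -
      have "q = - p" using that by simp
      then show ?thesis by (simp add: nw_form_sum algebra_simps)
    qed
    moreover have "nw_bracket x y + nw_bracket y x = 0"
      by (simp add: nw_eq_iff nw_bracket_nth algebra_simps)
    ultimately show ?case
      by (auto simp: affine_bracket_monomials add.commute[of q p] zero_prod_def simp flip: single_add)
  next
    case (add u1 u2)
    let ?u = "(Poly_Mapping.single p x, 0)"
    have "affine_bracket ?u (u1 + u2) + affine_bracket (u1 + u2) ?u =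
      (affine_bracket ?u u1 + affine_bracket u1 ?u) + (affine_bracket ?u u2 + affine_bracket u2 ?u)"
      by (simp add: affine_bracket_add_left affine_bracket_add_right add_ac)
    then show ?case
      by (simp only: add add_0)
  qed simp
next
  case (add u1 u2)
  have "affine_bracket (u1 + u2) v + affine_bracket v (u1 + u2) =
    (affine_bracket u1 v + affine_bracket v u1) + (affine_bracket u2 v + affine_bracket v u2)"
    by (simp add: affine_bracket_add_left affine_bracket_add_right add_ac)
  then show ?case
    by (simp only: add add_0)
qed simp

lemma affine_jacobi:
  "affine_bracket u (affine_bracket v w) + affine_bracket v (affine_bracket w u)
     + affine_bracket w (affine_bracket u v) = 0" (is "?J u v w = 0")
proof -
  have J_add: "?J (u + u') v w = ?J u v w + ?J u' v w" "?J u (v + v') w = ?J u v w + ?J u v' w"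
    "?J u v (w + w') = ?J u v w + ?J u v w'" for u u' v v' w w'
    by (simp_all add: affine_bracket_add_left affine_bracket_add_right add_ac)
  have mon: "?J (Poly_Mapping.single p x, 0) (Poly_Mapping.single q y, 0) (Poly_Mapping.single r z, 0) = 0"
    for p q r x y z
  proof (rule prod_eqI)
    have *: "q + (r + p) = p + (q + r)" "r + (p + q) = p + (q + r)"
      by simp_all
    show "fst (?J (Poly_Mapping.single p x, 0) (Poly_Mapping.single q y, 0)
      (Poly_Mapping.single r z, 0)) = fst 0"
      by (simp add: affine_bracket_monomials nw_jacobi * flip: single_add)
    have "of_int p * nw_form x (nw_bracket y z) + of_int q * nw_form y (nw_bracket z x)
        + of_int r * nw_form z (nw_bracket x y) = 0" if "p + (q + r) = 0"
    proof -
      have r: "r = - p - q" using that by simp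
      show ?thesis unfolding r by (simp add: nw_form_sum nw_bracket_nth algebra_simps)
    qed
    then show "snd (?J (Poly_Mapping.single p x, 0) (Poly_Mapping.single q y, 0)
      (Poly_Mapping.single r z, 0)) = snd 0"
      by (simp add: affine_bracket_monomials *)
  qed
  show ?thesis
  proof (induction u rule: affine_induct)
    case (monomial p x)
    show ?case
    proof (induction v rule: affine_induct)
      case (monomial q y)
      show ?case
      proof (induction w rule: affine_induct)
        case (monomial r z)
        show ?case by (rule mon)
      next
        case (add u1 u2) then show ?case by (simp only: J_add(3) add_0)
      next
        case (central r) then show ?case by simp
      qed
    next
      case (add u1 u2) then show ?case by (simp only: J_add(2) add_0)
    next
      case (central r) then show ?case by simp
    qed
  next
    case (add u1 u2) then show ?case by (simp only: J_add(1) add_0)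
  next
    case (central r) then show ?case by simp
  qed
qed

lemma affine_lie_algebra: "complex_lie_algebra affine_scale affine_bracket"
proof -
  interpret vector_space affine_scale by (rule vector_space_affine)
  show ?thesis
  proof
    fix x
    have "affine_scale 2 (affine_bracket x x) = 0"
      using affine_bracket_anti[of x x] scale_left_distrib[of 1 1 "affine_bracket x x"] by simp
    then show "affine_bracket x x = 0" by simp
  qed (auto simp: affine_bracket_add_left affine_bracket_add_right affine_bracket_scale affine_jacobi)
qed

text \<open>The subalgebra written \<open>H\<^sub>4(m,0)\<close> with a hat.\<close>

definition affine_sub :: "int \<Rightarrow> affine_nw set" where
  "affine_sub m =
     {u. \<forall>n. (Poly_Mapping.lookup (fst u) n $ NW_A \<noteq> 0 \<longrightarrow> n \<ge> - m) \<and>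
             (Poly_Mapping.lookup (fst u) n $ NW_B \<noteq> 0 \<longrightarrow> n \<ge> m) \<and>
             (Poly_Mapping.lookup (fst u) n $ NW_C \<noteq> 0 \<longrightarrow> n \<ge> 0) \<and>
             (Poly_Mapping.lookup (fst u) n $ NW_D \<noteq> 0 \<longrightarrow> n \<ge> 0)}"

lemma affine_lie_subalgebra:
  "complex_lie_algebra.lie_subalgebra affine_scale affine_bracket (affine_sub m)"
proof -
  interpret complex_lie_algebra affine_scale affine_bracket by (rule affine_lie_algebra)
  have sub: "subspace (affine_sub m)"
  proof (rule subspaceI)
    fix u v assume "u \<in> affine_sub m" "v \<in> affine_sub m"
    then show "u + v \<in> affine_sub m"
      unfolding affine_sub_def mem_Collect_eq fst_add lookup_add vector_add_component
      by (metis add_0)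
  qed (auto simp: affine_sub_def)
  have "affine_bracket u v \<in> affine_sub m" if "u \<in> affine_sub m" "v \<in> affine_sub m" for u v
  proof -
    have "affine_term p q (Poly_Mapping.lookup (fst u) p) (Poly_Mapping.lookup (fst v) q) \<in> affine_sub m"
      for p q
    proof -
      have u: "Poly_Mapping.lookup (fst u) p $ NW_A \<noteq> 0 \<Longrightarrow> p \<ge> - m"
        "Poly_Mapping.lookup (fst u) p $ NW_B \<noteq> 0 \<Longrightarrow> p \<ge> m"
        "Poly_Mapping.lookup (fst u) p $ NW_D \<noteq> 0 \<Longrightarrow> p \<ge> 0"
        and v: "Poly_Mapping.lookup (fst v) q $ NW_A \<noteq> 0 \<Longrightarrow> q \<ge> - m"
        "Poly_Mapping.lookup (fst v) q $ NW_B \<noteq> 0 \<Longrightarrow> q \<ge> m"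
        "Poly_Mapping.lookup (fst v) q $ NW_D \<noteq> 0 \<Longrightarrow> q \<ge> 0"
        using that by (simp_all add: affine_sub_def)
      define x where "x = Poly_Mapping.lookup (fst u) p"
      define y where "y = Poly_Mapping.lookup (fst v) q"
      have "nw_bracket x y $ NW_A \<noteq> 0 \<Longrightarrow> p + q \<ge> - m"
        using u(1,3) v(1,3) unfolding nw_bracket_nth x_def[symmetric] y_def[symmetric]
        by (cases "x $ NW_A = 0"; cases "y $ NW_A = 0"; cases "x $ NW_D = 0"; cases "y $ NW_D = 0"; force)
      moreover have "nw_bracket x y $ NW_B \<noteq> 0 \<Longrightarrow> p + q \<ge> m"
        using u(2,3) v(2,3) unfolding nw_bracket_nth x_def[symmetric] y_def[symmetric]
        by (cases "x $ NW_B = 0"; cases "y $ NW_B = 0"; cases "x $ NW_D = 0"; cases "y $ NW_D = 0"; force)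
      moreover have "nw_bracket x y $ NW_C \<noteq> 0 \<Longrightarrow> p + q \<ge> 0"
        using u(1,2) v(1,2) unfolding nw_bracket_nth x_def[symmetric] y_def[symmetric]
        by (cases "x $ NW_A = 0"; cases "y $ NW_A = 0"; cases "x $ NW_B = 0"; cases "y $ NW_B = 0"; force)
      ultimately show ?thesis
        by (simp add: affine_sub_def affine_term_def lookup_single when_def nw_bracket_nth(4)
            flip: x_def y_def)
    qed
    then show ?thesis
      unfolding affine_bracket_superset[OF finite_keys order_refl finite_keys order_refl]
      by (intro subspace_sum[OF sub])
  qed
  with sub show ?thesis
    by (simp add: lie_subalgebra_def)
qed

text \<open>
  The one-dimensional module of level \<open>l\<close> for \<open>\<alpha>\<close> in the span of \<open>c\<close> and \<open>d\<close>: an element \<open>h\<close> of that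
  span, in degree \<open>0\<close>, acts by \<open>\<alpha>(h) = (\<alpha>, h)\<close>, the central element by \<open>l\<close>, and all other basis
  elements of the subalgebra by \<open>0\<close>. Since \<open>\<alpha>\<close> is orthogonal to \<open>a\<close> and \<open>b\<close>, the degree-zero
  components of \<open>a\<close> and \<open>b\<close> do not contribute.
\<close>

definition one_dim_rep :: "complex \<Rightarrow> nw \<Rightarrow> affine_nw \<Rightarrow> complex \<Rightarrow> complex" where
  "one_dim_rep l \<alpha> u v = (nw_form \<alpha> (Poly_Mapping.lookup (fst u) 0) + l * snd u) * v"

lemma one_dim_rep_is_representation:
  assumes "\<alpha> = z *s nw_c + (of_int m * l) *s nw_d"
  shows "complex_lie_algebra.lie_representation affine_scale affine_bracket (affine_sub m) (*)
           (one_dim_rep l \<alpha>)"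
proof -
  interpret complex_lie_algebra affine_scale affine_bracket by (rule affine_lie_algebra)
  have \<alpha>: "\<alpha> $ NW_A = 0" "\<alpha> $ NW_B = 0" "\<alpha> $ NW_C = z" "\<alpha> $ NW_D = of_int m * l"
    by (simp_all add: assms axis_def)
  define wt where "wt u = nw_form \<alpha> (Poly_Mapping.lookup (fst u) 0) + l * snd u" for u :: affine_nw
  have vs: "vector_space ((*) :: complex \<Rightarrow> complex \<Rightarrow> complex)"
    by standard (simp_all add: algebra_simps)
  have add: "wt (u + v) = wt u + wt v" for u v
    by (simp add: wt_def lookup_add nw_form_linear algebra_simps)
  have [simp]: "wt 0 = 0"
    by (simp add: wt_def nw_form_linear)
  have sum: "wt (\<Sum>i\<in>I. f i) = (\<Sum>i\<in>I. wt (f i))" for I and f :: "int \<Rightarrow> affine_nw"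
    by (induction I rule: infinite_finite_induct) (simp_all add: add)
  have scale: "wt (affine_scale r u) = r * wt u" for r u
    by (simp add: wt_def nw_form_sum algebra_simps)
  have "wt (affine_bracket u v) = 0" if "u \<in> affine_sub m" "v \<in> affine_sub m" for u v
  proof -
    have "wt (affine_term p q (Poly_Mapping.lookup (fst u) p) (Poly_Mapping.lookup (fst v) q)) = 0" for p q
    proof (cases "p + q = 0")
      case False
      then show ?thesis
        by (simp add: wt_def affine_term_def lookup_single nw_form_linear)
    next
      case True
      define x where "x = Poly_Mapping.lookup (fst u) p"
      define y where "y = Poly_Mapping.lookup (fst v) q"
      have x: "x $ NW_A \<noteq> 0 \<Longrightarrow> p \<ge> - m" "x $ NW_B \<noteq> 0 \<Longrightarrow> p \<ge> m"
          "x $ NW_C \<noteq> 0 \<Longrightarrow> p \<ge> 0" "x $ NW_D \<noteq> 0 \<Longrightarrow> p \<ge> 0"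
        and y: "y $ NW_A \<noteq> 0 \<Longrightarrow> q \<ge> - m" "y $ NW_B \<noteq> 0 \<Longrightarrow> q \<ge> m"
          "y $ NW_C \<noteq> 0 \<Longrightarrow> q \<ge> 0" "y $ NW_D \<noteq> 0 \<Longrightarrow> q \<ge> 0"
        using that by (simp_all add: affine_sub_def x_def y_def)
      have "x $ NW_A = 0 \<or> y $ NW_B = 0 \<or> p = - m"
        using x(1) y(2) True by force
      then have 1: "(of_int m + of_int p) * (x $ NW_A * y $ NW_B) = 0"
        by auto
      have "x $ NW_B = 0 \<or> y $ NW_A = 0 \<or> p = m"
        using x(2) y(1) True by force
      then have 2: "(of_int p - of_int m) * (x $ NW_B * y $ NW_A) = 0"
        by auto
      have "p = 0 \<or> x $ NW_C = 0 \<or> y $ NW_D = 0" "p = 0 \<or> x $ NW_D = 0 \<or> y $ NW_C = 0"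
        using x(3,4) y(3,4) True by force+
      then have 3: "of_int p * (x $ NW_C * y $ NW_D) = 0" "of_int p * (x $ NW_D * y $ NW_C) = 0"
        by auto
      have "wt (affine_term p q x y) = l * ((of_int m + of_int p) * (x $ NW_A * y $ NW_B)
        + (of_int p - of_int m) * (x $ NW_B * y $ NW_A)
        + of_int p * (x $ NW_C * y $ NW_D) + of_int p * (x $ NW_D * y $ NW_C))"
        using True by (simp add: wt_def affine_term_def nw_form_sum nw_bracket_nth \<alpha> algebra_simps)
      also have "\<dots> = 0"
        unfolding 1 2 3 by simp
      finally show ?thesis
        by (simp add: x_def y_def)
    qed
    then show ?thesis
      unfolding affine_bracket_superset[OF finite_keys order_refl finite_keys order_refl] sum
      by simp
  qed
  moreover have "one_dim_rep l \<alpha> u w = wt u * w" for u w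
    by (simp add: one_dim_rep_def wt_def)
  moreover have "Vector_Spaces.linear (*) (*) (one_dim_rep l \<alpha> u)" for u
    by (rule Vector_Spaces.linear_iff[THEN iffD2]) (simp add: vs one_dim_rep_def algebra_simps)
  ultimately show ?thesis
    by (simp add: lie_representation_def vs add scale algebra_simps)
qed

text \<open>
  The arguments are the level, the integer defining the subalgebra, and \<open>\<alpha>\<close>; meaningful when
  \<open>\<alpha>(c) = m l\<close>, so that \<open>one_dim_rep l \<alpha>\<close> is a representation of \<open>affine_sub m\<close>.
\<close>

definition affine_verma ::
    "complex \<Rightarrow> int \<Rightarrow> nw \<Rightarrow> (affine_nw free_algebra set,
       (affine_nw free_algebra set \<times> complex \<Rightarrow>\<^sub>0 int) set) module" where
  "affine_verma l m \<alpha> =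
     induced_module
       (enveloping_algebra affine_scale affine_bracket UNIV)
       (enveloping_algebra affine_scale affine_bracket (affine_sub m))
       (enveloping_inclusion affine_scale affine_bracket UNIV)
       (enveloping_module (*) (one_dim_rep l \<alpha>))"

end

(*
Spectral flow turns the defining relations of the module into a highest weight condition: shifting the
modes of a and b by -m and m, and those of c and d in degree 0 by scalars, one obtains operators x_n for
x in H_4, with [x_n, y_q] = [x,y]_{n+q} + n (x,y) delta_{n+q,0}, all of which kill the generating vector
when n >= 0. Irreducibility then follows from the operator
  L = b_0 a_0 + sum_{n>0} (a_{-n} b_n + b_{-n} a_n + c_{-n} d_n + d_{-n} c_n - c_{-n} c_n),
which multiplies a word of total weight s in the negative modes, applied to the generator, by s. In an
invariant subspace choose a nonzero vector of least possible weight s; positive modes kill it, and since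
a_0 acts locally nilpotently it may be chosen to be killed by a_0 too. Hence L kills it, so s = 0 and it
is a multiple of the generator.

That the module is nonzero needs half of the Poincare-Birkhoff-Witt theorem. For a Lie algebra that is
the direct sum of two subalgebras, and a character psi of the first, with x' the component of x in it,
  phi(x w) = phi(ad(x') w) + psi(x') phi(w),   phi(1) = 1,
defines by recursion on the length a functional on the tensor algebra that factors through the enveloping
algebra and satisfies phi(w x) = psi(x) phi(w) for x in the first subalgebra.
*)
theory Submission
  imports Defs
begin

section \<open>Irreducibility of highest weight modules\<close>

text \<open>The shift of modes costs a central term: the bracket of a in degree n - m with b in
  degree q + m carries n - m instead of n. Replacing c in degree 0 by c - m absorbs exactly this,
  and c - m kills the generator because c acts on it by m; hence the shift has to equal the
  eigenvalue of c. Afterwards c_0 acts as 0 on every word applied to the generator, which removes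
  c_0 d_0 from L and closes the telescoping sums below.

  Words of different weight are not known to be independent, so weights enter through a filtration:
  on the stage of weight at most s, L - s lands in the stage s - 1. If v is in the least stage that
  meets the subspace nontrivially and L v = 0, then s v lies in an earlier stage and in the
  subspace, so it is 0.

  The recursion for phi is forced: write x = x' + x''. If phi vanishes on products beginning with
  x'' and phi(w x') = psi(x') phi(w), then phi(x w) = phi(x' w) = phi([x', w]) + psi(x')
  phi(w).\<close>

lemma sum_int_shift_support:
  fixes f :: "int \<Rightarrow> 'b::ab_group_add"
  assumes "0 \<le> q" "q \<le> N" "\<And>n. N < n \<Longrightarrow> f n = 0"
  shows "(\<Sum>n=1..N. f (n + q)) = (\<Sum>n=1..N. f n) - (\<Sum>n=1..q. f n)"
proof -
  have "(\<Sum>n=1..N. f (n + q)) = (\<Sum>n=q+1..N+q. f n)"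
    by (rule sum.reindex_bij_witness[where i = "\<lambda>n. n - q" and j = "\<lambda>n. n + q"]) auto
  also have "\<dots> = (\<Sum>n=q+1..N. f n)"
    using assms by (intro sum.mono_neutral_right) auto
  also have "\<dots> = (\<Sum>n=1..N. f n) - (\<Sum>n=1..q. f n)"
  proof -
    have "{1..N} = {1..q} \<union> {q+1..N}" using assms by auto
    then have "(\<Sum>n=1..N. f n) = (\<Sum>n=1..q. f n) + (\<Sum>n=q+1..N. f n)"
      by (simp add: sum.union_disjoint)
    then show ?thesis by simp
  qed
  finally show ?thesis .
qed

text \<open>Reflection carries 1..q onto 0..q-1. It compares the segments 1..q left over by the
  preceding index shift for two families related by n -> q - n.\<close>

lemma sum_int_reflect:
  fixes f :: "int \<Rightarrow> 'b::ab_group_add"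
  assumes "0 \<le> q"
  shows "(\<Sum>n=1..q. f (q - n)) = (\<Sum>n=1..q. f n) + f 0 - f q"
proof -
  have "(\<Sum>n=1..q. f (q - n)) = (\<Sum>n=0..q-1. f n)"
    by (rule sum.reindex_bij_witness[where i = "\<lambda>n. q - n" and j = "\<lambda>n. q - n"]) auto
  also have "\<dots> + f q = (\<Sum>n=0..q. f n)"
  proof -
    have "{0..q} = insert q {0..q-1}" using assms by auto
    then show ?thesis by (simp add: add.commute)
  qed
  also have "\<dots> = (\<Sum>n=1..q. f n) + f 0"
  proof -
    have "{0..q} = insert 0 {1..q}" using assms by auto
    then show ?thesis by (simp add: add.commute)
  qed
  finally show ?thesis by (simp add: algebra_simps)
qed

lemma nw_basis_brackets:
  "nw_bracket nw_a nw_a = 0" "nw_bracket nw_a nw_b = nw_c" "nw_bracket nw_a nw_c = 0" "nw_bracket nw_a nw_d = - nw_a"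
  "nw_bracket nw_b nw_a = - nw_c" "nw_bracket nw_b nw_b = 0" "nw_bracket nw_b nw_c = 0" "nw_bracket nw_b nw_d = nw_b"
  "nw_bracket nw_c nw_a = 0" "nw_bracket nw_c nw_b = 0" "nw_bracket nw_c nw_c = 0" "nw_bracket nw_c nw_d = 0"
  "nw_bracket nw_d nw_a = nw_a" "nw_bracket nw_d nw_b = - nw_b" "nw_bracket nw_d nw_c = 0" "nw_bracket nw_d nw_d = 0"
  by (simp_all add: nw_eq_iff nw_bracket_nth axis_def)

lemma nw_basis_forms:
  "nw_form nw_a nw_a = 0" "nw_form nw_a nw_b = 1" "nw_form nw_a nw_c = 0" "nw_form nw_a nw_d = 0"
  "nw_form nw_b nw_a = 1" "nw_form nw_b nw_b = 0" "nw_form nw_b nw_c = 0" "nw_form nw_b nw_d = 0"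
  "nw_form nw_c nw_a = 0" "nw_form nw_c nw_b = 0" "nw_form nw_c nw_c = 0" "nw_form nw_c nw_d = 1"
  "nw_form nw_d nw_a = 0" "nw_form nw_d nw_b = 0" "nw_form nw_d nw_c = 1" "nw_form nw_d nw_d = 0"
  by (simp_all add: nw_form_sum axis_def)

lemma nw_basis_expansion:
  "x = x $ NW_A *s nw_a + x $ NW_B *s nw_b + x $ NW_C *s nw_c + x $ NW_D *s nw_d" for x :: nw
  by (simp add: nw_eq_iff axis_def)

text \<open>The modes are linear on the whole type, but the commutation relations are demanded on
  \<open>M\<close> only. In the application \<open>M\<close> is the subspace on which the central
  element acts as the identity.\<close>

locale nw_highest_weight = vector_space scale
  for scale :: "complex \<Rightarrow> 'v::ab_group_add \<Rightarrow> 'v" (infixr "\<cdot>" 75) +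
  fixes X :: "nw \<Rightarrow> int \<Rightarrow> 'v \<Rightarrow> 'v" and M :: "'v set" and v0 :: 'v
  assumes M: "subspace M"
    and X_M: "v \<in> M \<Longrightarrow> X x n v \<in> M"
    and X_add: "X x n (u + v) = X x n u + X x n v"
    and X_scale: "X x n (r \<cdot> v) = r \<cdot> X x n v"
    and X_add_left: "X (x + y) n v = X x n v + X y n v"
    and X_scale_left: "X (r *s x) n v = r \<cdot> X x n v"
    and X_commute: "v \<in> M \<Longrightarrow> X x n (X y q v) = X y q (X x n v) + X (nw_bracket x y) (n + q) v
          + (if n + q = 0 then of_int n * nw_form x y else 0) \<cdot> v"
    and v0_M: "v0 \<in> M"
    and X_v0: "n \<ge> 0 \<Longrightarrow> X x n v0 = 0"
begin

lemma X_zero [simp]: "X x n 0 = 0"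
  using X_scale[of x n 0 0] by simp

lemma X_zero_left [simp]: "X 0 n v = 0"
  using X_scale_left[of 0 0 n v] by (simp add: vector_space_over_itself.scale_zero_left)

lemma X_minus_left: "X (- x) n v = - X x n v"
  using X_add_left[of x "- x" n v] by (simp add: eq_neg_iff_add_eq_0 add.commute)

lemma X_minus: "X x n (- v) = - X x n v"
  using X_add[of x n v "- v"] by (simp add: eq_neg_iff_add_eq_0 add.commute)

lemma X_diff: "X x n (u - v) = X x n u - X x n v"
  using X_add[of x n u "- v"] by (simp add: X_minus)

lemma X_sum: "X x n (sum f S) = (\<Sum>i\<in>S. X x n (f i))"
  by (induction S rule: infinite_finite_induct) (simp_all add: X_add)

lemmas X_simps = X_add X_scale X_minus X_diff X_sum

abbreviation "a \<equiv> X nw_a"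
abbreviation "b \<equiv> X nw_b"
abbreviation "c \<equiv> X nw_c"
abbreviation "d \<equiv> X nw_d"

lemma commutators:
  assumes "v \<in> M"
  shows ab: "a n (b q v) = b q (a n v) + c (n + q) v + (if n + q = 0 then of_int n else 0) \<cdot> v"
    and ba: "b n (a q v) = a q (b n v) - c (n + q) v + (if n + q = 0 then of_int n else 0) \<cdot> v"
    and da: "d n (a q v) = a q (d n v) + a (n + q) v"
    and ad: "a n (d q v) = d q (a n v) - a (n + q) v"
    and db: "d n (b q v) = b q (d n v) - b (n + q) v"
    and bd: "b n (d q v) = d q (b n v) + b (n + q) v"
    and dc: "d n (c q v) = c q (d n v) + (if n + q = 0 then of_int n else 0) \<cdot> v"
    and cd: "c n (d q v) = d q (c n v) + (if n + q = 0 then of_int n else 0) \<cdot> v"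
    and aa: "a n (a q v) = a q (a n v)"
    and bb: "b n (b q v) = b q (b n v)"
    and cc: "c n (c q v) = c q (c n v)"
    and dd: "d n (d q v) = d q (d n v)"
    and ac: "a n (c q v) = c q (a n v)"
    and ca: "c n (a q v) = a q (c n v)"
    and bc: "b n (c q v) = c q (b n v)"
    and cb: "c n (b q v) = b q (c n v)"
  by (subst X_commute[OF assms], simp add: nw_basis_brackets nw_basis_forms X_minus_left)+

text \<open>
  Sugawara's operator. The summand \<open>c\<^sub>-\<^sub>n c\<^sub>n\<close> comes from the Killing form of the Lie algebra, which does not
  vanish on \<open>(d, d)\<close>.
\<close>

definition energy_summand :: "int \<Rightarrow> 'v \<Rightarrow> 'v" where
  "energy_summand n v = a (- n) (b n v) + b (- n) (a n v) + c (- n) (d n v) + d (- n) (c n v)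
     - c (- n) (c n v)"

text \<open>The cutoff \<open>N\<close> replaces an infinite sum: on a vector killed by all modes
  above \<open>N\<close>, raising \<open>N\<close> changes nothing. Where c_0 acts as 0,
  \<open>b 0 (a 0 v)\<close> is all that remains of the degree-zero part of Sugawara's
  operator.\<close>

definition energy :: "int \<Rightarrow> 'v \<Rightarrow> 'v" where
  "energy N v = b 0 (a 0 v) + (\<Sum>n=1..N. energy_summand n v)"

lemma energy_summand_linear:
  "energy_summand n (u + v) = energy_summand n u + energy_summand n v"
  "energy_summand n (r \<cdot> v) = r \<cdot> energy_summand n v"
  by (simp_all add: energy_summand_def X_simps algebra_simps)

lemma energy_linear:
  "energy N (u + v) = energy N u + energy N v"
  "energy N (r \<cdot> v) = r \<cdot> energy N v"
  by (simp_all add: energy_def energy_summand_linear X_simps sum.distrib algebra_simps scale_sum_right)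

text \<open>\<open>v_kill\<close> leaves room for q below the cutoff: modes of degree n - q with n >
  N kill v, so the shifted sums have no boundary terms at their upper end.\<close>

context
  fixes v :: 'v and q N :: int
  assumes v: "v \<in> M" and q: "1 \<le> q" "q \<le> N" and v_kill: "\<And>x n. n > N - q \<Longrightarrow> X x n v = 0"
    and c0: "c 0 v = 0"
begin

lemma sum_delta: "(\<Sum>n=1..N. (if n = q then r n else 0) \<cdot> u n) = r q \<cdot> u q"
proof -
  have "(\<Sum>n=1..N. (if n = q then r n else 0) \<cdot> u n) = (\<Sum>n=1..N. if n = q then r n \<cdot> u n else 0)"
    by (rule sum.cong) auto
  then show ?thesis using q by simp
qed

text \<open>Commuting \<open>a (- q)\<close> to the left produces differences of f and of g under n
  -> n + q. They telescope to sums over 1..q, which the reflection g n = f (q - n) reduces to f 0,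
  as f q contains c_0. The zero modes contribute - g q = - f 0, so only the contraction at n = q
  survives.\<close>

lemma energy_a: "energy N (a (- q) v) = a (- q) (energy N v) + of_int q \<cdot> a (- q) v"
proof -
  define f where "f n = a (- n) (c (n - q) v)" for n
  define g where "g n = c (- n) (a (n - q) v)" for n
  have S: "energy_summand n (a (- q) v) = a (- q) (energy_summand n v)
      + (f (n + q) - f n + (g n - g (n + q)) + (if n = q then of_int n else 0) \<cdot> a (- n) v)"
    if "n \<in> {1..N}" for n
  proof -
    have "a (- n) (b n (a (- q) v)) = a (- q) (a (- n) (b n v)) - f n
        + (if n = q then of_int n else 0) \<cdot> a (- n) v"
      using v by (simp add: ba X_M X_simps f_def aa[of _ "-n" "-q"])
    moreover have "b (- n) (a n (a (- q) v)) = a (- q) (b (- n) (a n v)) - g (n + q)"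
      using v q that by (simp add: aa[of v n "-q"] ba[of _ "-n" "-q"] X_M g_def algebra_simps)
    moreover have "c (- n) (d n (a (- q) v)) = a (- q) (c (- n) (d n v)) + g n"
      using v by (simp add: da X_M X_simps g_def ca[of "d n v"])
    moreover have "d (- n) (c n (a (- q) v)) = a (- q) (d (- n) (c n v)) + f (n + q)"
      using v by (simp add: ca[of v n "-q"] da X_M X_simps f_def algebra_simps)
    moreover have "c (- n) (c n (a (- q) v)) = a (- q) (c (- n) (c n v))"
      using v by (simp add: ca[of _ _ "-q"] X_M)
    ultimately show ?thesis
      unfolding energy_summand_def X_simps by (simp only:) (simp add: algebra_simps)
  qed
  have fg: "g n = f (q - n)" for n
    using v by (simp add: f_def g_def ac algebra_simps)
  have z: "f n = 0" "g n = 0" if "N < n" for n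
    using that v_kill by (simp_all add: f_def g_def)
  have "f q = 0" by (simp add: f_def c0)
  have b0: "b 0 (a 0 (a (- q) v)) = a (- q) (b 0 (a 0 v)) - g q"
    using v q by (simp add: aa[of v 0 "-q"] ba[of _ 0 "-q"] X_M g_def)
  have "(\<Sum>n=1..q. g n) = (\<Sum>n=1..q. f n) + f 0 - f q"
    unfolding fg using q by (intro sum_int_reflect) auto
  then have "(\<Sum>n=1..N. f (n + q) - f n + (g n - g (n + q))) = f 0"
    using q z \<open>f q = 0\<close> by (simp add: sum.distrib sum_subtractf sum_int_shift_support[of q N f] sum_int_shift_support[of q N g])
  then have "(\<Sum>n=1..N. energy_summand n (a (- q) v))
      = a (- q) (\<Sum>n=1..N. energy_summand n v) + f 0 + of_int q \<cdot> a (- q) v"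
    by (simp only: sum.cong[OF refl S] sum.distrib[of _ "\<lambda>n. (if n = q then of_int n else 0) \<cdot> a (- n) v"])
      (simp add: sum.distrib X_sum sum_delta[of of_int "\<lambda>n. a (- n) v"])
  then show ?thesis
    using b0 fg[of q] by (simp add: energy_def X_simps algebra_simps)
qed

text \<open>The mirror image of the case of a: the telescoped sums leave - f 0, and the zero modes
  compensate it by f 0.\<close>

lemma energy_b: "energy N (b (- q) v) = b (- q) (energy N v) + of_int q \<cdot> b (- q) v"
proof -
  define f where "f n = b (- n) (c (n - q) v)" for n
  define g where "g n = c (- n) (b (n - q) v)" for n
  have S: "energy_summand n (b (- q) v) = b (- q) (energy_summand n v)
      + (f n - f (n + q) + (g (n + q) - g n) + (if n = q then of_int n else 0) \<cdot> b (- n) v)"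
    if "n \<in> {1..N}" for n
  proof -
    have "b (- n) (a n (b (- q) v)) = b (- q) (b (- n) (a n v)) + f n
        + (if n = q then of_int n else 0) \<cdot> b (- n) v"
      using v by (simp add: ab X_M X_simps f_def bb[of _ "-n" "-q"])
    moreover have "a (- n) (b n (b (- q) v)) = b (- q) (a (- n) (b n v)) + g (n + q)"
      using v q that by (simp add: bb[of v n "-q"] ab[of _ "-n" "-q"] X_M g_def algebra_simps)
    moreover have "c (- n) (d n (b (- q) v)) = b (- q) (c (- n) (d n v)) - g n"
      using v by (simp add: db X_M X_simps g_def cb[of "d n v"])
    moreover have "d (- n) (c n (b (- q) v)) = b (- q) (d (- n) (c n v)) - f (n + q)"
      using v by (simp add: cb[of v n "-q"] db X_M X_simps f_def algebra_simps)
    moreover have "c (- n) (c n (b (- q) v)) = b (- q) (c (- n) (c n v))"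
      using v by (simp add: cb[of _ _ "-q"] X_M)
    ultimately show ?thesis
      unfolding energy_summand_def X_simps by (simp only:) (simp add: algebra_simps)
  qed
  have fg: "g n = f (q - n)" for n
    using v by (simp add: f_def g_def bc algebra_simps)
  have z: "f n = 0" "g n = 0" if "N < n" for n
    using that v_kill by (simp_all add: f_def g_def)
  have "f q = 0" by (simp add: f_def c0)
  have b0: "b 0 (a 0 (b (- q) v)) = b (- q) (b 0 (a 0 v)) + f 0"
    using v q by (simp add: ab[of _ 0 "-q"] bb[of _ 0 "-q"] X_M X_simps f_def)
  have "(\<Sum>n=1..q. g n) = (\<Sum>n=1..q. f n) + f 0 - f q"
    unfolding fg using q by (intro sum_int_reflect) auto
  then have "(\<Sum>n=1..N. f n - f (n + q) + (g (n + q) - g n)) = - f 0"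
    using q z \<open>f q = 0\<close> by (simp add: sum.distrib sum_subtractf sum_int_shift_support[of q N f] sum_int_shift_support[of q N g])
  then have "(\<Sum>n=1..N. energy_summand n (b (- q) v))
      = b (- q) (\<Sum>n=1..N. energy_summand n v) - f 0 + of_int q \<cdot> b (- q) v"
    by (simp only: sum.cong[OF refl S] sum.distrib[of _ "\<lambda>n. (if n = q then of_int n else 0) \<cdot> b (- n) v"])
      (simp add: sum.distrib X_sum sum_delta[of of_int "\<lambda>n. b (- n) v"])
  then show ?thesis
    using b0 by (simp add: energy_def X_simps algebra_simps)
qed

text \<open>c brackets to 0 with everything, so the only contribution is its contraction with d at n
  = q.\<close>

lemma energy_c: "energy N (c (- q) v) = c (- q) (energy N v) + of_int q \<cdot> c (- q) v"
proof -
  have S: "energy_summand n (c (- q) v) = c (- q) (energy_summand n v)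
      + (if n = q then of_int n else 0) \<cdot> c (- n) v"
    if "n \<in> {1..N}" for n
    using v q that by (simp add: energy_summand_def X_M X_simps
        ac[of _ _ "-q"] bc[of _ _ "-q"] dc[of _ _ "-q"] cc[of _ _ "-q"] algebra_simps)
  have "(\<Sum>n=1..N. energy_summand n (c (- q) v))
      = c (- q) (\<Sum>n=1..N. energy_summand n v) + of_int q \<cdot> c (- q) v"
    by (simp only: sum.cong[OF refl S] sum.distrib)
      (simp add: X_sum sum_delta[of of_int "\<lambda>n. c (- n) v"])
  then show ?thesis
    using v by (simp add: energy_def X_simps ac[of _ _ "-q"] bc[of _ _ "-q"] X_M algebra_simps)
qed

text \<open>Here reflection meets noncommuting factors: each of the q terms is off by
  \<open>c (- q) v\<close>. The total excess of q times \<open>c (- q) v\<close> is cancelled by the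
  correction term \<open>c (- n) (c n v)\<close> of the summand, contracted with d at n = q.\<close>

lemma energy_d: "energy N (d (- q) v) = d (- q) (energy N v) + of_int q \<cdot> d (- q) v"
proof -
  define f where "f n = a (- n) (b (n - q) v)" for n
  define g where "g n = b (- n) (a (n - q) v)" for n
  have S: "energy_summand n (d (- q) v) = d (- q) (energy_summand n v)
      + (f n - f (n + q) + (g (n + q) - g n)
        + (if n = q then of_int n else 0) \<cdot> (d (- n) v - c (- n) v))"
    if "n \<in> {1..N}" for n
  proof -
    have "b (- n) (a n (d (- q) v)) = d (- q) (b (- n) (a n v)) + g (n + q) - g n"
      using v by (simp add: ad bd[of _ "-n" "-q"] X_M X_simps g_def algebra_simps)
    moreover have "a (- n) (b n (d (- q) v)) = d (- q) (a (- n) (b n v)) - f (n + q) + f n"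
      using v by (simp add: bd ad[of _ "-n" "-q"] X_M X_simps f_def algebra_simps)
    moreover have "c (- n) (d n (d (- q) v)) = d (- q) (c (- n) (d n v))"
      using v q that by (simp add: dd[of v n "-q"] cd[of _ "-n" "-q"] X_M)
    moreover have "d (- n) (c n (d (- q) v)) = d (- q) (d (- n) (c n v)) + (if n = q then of_int n else 0) \<cdot> d (- n) v"
      using v by (simp add: cd[of v n "-q"] dd[of _ "-n" "-q"] X_M X_simps)
    moreover have "c (- n) (c n (d (- q) v)) = d (- q) (c (- n) (c n v)) + (if n = q then of_int n else 0) \<cdot> c (- n) v"
      using v q that by (simp add: cd[of _ _ "-q"] X_M X_simps)
    ultimately show ?thesis
      unfolding energy_summand_def X_simps by (simp only:) (simp add: algebra_simps)
  qed
  have fg: "g n = f (q - n) - c (- q) v" for n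
    using v q by (simp add: f_def g_def ba algebra_simps)
  have z: "f n = 0" "g n = 0" if "N < n" for n
    using that v_kill by (simp_all add: f_def g_def)
  have b0: "b 0 (a 0 (d (- q) v)) = d (- q) (b 0 (a 0 v)) - g 0 + g q"
    using v by (simp add: ad bd[of _ 0 "-q"] X_M X_simps g_def algebra_simps)
  have "(\<Sum>n=1..q. f (q - n)) = (\<Sum>n=1..q. f n) + f 0 - f q"
    using q by (intro sum_int_reflect) auto
  then have "(\<Sum>n=1..q. g n) = (\<Sum>n=1..q. f n) + f 0 - f q - of_int q \<cdot> c (- q) v"
    unfolding fg using q by (simp add: sum_subtractf sum_constant_scale)
  then have "(\<Sum>n=1..N. f n - f (n + q) + (g (n + q) - g n)) = f q - f 0 + of_int q \<cdot> c (- q) v"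
    using q z by (simp add: sum.distrib sum_subtractf sum_int_shift_support[of q N f] sum_int_shift_support[of q N g])
  then have "(\<Sum>n=1..N. energy_summand n (d (- q) v))
      = d (- q) (\<Sum>n=1..N. energy_summand n v) + f q - f 0 + of_int q \<cdot> d (- q) v"
    by (simp only: sum.cong[OF refl S] sum.distrib[of _ "\<lambda>n. (if n = q then of_int n else 0) \<cdot> (d (- n) v - c (- n) v)"])
      (simp add: sum.distrib sum_subtractf X_sum sum_delta[of of_int "\<lambda>n. d (- n) v - c (- n) v"], simp add: algebra_simps)
  then show ?thesis
    using b0 unfolding fg[of 0] fg[of q] energy_def X_simps
    by (simp only:) (simp add: algebra_simps)
qed

lemma energy_X: "energy N (X y (- q) v) = X y (- q) (energy N v) + of_int q \<cdot> X y (- q) v"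
proof -
  have *: "X y (- q) u = y $ NW_A \<cdot> a (- q) u + y $ NW_B \<cdot> b (- q) u + y $ NW_C \<cdot> c (- q) u
      + y $ NW_D \<cdot> d (- q) u" for u
    by (subst nw_basis_expansion) (simp add: X_add_left X_scale_left)
  show ?thesis
    unfolding * by (simp add: energy_linear energy_a energy_b energy_c energy_d algebra_simps)
qed

end


section \<open>Filtration by the total weight of words\<close>

inductive word_vector :: "int \<Rightarrow> 'v \<Rightarrow> bool" where
  vacuum: "word_vector 0 v0"
| letter: "word_vector s v \<Longrightarrow> 1 \<le> q \<Longrightarrow> word_vector (s + q) (X x (- q) v)"

text \<open>Taking all weights up to s avoids deciding whether words of different weight are
  linearly independent.\<close>

definition U :: "int \<Rightarrow> 'v set" where
  "U s = span {v. \<exists>t\<le>s. word_vector t v}"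

lemma word_vector_ge_0: "word_vector s v \<Longrightarrow> 0 \<le> s"
  by (induction rule: word_vector.induct) auto

lemma word_vector_M: "word_vector s v \<Longrightarrow> v \<in> M"
  by (induction rule: word_vector.induct) (auto intro: v0_M X_M)

lemma subspace_U: "subspace (U s)"
  by (simp add: U_def)

lemma U_mono: "s \<le> t \<Longrightarrow> U s \<subseteq> U t"
  unfolding U_def by (rule span_mono) (auto intro: order_trans)

lemma word_vector_U: "word_vector t v \<Longrightarrow> t \<le> s \<Longrightarrow> v \<in> U s"
  unfolding U_def by (rule span_base) auto

lemma U_neg: "s < 0 \<Longrightarrow> U s = {0}"
proof -
  assume "s < 0"
  then have "{v. \<exists>t\<le>s. word_vector t v} = {}"
    using word_vector_ge_0 by force
  then show ?thesis by (simp only: U_def span_empty)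
qed

lemma subspace_preimage_X:
  assumes "subspace S" shows "subspace {v. X x n v \<in> S}"
  using assms by (auto simp: subspace_def X_simps)

lemma U_induct [consumes 1, case_names subspace word]:
  assumes "v \<in> U s" "subspace {v. P v}" "\<And>t v. t \<le> s \<Longrightarrow> word_vector t v \<Longrightarrow> P v"
  shows "P v"
proof -
  have "U s \<subseteq> {v. P v}"
    unfolding U_def by (rule span_minimal) (use assms in auto)
  then show ?thesis using assms(1) by auto
qed

lemma U_subset_M: "U s \<subseteq> M"
  unfolding U_def by (rule span_minimal) (auto intro: word_vector_M M)

lemma X_neg_U:
  assumes "v \<in> U s" "q \<ge> 1" shows "X x (- q) v \<in> U (s + q)"
  using assms(1)
proof (induction rule: U_induct)
  case subspace
  show ?case by (rule subspace_preimage_X) (rule subspace_U)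
next
  case (word t v)
  then show ?case using letter[of t v q x] assms(2) by (auto intro: word_vector_U)
qed

text \<open>A nonnegative mode is commuted past the first letter and by induction on to the vacuum,
  which it kills. The contraction term appears only for n = q, where the target stage is that of v
  itself.\<close>

lemma X_word_vector: "word_vector s v \<Longrightarrow> X x n v \<in> U (s - n)"
proof (induction arbitrary: x n rule: word_vector.induct)
  case vacuum
  show ?case
  proof (cases "0 \<le> n")
    case True
    then show ?thesis by (simp add: X_v0 subspace_0 subspace_U)
  next
    case False
    then show ?thesis using letter[OF word_vector.vacuum, of "- n" x] by (auto intro: word_vector_U)
  qed
next
  case (letter s v q y)
  show ?case
  proof (cases "0 \<le> n")
    case False
    then show ?thesis
      using word_vector.letter[OF word_vector.letter[OF letter(1,2)], of "- n" x y] by (auto intro: word_vector_U)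
  next
    case True
    have "v \<in> M" using letter(1) by (rule word_vector_M)
    moreover have "X y (- q) (X x n v) \<in> U (s + q - n)"
      using X_neg_U[OF letter(3)[of x n] letter(2), of y] by (simp add: algebra_simps)
    moreover have "X (nw_bracket x y) (n - q) v \<in> U (s + q - n)"
      using letter(3)[of "nw_bracket x y" "n - q"] by (simp add: algebra_simps)
    moreover have "(if n + - q = 0 then of_int n * nw_form x y else 0) \<cdot> v \<in> U (s + q - n)"
      using word_vector_U[OF letter(1)] by (auto intro: subspace_scale[OF subspace_U] subspace_0[OF subspace_U])
    ultimately show ?thesis
      by (simp only: X_commute[of v x n y "- q"] diff_conv_add_uminus) (intro subspace_add[OF subspace_U])
  qed
qed

lemma X_U:
  assumes "v \<in> U s" shows "X x n v \<in> U (s - n)"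
  using assms
proof (induction rule: U_induct)
  case subspace
  show ?case by (rule subspace_preimage_X) (rule subspace_U)
next
  case (word t v)
  then show ?case using X_word_vector[of t v x n] U_mono[of "t - n" "s - n"] by auto
qed

lemma X_kill_U: "v \<in> U s \<Longrightarrow> s < n \<Longrightarrow> X x n v = 0"
  using X_U[of v s x n] U_neg[of "s - n"] by auto

text \<open>c is central in the finite-dimensional algebra, and the contraction with a mode of
  degree 0 has coefficient 0, so c_0 commutes with every letter. This supplies the assumption
  \<open>c0\<close> of the energy computations.\<close>

lemma c0_word_vector: "word_vector s v \<Longrightarrow> c 0 v = 0"
proof (induction rule: word_vector.induct)
  case vacuum
  show ?case by (simp add: X_v0)
next
  case (letter s v q y)
  have "nw_bracket nw_c y = 0"
    by (simp add: nw_eq_iff nw_bracket_nth axis_def)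
  then show ?case
    using X_commute[OF word_vector_M[OF letter(1)], of nw_c 0 y "- q"] letter by simp
qed

lemma energy_word_vector: "word_vector s v \<Longrightarrow> s \<le> N \<Longrightarrow> energy N v = of_int s \<cdot> v"
proof (induction arbitrary: N rule: word_vector.induct)
  case vacuum
  then show ?case by (simp add: energy_def energy_summand_def X_v0)
next
  case (letter s v q y)
  \<comment> \<open>As s + q \<le> N, a mode above N - q exceeds the weight s of v.\<close>
  have "X x n v = 0" if "N - q < n" for x n
    using that letter.prems word_vector_U[OF letter(1), of "s"] by (intro X_kill_U[of v s]) auto
  then have "energy N (X y (- q) v) = X y (- q) (energy N v) + of_int q \<cdot> X y (- q) v"
    using letter word_vector_ge_0[OF letter(1)]
    by (intro energy_X) (auto intro: word_vector_M c0_word_vector)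
  then show ?case
    using letter by (simp add: X_scale algebra_simps)
qed

text \<open>Words of weight exactly s are eigenvectors with eigenvalue s; a word of smaller weight t
  is multiplied by t - s and lies in the stage below anyway.\<close>

lemma energy_U:
  assumes "v \<in> U s" "s \<le> N" shows "energy N v - of_int s \<cdot> v \<in> U (s - 1)"
  using assms(1)
proof (induction rule: U_induct)
  case subspace
  show ?case
    unfolding subspace_def
  proof (intro conjI ballI allI; clarsimp simp only: mem_Collect_eq)
    show "energy N 0 - of_int s \<cdot> 0 \<in> U (s - 1)"
      using energy_linear(2)[of N 0 0] by (simp add: subspace_0 subspace_U)
  next
    fix x y assume "energy N x - of_int s \<cdot> x \<in> U (s - 1)" "energy N y - of_int s \<cdot> y \<in> U (s - 1)"
    from subspace_add[OF subspace_U this] show "energy N (x + y) - of_int s \<cdot> (x + y) \<in> U (s - 1)"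
      by (simp add: energy_linear algebra_simps)
  next
    fix r x assume "energy N x - of_int s \<cdot> x \<in> U (s - 1)"
    from subspace_scale[OF subspace_U this, of r] show "energy N (r \<cdot> x) - of_int s \<cdot> (r \<cdot> x) \<in> U (s - 1)"
      by (simp add: energy_linear algebra_simps)
  qed
next
  case (word t v)
  then have "energy N v - of_int s \<cdot> v = of_int (t - s) \<cdot> v"
    using assms(2) by (simp add: energy_word_vector algebra_simps)
  moreover have "of_int (t - s) \<cdot> v \<in> U (s - 1)"
  proof (cases "t = s")
    case False
    then show ?thesis using word by (intro subspace_scale[OF subspace_U] word_vector_U) auto
  qed (simp add: subspace_0 subspace_U)
  ultimately show ?case by simp
qed

section \<open>Local nilpotency of the zero mode of a\<close>

definition a0_nilpotent :: "'v \<Rightarrow> bool" where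
  "a0_nilpotent v \<longleftrightarrow> (\<exists>j. (a 0 ^^ j) v = 0)"

lemma a0_pow_linear:
  "(a 0 ^^ n) (u + v) = (a 0 ^^ n) u + (a 0 ^^ n) v" "(a 0 ^^ n) (r \<cdot> v) = r \<cdot> (a 0 ^^ n) v"
  by (induction n) (simp_all add: X_add X_scale)

lemma a0_pow_mono:
  assumes "(a 0 ^^ i) u = 0" "i \<le> j" shows "(a 0 ^^ j) u = 0"
proof -
  have "(a 0 ^^ n) 0 = 0" for n
    by (induction n) simp_all
  moreover obtain k where "j = k + i"
    using assms(2) by (metis add.commute le_Suc_ex)
  ultimately show ?thesis
    using assms(1) by (simp add: funpow_add)
qed

lemma a0_nilpotent_subspace: "subspace {v. a0_nilpotent v}"
proof (rule subspaceI; unfold mem_Collect_eq)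
  show "a0_nilpotent 0"
    unfolding a0_nilpotent_def by (rule exI[of _ 0]) simp
next
  fix u v assume "a0_nilpotent u" "a0_nilpotent v"
  then obtain i j where "(a 0 ^^ i) u = 0" "(a 0 ^^ j) v = 0"
    by (auto simp: a0_nilpotent_def)
  then have "(a 0 ^^ max i j) (u + v) = 0"
    using a0_pow_mono[of i u "max i j"] a0_pow_mono[of j v "max i j"] by (simp add: a0_pow_linear)
  then show "a0_nilpotent (u + v)"
    by (auto simp: a0_nilpotent_def)
next
  fix r v assume "a0_nilpotent v"
  then show "a0_nilpotent (r \<cdot> v)"
    by (auto simp: a0_nilpotent_def a0_pow_linear)
qed

lemma a0_nilpotent_step: "a0_nilpotent (a 0 v) \<Longrightarrow> a0_nilpotent v"
  unfolding a0_nilpotent_def by (metis comp_apply funpow_Suc_right)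

text \<open>By the Leibniz rule, a_0 applied to y_{-q} v gives y_{-q} (a_0 v), with smaller j, plus
  [a, y]_{-q} v, with smaller k. This calls for an induction on k with one on j inside it.\<close>

lemma a0_nilpotent_letter:
  assumes "v \<in> M" "(a 0 ^^ j) v = 0" "(nw_bracket nw_a ^^ k) y = 0" "1 \<le> q"
  shows "a0_nilpotent (X y (- q) v)"
  using assms
proof (induction k arbitrary: j v y)
  case 0
  then show ?case using subspace_0[OF a0_nilpotent_subspace] by simp
next
  case (Suc k)
  note outer = Suc.IH
  have ad: "(nw_bracket nw_a ^^ k) (nw_bracket nw_a y) = 0"
    using Suc.prems(3) by (simp add: funpow_Suc_right del: funpow.simps)
  show ?case
    using Suc.prems(1,2)
  proof (induction j arbitrary: v)
    case 0
    then show ?case using subspace_0[OF a0_nilpotent_subspace] by simp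
  next
    case (Suc j)
    have "(a 0 ^^ j) (a 0 v) = 0"
      using Suc.prems(2) by (simp add: funpow_Suc_right del: funpow.simps)
    then have "a0_nilpotent (X y (- q) (a 0 v))"
      using Suc.IH[of "a 0 v"] Suc.prems(1) X_M by blast
    moreover have "a0_nilpotent (X (nw_bracket nw_a y) (- q) v)"
      using Suc.prems ad \<open>1 \<le> q\<close> by (intro outer[of v "Suc j"])
    ultimately have "a0_nilpotent (X y (- q) (a 0 v) + X (nw_bracket nw_a y) (- q) v)"
      using subspace_add[OF a0_nilpotent_subspace] by auto
    moreover have "a 0 (X y (- q) v) = X y (- q) (a 0 v) + X (nw_bracket nw_a y) (- q) v"
      using X_commute[OF Suc.prems(1), of nw_a 0 y "- q"] \<open>1 \<le> q\<close> by simp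
    ultimately show ?case
      by (intro a0_nilpotent_step[of "X y (- q) v"]) simp
  qed
qed

lemma a0_nilpotent_U:
  assumes "v \<in> U s" shows "a0_nilpotent v"
  using assms
proof (induction rule: U_induct)
  case (word t v)
  from word(2) show ?case
  proof (induction rule: word_vector.induct)
    case vacuum
    show ?case unfolding a0_nilpotent_def by (rule exI[of _ 1]) (simp add: X_v0)
  next
    case (letter s v q y)
    \<comment> \<open>Bracketing with a sends b to c and d to -a, and kills a and c, hence is
      nilpotent.\<close>
    have "(nw_bracket nw_a ^^ 3) y = 0"
      by (simp add: numeral_3_eq_3 nw_eq_iff nw_bracket_nth axis_def)
    then show ?case
      using letter a0_nilpotent_letter[of v _ 3 y q] word_vector_M by (auto simp: a0_nilpotent_def)
  qed
qed (rule a0_nilpotent_subspace)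

lemma subspace_UN_U: "subspace (\<Union>s. U s)"
proof (rule subspaceI)
  fix u v assume "u \<in> (\<Union>s. U s)" "v \<in> (\<Union>s. U s)"
  then obtain s t where "u \<in> U s" "v \<in> U t" by blast
  then have "u \<in> U (max s t)" "v \<in> U (max s t)"
    using U_mono[of s "max s t"] U_mono[of t "max s t"] by auto
  then show "u + v \<in> (\<Union>s. U s)"
    using subspace_add[OF subspace_U] by blast
qed (use subspace_0[OF subspace_U] subspace_scale[OF subspace_U] in blast)+

theorem vacuum_in_invariant_subspace:
  assumes W: "subspace W" "\<And>x n v. v \<in> W \<Longrightarrow> X x n v \<in> W"
    and w: "w \<in> W" "w \<in> U t" "w \<noteq> 0"
  shows "v0 \<in> W"
proof -
  define P where "P s \<longleftrightarrow> (\<exists>w \<in> W \<inter> U (int s). w \<noteq> 0)" for s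
  have "0 \<le> t"
    using w U_neg by force
  then have "P (nat t)"
    using w by (auto simp: P_def)
  define s where "s = (LEAST s. P s)"
  have "P s"
    unfolding s_def using \<open>P (nat t)\<close> by (rule LeastI)
  then obtain u where u: "u \<in> W" "u \<in> U (int s)" "u \<noteq> 0"
    by (auto simp: P_def)
  \<comment> \<open>By minimality of s, W meets every earlier stage in 0 only.\<close>
  have small: "z = 0" if "z \<in> W" "z \<in> U r" "r < int s" for z r
  proof (rule ccontr)
    assume "z \<noteq> 0"
    then have "0 \<le> r" using that U_neg by force
    then have "P (nat r)" using that \<open>z \<noteq> 0\<close> by (auto simp: P_def)
    then have "s \<le> nat r" unfolding s_def by (rule Least_le)
    then show False using that(3) \<open>0 \<le> r\<close> by simp
  qed
  define j where "j = (LEAST j. (a 0 ^^ j) u = 0)"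
  have "\<exists>j. (a 0 ^^ j) u = 0"
    using a0_nilpotent_U[OF u(2)] by (simp add: a0_nilpotent_def)
  then have j: "(a 0 ^^ j) u = 0"
    unfolding j_def by (rule LeastI_ex)
  then obtain i where i: "j = Suc i"
    using u(3) by (cases j) auto
  \<comment> \<open>The last nonzero vector among the iterates of a_0 on u. As a_0 has degree 0, v
    stays in the stage s, and in W.\<close>
  define v where "v = (a 0 ^^ i) u"
  have "v \<noteq> 0"
    using not_less_Least[of i "\<lambda>j. (a 0 ^^ j) u = 0"] i by (auto simp: v_def j_def)
  have "(a 0 ^^ n) u \<in> W \<inter> U (int s)" for n
    by (induction n) (use u W(2) X_U[of _ "int s" nw_a 0] in auto)
  then have v: "v \<in> W" "v \<in> U (int s)"
    by (auto simp: v_def)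
  have "X x n v = 0" if "1 \<le> n" for x n
    using small[OF W(2)[OF v(1)] X_U[OF v(2)]] that by simp
  moreover have "a 0 v = 0"
    using j by (simp add: i v_def)
  ultimately have "energy (int s) v = 0"
    by (simp add: energy_def energy_summand_def)
  \<comment> \<open>\<open>energy_U\<close> compares L v = 0 with s v modulo the stage s -
    1.\<close>
  then have "of_int (int s) \<cdot> v \<in> U (int s - 1)"
    using subspace_neg[OF subspace_U energy_U[OF v(2) order_refl]] by simp
  then have "of_int (int s) \<cdot> v = 0"
    using small[of "of_int (int s) \<cdot> v" "int s - 1"] subspace_scale[OF W(1) v(1)] by simp
  then have "s = 0"
    using \<open>v \<noteq> 0\<close> by simp
  \<comment> \<open>A nonempty word has positive weight.\<close>
  moreover have "U 0 \<subseteq> span {v0}"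
  proof -
    have "x = v0" if "word_vector t x" "t \<le> 0" for t x
      using that word_vector_ge_0 by (cases rule: word_vector.cases) force+
    then show ?thesis
      unfolding U_def by (intro span_minimal) (auto intro: span_base)
  qed
  ultimately obtain r where "v = r \<cdot> v0"
    using v(2) by (auto simp: span_singleton)
  then have "v0 = inverse r \<cdot> v"
    using \<open>v \<noteq> 0\<close> by auto
  then show ?thesis
    using subspace_scale[OF W(1) v(1)] by simp
qed

end

section \<open>Functionals on the enveloping algebra\<close>

definition linear_extension :: "(complex \<Rightarrow> 'v::ab_group_add \<Rightarrow> 'v) \<Rightarrow> ('a \<Rightarrow> 'v) \<Rightarrow> ('a \<Rightarrow>\<^sub>0 complex) \<Rightarrow> 'v" where
  "linear_extension sc f p = (\<Sum>w\<in>Poly_Mapping.keys p. sc (Poly_Mapping.lookup p w) (f w))"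

abbreviation word :: "'g list \<Rightarrow> 'g free_algebra" where
  "word w \<equiv> Poly_Mapping.single (Word w) 1"

locale complex_vector_space = vector_space scale
  for scale :: "complex \<Rightarrow> 'v::ab_group_add \<Rightarrow> 'v"
begin

lemma linear_extension_superset:
  assumes "finite S" "Poly_Mapping.keys p \<subseteq> S"
  shows "linear_extension scale f p = (\<Sum>w\<in>S. scale (Poly_Mapping.lookup p w) (f w))"
  unfolding linear_extension_def using assms
  by (intro sum.mono_neutral_left) (auto simp: in_keys_iff)

lemma linear_extension_zero [simp]: "linear_extension scale f 0 = 0"
  by (simp add: linear_extension_def)

lemma linear_extension_single [simp]: "linear_extension scale f (Poly_Mapping.single w r) = scale r (f w)"
  by (subst linear_extension_superset[of "{w}"]) auto

lemma linear_extension_add: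
  "linear_extension scale f (p + q) = linear_extension scale f p + linear_extension scale f q"
proof -
  let ?S = "Poly_Mapping.keys p \<union> Poly_Mapping.keys q"
  have "Poly_Mapping.keys (p + q) \<subseteq> ?S" by (rule Poly_Mapping.keys_add)
  then show ?thesis
    by (simp add: linear_extension_superset[of ?S] lookup_add scale_left_distrib sum.distrib)
qed

lemma linear_extension_uminus: "linear_extension scale f (- p) = - linear_extension scale f p"
  using linear_extension_add[of f p "- p"] by (simp add: eq_neg_iff_add_eq_0 add.commute)

lemma linear_extension_diff:
  "linear_extension scale f (p - q) = linear_extension scale f p - linear_extension scale f q"
  using linear_extension_add[of f p "- q"] by (simp add: linear_extension_uminus)

end

lemma poly_mapping_single_induct [case_names zero single add]:
  fixes p :: "'a \<Rightarrow>\<^sub>0 'b::monoid_add"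
  assumes "P 0" "\<And>w r. P (Poly_Mapping.single w r)" "\<And>p q. P p \<Longrightarrow> P q \<Longrightarrow> P (p + q)"
  shows "P p"
proof (induction p rule: update_induct)
  case const
  then show ?case using assms by blast
next
  case (update f a b)
  have "Poly_Mapping.update a b f = f + Poly_Mapping.single a b"
    using update by (intro poly_mapping_eqI) (auto simp: lookup_update lookup_add lookup_single in_keys_iff)
  then show ?case using assms(3)[OF update(3) assms(2)[of a b]] by simp
qed

context complex_vector_space begin

lemma linear_extension_scalar_mult:
  "linear_extension scale f (Poly_Mapping.single 0 r * p) = scale r (linear_extension scale f p)"
  for f :: "'c::monoid_add \<Rightarrow> 'v"
  by (induction p rule: poly_mapping_single_induct)
    (simp_all add: mult_single distrib_left linear_extension_add scale_right_distrib)

lemma linear_extension_linear_id: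
  assumes "\<And>p q. g (p + q) = g p + g q" "\<And>w r. g (Poly_Mapping.single w r) = scale r (f w)"
  shows "g p = linear_extension scale f p"
proof -
  have "g 0 = 0" using assms(1)[of 0 0] by simp
  then show ?thesis
    by (induction p rule: poly_mapping_single_induct) (simp_all add: assms linear_extension_add)
qed

end

definition free_scale :: "complex \<Rightarrow> 'g free_algebra \<Rightarrow> 'g free_algebra" where
  "free_scale r p = Poly_Mapping.single 0 r * p"

lemma vector_space_free_scale: "vector_space (free_scale :: complex \<Rightarrow> 'g free_algebra \<Rightarrow> _)"
  by standard (simp_all add: free_scale_def distrib_left distrib_right single_add
      single_one mult_single flip: mult.assoc)

lemma single_scalar_commute: "Poly_Mapping.single 0 r * p = p * Poly_Mapping.single 0 (r::complex)"
  for p :: "'a::monoid_add \<Rightarrow>\<^sub>0 complex"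
  by (induction p rule: poly_mapping_single_induct)
    (simp_all add: mult_single distrib_left distrib_right mult.commute)

lemma mult_scalar_left: "p * (Poly_Mapping.single 0 r * q) = Poly_Mapping.single 0 r * (p * q)"
  for p q :: "'a::monoid_add \<Rightarrow>\<^sub>0 complex"
  by (simp only: mult.assoc[symmetric] single_scalar_commute[of r p])

lemma word_append: "word (u @ v) = word u * word v"
  by (simp add: mult_single plus_free_monoid_def)

lemma word_Cons: "word (x # w) = gen x * word w"
  by (simp add: mult_single plus_free_monoid_def gen_def)

lemma word_Nil: "word [] = 1"
  by (simp add: single_one flip: zero_free_monoid_def)

lemma single_word: "Poly_Mapping.single w r = Poly_Mapping.single 0 r * word (letters w)"
  by (simp add: mult_single)

lemma free_algebra_induct [case_names word add scale]:
  assumes "\<And>w. P (word w)" "\<And>p q. P p \<Longrightarrow> P q \<Longrightarrow> P (p + q)"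
    "\<And>r p. P p \<Longrightarrow> P (Poly_Mapping.single 0 r * p)"
  shows "P p"
proof (induction p rule: poly_mapping_single_induct)
  case zero
  then show ?case using assms(3)[OF assms(1), of 0] by simp
next
  case (single w r)
  then show ?case using assms(3)[OF assms(1)] by (subst single_word)
qed (rule assms(2))

interpretation free: complex_vector_space "free_scale :: complex \<Rightarrow> 'g free_algebra \<Rightarrow> _"
  by (rule complex_vector_space.intro) (rule vector_space_free_scale)

lemma vector_space_complex: "vector_space ((*) :: complex \<Rightarrow> complex \<Rightarrow> complex)"
  by standard (simp_all add: algebra_simps)

section \<open>Derivations of the free algebra\<close>

primrec letterwise :: "('g \<Rightarrow> 'g) \<Rightarrow> 'g list \<Rightarrow> 'g list list" where
  "letterwise D [] = []"
| "letterwise D (y # w) = (D y # w) # map ((#) y) (letterwise D w)"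

lemma length_letterwise: "v \<in> set (letterwise D w) \<Longrightarrow> length v = length w"
  by (induction w arbitrary: v) auto

text \<open>Distinct letters are independent generators, so any map \<open>D\<close> of letters,
  linear or not, extends by the Leibniz rule.\<close>

definition derivation :: "('g \<Rightarrow> 'g) \<Rightarrow> 'g free_algebra \<Rightarrow> 'g free_algebra" where
  "derivation D = linear_extension free_scale (\<lambda>w. \<Sum>v\<leftarrow>letterwise D (letters w). word v)"

lemma derivation_word: "derivation D (word w) = (\<Sum>v\<leftarrow>letterwise D w. word v)"
  by (simp add: derivation_def)

lemma derivation_add: "derivation D (p + q) = derivation D p + derivation D q"
  by (simp add: derivation_def free.linear_extension_add)

lemma derivation_diff: "derivation D (p - q) = derivation D p - derivation D q"
  by (simp add: derivation_def free.linear_extension_diff)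

lemma derivation_scale: "derivation D (Poly_Mapping.single 0 r * p) = Poly_Mapping.single 0 r * derivation D p"
  by (simp add: derivation_def free.linear_extension_scalar_mult free_scale_def)

lemma derivation_gen [simp]: "derivation D (gen x) = gen (D x)"
  by (simp add: gen_def derivation_word)

lemma derivation_zero [simp]: "derivation D 0 = 0"
  by (simp add: derivation_def)

lemma derivation_one [simp]: "derivation D 1 = 0"
  using derivation_word[of D "[]"] by (simp add: word_Nil)

lemma sum_list_word_Cons: "sum_list (map (word \<circ> (#) y) vs) = gen y * (\<Sum>v\<leftarrow>vs. word v)"
  by (induction vs) (simp_all add: word_Cons distrib_left)

lemma derivation_gen_mult: "derivation D (gen y * p) = gen (D y) * p + gen y * derivation D p"
proof (induction p rule: free_algebra_induct)
  case (word w)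
  show ?case
    by (simp add: derivation_word sum_list_word_Cons word_Cons[of "D y"] flip: word_Cons[of y])
next
  case (add p q)
  then show ?case by (simp add: distrib_left derivation_add)
next
  case (scale r p)
  then show ?case
    by (simp add: mult_scalar_left derivation_scale distrib_left)
qed

lemma derivation_mult: "derivation D (p * q) = derivation D p * q + p * derivation D q"
proof (induction p rule: free_algebra_induct)
  case (word w)
  show ?case
    by (induction w) (simp_all add: word_Nil word_Cons mult.assoc derivation_gen_mult distrib_left distrib_right)
next
  case (add p p')
  then show ?case by (simp add: distrib_right derivation_add)
next
  case (scale r p)
  then show ?case by (simp add: mult.assoc derivation_scale distrib_left)
qed

text \<open>
  \<open>proj\<close> is the projection onto a subalgebra along a complementary subalgebra, and \<open>\<psi>\<close> is a character
  of its image; the values of \<open>\<psi>\<close> elsewhere are irrelevant.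
\<close>

locale lie_character_extension = complex_lie_algebra scale bracket
  for scale :: "complex \<Rightarrow> 'g::ab_group_add \<Rightarrow> 'g" and bracket :: "'g \<Rightarrow> 'g \<Rightarrow> 'g" +
  fixes proj :: "'g \<Rightarrow> 'g" and \<psi> :: "'g \<Rightarrow> complex"
  assumes proj_add: "proj (x + y) = proj x + proj y"
    and proj_scale: "proj (scale r x) = scale r (proj x)"
    and proj_proj: "proj (proj x) = proj x"
    and proj_bracket: "proj (bracket (proj x) (proj y)) = bracket (proj x) (proj y)"
    and proj_bracket_complement: "proj (bracket (x - proj x) (y - proj y)) = 0"
    and \<psi>_add: "\<psi> (proj x + proj y) = \<psi> (proj x) + \<psi> (proj y)"
    and \<psi>_scale: "\<psi> (scale r (proj x)) = r * \<psi> (proj x)"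
    and \<psi>_bracket: "\<psi> (bracket (proj x) (proj y)) = 0"
begin

lemma proj_zero [simp]: "proj 0 = 0"
  using proj_add[of 0 0] by simp

lemma \<psi>_zero [simp]: "\<psi> 0 = 0"
  using \<psi>_add[of 0 0] by simp

lemma bracket_zero [simp]: "bracket 0 x = 0" "bracket x 0 = 0"
  using bracket_add_left[of 0 0 x] bracket_add_right[of x 0 0] by simp_all

lemma bracket_anti: "bracket y x = - bracket x y"
proof -
  have "bracket x y + bracket y x = bracket (x + y) (x + y)"
    unfolding bracket_add_left bracket_add_right by (simp add: bracket_self)
  then have "bracket x y + bracket y x = 0"
    by (simp add: bracket_self)
  then show ?thesis by (simp add: eq_neg_iff_add_eq_0 add.commute)
qed

lemma bracket_minus_right: "bracket x (- y) = - bracket x y"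
  using bracket_add_right[of x y "- y"] by (simp add: eq_neg_iff_add_eq_0 add.commute)

lemma bracket_derivation: "bracket z (bracket x y) = bracket (bracket z x) y + bracket x (bracket z y)"
proof -
  have "bracket x (bracket y z) = - bracket x (bracket z y)"
    using bracket_anti[of y z] by (simp add: bracket_minus_right)
  moreover have "bracket y (bracket z x) = - bracket (bracket z x) y"
    by (rule bracket_anti)
  ultimately show ?thesis
    using jacobi[of z x y] by (simp add: algebra_simps)
qed

text \<open>Moving \<open>proj x\<close> to the right end leaves its commutators with the letters of
  w, and at the end the value of \<open>\<psi>\<close>; the complementary part of x, standing
  leftmost, contributes 0. A commutator with one letter keeps the length of w, whence
  termination.\<close>

function vacuum_value :: "'g list \<Rightarrow> complex" where
  "vacuum_value [] = 1"
| "vacuum_value (x # w) = (\<Sum>v\<leftarrow>letterwise (bracket (proj x)) w. vacuum_value v)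
     + \<psi> (proj x) * vacuum_value w"
  by pat_completeness auto
termination
  by (relation "measure length") (auto dest: length_letterwise)

definition expectation :: "'g free_algebra \<Rightarrow> complex" where
  "expectation = linear_extension (*) (\<lambda>w. vacuum_value (letters w))"

interpretation cplx: complex_vector_space "(*) :: complex \<Rightarrow> complex \<Rightarrow> complex"
  by (rule complex_vector_space.intro) (rule vector_space_complex)

lemma expectation_add: "expectation (p + q) = expectation p + expectation q"
  by (simp add: expectation_def cplx.linear_extension_add)

lemma expectation_diff: "expectation (p - q) = expectation p - expectation q"
  by (simp add: expectation_def cplx.linear_extension_diff)

lemma expectation_scale: "expectation (Poly_Mapping.single 0 r * p) = r * expectation p"
  by (simp add: expectation_def cplx.linear_extension_scalar_mult)

lemma expectation_word: "expectation (word w) = vacuum_value w"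
  by (simp add: expectation_def)

lemma expectation_one [simp]: "expectation 1 = 1"
  using expectation_word[of "[]"] by (simp add: word_Nil)

lemma expectation_zero [simp]: "expectation 0 = 0"
  using expectation_add[of 0 0] by simp

lemma expectation_sum_list: "expectation (\<Sum>v\<leftarrow>vs. f v) = (\<Sum>v\<leftarrow>vs. expectation (f v))"
  by (induction vs) (simp_all add: expectation_add)

abbreviation ad_proj :: "'g \<Rightarrow> 'g free_algebra \<Rightarrow> 'g free_algebra" where
  "ad_proj x \<equiv> derivation (bracket (proj x))"

lemma expectation_gen_mult:
  "expectation (gen x * p) = expectation (ad_proj x p) + \<psi> (proj x) * expectation p"
proof (induction p rule: free_algebra_induct)
  case (word w)
  show ?case
    by (simp add: expectation_word derivation_word expectation_sum_list flip: word_Cons)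
next
  case (add p q)
  then show ?case by (simp add: distrib_left expectation_add derivation_add)
next
  case (scale r p)
  then show ?case
    by (simp add: mult_scalar_left derivation_scale expectation_scale distrib_left)
qed

section \<open>Descent of the functional to the enveloping algebra\<close>

inductive_set relators :: "'g free_algebra set" where
  relator_add: "gen (x + y) - gen x - gen y \<in> relators"
| relator_scale: "gen (scale r x) - Poly_Mapping.single 0 r * gen x \<in> relators"
| relator_bracket: "gen x * gen y - gen y * gen x - gen (bracket x y) \<in> relators"

lemma enveloping_relations_relators: "enveloping_relations scale bracket UNIV = relators"
  unfolding enveloping_relations_def
  by (auto intro: relators.intros elim!: relators.cases)

text \<open>
  As letters are not linear in the free algebra, \<open>x \<mapsto> derivation (bracket x)\<close> respects the Lie algebra
  structure only up to relators inserted into shorter words.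
\<close>

inductive_set ideal_below :: "nat \<Rightarrow> 'g free_algebra set" for n where
  zero: "0 \<in> ideal_below n"
| base: "q \<in> relators \<Longrightarrow> length u + length w < n \<Longrightarrow> word u * q * word w \<in> ideal_below n"
| add: "p \<in> ideal_below n \<Longrightarrow> q \<in> ideal_below n \<Longrightarrow> p + q \<in> ideal_below n"
| diff: "p \<in> ideal_below n \<Longrightarrow> q \<in> ideal_below n \<Longrightarrow> p - q \<in> ideal_below n"

lemma ideal_below_mono: "m \<le> n \<Longrightarrow> ideal_below m \<subseteq> ideal_below n"
proof
  fix p assume "p \<in> ideal_below m" "m \<le> n"
  then show "p \<in> ideal_below n"
    by (induction rule: ideal_below.induct) (auto intro: ideal_below.intros)
qed

lemma ideal_below_sum_list:
  "(\<And>v. v \<in> set vs \<Longrightarrow> f v \<in> ideal_below n) \<Longrightarrow> (\<Sum>v\<leftarrow>vs. f v) \<in> ideal_below n"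
  by (induction vs) (auto intro: ideal_below.intros)

lemma ideal_below_gen_mult: "p \<in> ideal_below n \<Longrightarrow> gen y * p \<in> ideal_below (Suc n)"
proof (induction rule: ideal_below.induct)
  case (base q u w)
  then show ?case
    using ideal_below.base[of q "y # u" w "Suc n"] by (simp add: word_Cons mult.assoc)
qed (auto simp: distrib_left right_diff_distrib intro: ideal_below.intros)

lemma ideal_below_relator_word: "q \<in> relators \<Longrightarrow> length w < n \<Longrightarrow> q * word w \<in> ideal_below n"
  using ideal_below.base[of q "[]" w n] by (simp add: word_Nil)

text \<open>Each relator goes to a combination of relators between the same two words, so the bound
  on their length is kept. For the bracket relator, the letter for [z, [x, y]] has to be split by
  the Jacobi identity, at the price of one additive relator.\<close>

lemma derivation_relator:
  assumes "q \<in> relators" "length u + length w < n"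
  shows "word u * derivation (bracket z) q * word w \<in> ideal_below n"
  using assms(1)
proof cases
  case (relator_add x y)
  then show ?thesis
    using ideal_below.base[OF relators.relator_add assms(2), of "bracket z x" "bracket z y"]
    by (simp add: derivation_diff bracket_add_right)
next
  case (relator_scale r x)
  then show ?thesis
    using ideal_below.base[OF relators.relator_scale assms(2), of r "bracket z x"]
    by (simp add: derivation_diff bracket_scale_right derivation_scale)
next
  case (relator_bracket x y)
  have "derivation (bracket z) q =
      (gen (bracket z x) * gen y - gen y * gen (bracket z x) - gen (bracket (bracket z x) y))
        + (gen x * gen (bracket z y) - gen (bracket z y) * gen x - gen (bracket x (bracket z y)))
        - (gen (bracket (bracket z x) y + bracket x (bracket z y)) - gen (bracket (bracket z x) y)
           - gen (bracket x (bracket z y)))" (is "_ = ?A + ?B - ?C")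
    by (simp add: relator_bracket derivation_diff derivation_mult bracket_derivation[of z x y])
  then have "word u * derivation (bracket z) q * word w
      = word u * ?A * word w + word u * ?B * word w - word u * ?C * word w"
    by (simp only: distrib_left distrib_right left_diff_distrib right_diff_distrib)
  then show ?thesis
    by (simp only:) (intro ideal_below.intros relators.intros assms(2))
qed


text \<open>At each letter the defect is an additive relator standing in place of that letter, so it
  is surrounded by one letter fewer than the word has. This gain drives the induction in
  \<open>expectation_ideal_below\<close>.\<close>

lemma derivation_add_ideal_below:
  "derivation (bracket (x + y)) (word w) - derivation (bracket x) (word w) - derivation (bracket y) (word w)
     \<in> ideal_below (length w)"
proof (induction w)
  case Nil
  show ?case by (simp add: word_Nil ideal_below.zero)
next
  case (Cons z w)
  let ?R = "gen (bracket x z + bracket y z) - gen (bracket x z) - gen (bracket y z)"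
  let ?D = "\<lambda>x. derivation (bracket x)"
  have "?D (x + y) (word (z # w)) - ?D x (word (z # w)) - ?D y (word (z # w)) =
    ?R * word w + gen z * (?D (x + y) (word w) - ?D x (word w) - ?D y (word w))"
    by (simp add: word_Cons derivation_gen_mult bracket_add_left algebra_simps)
  moreover have "?R * word w \<in> ideal_below (length (z # w))"
    by (rule ideal_below_relator_word) (simp_all add: relators.relator_add)
  ultimately show ?case
    using ideal_below_gen_mult[OF Cons] by (auto intro: ideal_below.add)
qed

lemma derivation_scale_ideal_below:
  "derivation (bracket (scale r x)) (word w) - Poly_Mapping.single 0 r * derivation (bracket x) (word w)
     \<in> ideal_below (length w)"
proof (induction w)
  case Nil
  show ?case by (simp add: word_Nil ideal_below.zero)
next
  case (Cons z w)
  let ?R = "gen (scale r (bracket x z)) - Poly_Mapping.single 0 r * gen (bracket x z)"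
  let ?D = "\<lambda>x. derivation (bracket x)"
  have "?D (scale r x) (word (z # w)) - Poly_Mapping.single 0 r * ?D x (word (z # w)) =
    ?R * word w + gen z * (?D (scale r x) (word w) - Poly_Mapping.single 0 r * ?D x (word w))"
    by (simp add: word_Cons derivation_gen_mult bracket_scale_left mult_scalar_left algebra_simps)
  moreover have "?R * word w \<in> ideal_below (length (z # w))"
    by (rule ideal_below_relator_word) (simp_all add: relators.relator_scale)
  ultimately show ?case
    using ideal_below_gen_mult[OF Cons] by (auto intro: ideal_below.add)
qed

text \<open>By Jacobi the two sides agree on a letter as elements of the Lie algebra; in the free
  algebra they differ by one additive relator there, while mixed terms on two different letters
  cancel.\<close>

lemma derivation_commutator_ideal_below:
  "derivation (bracket x) (derivation (bracket y) (word w)) - derivation (bracket y) (derivation (bracket x) (word w))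
     - derivation (bracket (bracket x y)) (word w) \<in> ideal_below (length w)"
proof (induction w)
  case Nil
  show ?case by (simp add: word_Nil ideal_below.zero)
next
  case (Cons z w)
  let ?D = "\<lambda>x. derivation (bracket x)"
  let ?R = "gen (bracket (bracket x y) z + bracket y (bracket x z)) - gen (bracket (bracket x y) z)
     - gen (bracket y (bracket x z))"
  have "?D x (?D y (word (z # w))) - ?D y (?D x (word (z # w))) - ?D (bracket x y) (word (z # w)) =
    ?R * word w + gen z * (?D x (?D y (word w)) - ?D y (?D x (word w)) - ?D (bracket x y) (word w))"
    by (simp add: word_Cons derivation_gen_mult derivation_add bracket_derivation[of x y z] algebra_simps)
  moreover have "?R * word w \<in> ideal_below (length (z # w))"
    by (rule ideal_below_relator_word) (simp_all add: relators.relator_add)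
  ultimately show ?case
    using ideal_below_gen_mult[OF Cons] by (auto intro: ideal_below.add)
qed

lemma derivation_ideal_below:
  assumes "q \<in> relators" "length u + length w < n"
  shows "derivation (bracket z) (word u * q * word w) \<in> ideal_below n"
proof -
  have "derivation (bracket z) (word u) * q * word w \<in> ideal_below n"
    unfolding derivation_word sum_list_mult_const[symmetric]
    using assms length_letterwise by (fastforce intro!: ideal_below_sum_list ideal_below.base)
  moreover have "word u * q * derivation (bracket z) (word w) \<in> ideal_below n"
    unfolding derivation_word sum_list_const_mult[symmetric]
    using assms length_letterwise by (fastforce intro!: ideal_below_sum_list ideal_below.base)
  ultimately show ?thesis
    using derivation_relator[OF assms, of z]
    by (auto simp: derivation_mult distrib_right intro: ideal_below.add)
qed

text \<open>If a letter precedes the relator, the recursion removes it and both resulting terms have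
  shorter surroundings. If the relator stands first, each of its three kinds is checked by expanding
  the recursion; the defects of ad on the remaining word w lie in
  \<open>ideal_below (length w)\<close>, hence are killed by the induction hypothesis.\<close>

lemma expectation_ideal_below: "p \<in> ideal_below n \<Longrightarrow> expectation p = 0"
proof (induction n arbitrary: p)
  case 0
  then show ?case by (induction rule: ideal_below.induct) (simp_all add: expectation_add expectation_diff)
next
  case (Suc n)
  have E_eq: "expectation (gen x * word w) = expectation (ad_proj x (word w)) + \<psi> (proj x) * expectation (word w)" for x w
    by (rule expectation_gen_mult)
  have E_add: "expectation (gen (x + y) * word w) = expectation (gen x * word w) + expectation (gen y * word w)"
    if "length w \<le> n" for x y w
  proof -
    have "ideal_below (length w) \<subseteq> ideal_below n"
      using that by (rule ideal_below_mono)
    then have "expectation (derivation (bracket (proj x + proj y)) (word w) - ad_proj x (word w) - ad_proj y (word w)) = 0"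
      using Suc.IH derivation_add_ideal_below[of "proj x" "proj y" w] by blast
    then have "expectation (derivation (bracket (proj x + proj y)) (word w))
        = expectation (ad_proj x (word w)) + expectation (ad_proj y (word w))"
      by (simp only: expectation_diff) (simp add: algebra_simps)
    then show ?thesis
      by (simp add: E_eq proj_add \<psi>_add algebra_simps)
  qed
  have E_scale: "expectation (gen (scale r x) * word w) = r * expectation (gen x * word w)"
    if "length w \<le> n" for r x w
  proof -
    have "ideal_below (length w) \<subseteq> ideal_below n"
      using that by (rule ideal_below_mono)
    then show ?thesis
      using Suc.IH[of "ad_proj (scale r x) (word w) - Poly_Mapping.single 0 r * ad_proj x (word w)"]
        derivation_scale_ideal_below[of r "proj x" w]
      by (force simp: E_eq expectation_diff expectation_scale proj_scale \<psi>_scale distrib_left)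
  qed
  have E_bracket: "expectation (gen x * (gen y * word w)) - expectation (gen y * (gen x * word w))
      = expectation (gen (bracket x y) * word w)" if w: "length w \<le> n" for x y w
  proof -
    have "ideal_below (length w) \<subseteq> ideal_below n"
      using that by (rule ideal_below_mono)
    then have "expectation (ad_proj x (ad_proj y (word w)) - ad_proj y (ad_proj x (word w))
        - derivation (bracket (bracket (proj x) (proj y))) (word w)) = 0"
      using Suc.IH derivation_commutator_ideal_below[of "proj x" "proj y" w] by blast
    then have comm: "expectation (ad_proj x (ad_proj y (word w))) - expectation (ad_proj y (ad_proj x (word w)))
        = expectation (derivation (bracket (bracket (proj x) (proj y))) (word w))"
      by (simp only: expectation_diff) (simp add: algebra_simps)
    \<comment> \<open>In the free algebra \<open>gen 0\<close> is a nonzero letter; the functional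
      kills it because of additivity, just established.\<close>
    have "expectation (gen 0 * word w) = 0"
      using E_add[OF w, of 0 0] by simp
    then have complement: "expectation (gen z * word w) = 0" if "proj z = 0" for z
      using that by (simp add: E_eq)
    have neg: "expectation (gen (- z) * word w) = - expectation (gen z * word w)" for z
      using E_scale[OF w, of "-1" z] by simp
    \<comment> \<open>The first two terms are those that the recursion yields from x y w - y x w.
      The third, which they count twice, matches the commutator of the two ad operators, and the
      last lies in the complementary subalgebra, where the functional vanishes.\<close>
    have "bracket x y = bracket (proj x) y + - bracket (proj y) x + (- bracket (proj x) (proj y)) + bracket (x - proj x) (y - proj y)"
    proof -
      have 1: "bracket x y = bracket (x - proj x) (y - proj y) + bracket (proj x) (y - proj y)
          + bracket (x - proj x) (proj y) + bracket (proj x) (proj y)"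
        using bracket_add_left[of "x - proj x" "proj x" "y - proj y"] bracket_add_left[of "x - proj x" "proj x" "proj y"]
          bracket_add_right[of x "y - proj y" "proj y"] by (simp add: add_ac)
      have 2: "bracket (proj x) y = bracket (proj x) (y - proj y) + bracket (proj x) (proj y)"
        using bracket_add_right[of "proj x" "y - proj y" "proj y"] by simp
      have 3: "- bracket (proj y) x = bracket (x - proj x) (proj y) + bracket (proj x) (proj y)"
        using bracket_add_left[of "x - proj x" "proj x" "proj y"] bracket_anti[of x "proj y"] by simp
      show ?thesis
        unfolding 1 2 3 by (simp add: algebra_simps)
    qed
    then have "expectation (gen (bracket x y) * word w) = expectation (gen (bracket (proj x) y) * word w)
        - expectation (gen (bracket (proj y) x) * word w) - expectation (gen (bracket (proj x) (proj y)) * word w)"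
      using complement[OF proj_bracket_complement, of x y] by (simp only: E_add[OF w] neg) simp
    moreover have "expectation (gen (bracket (proj x) (proj y)) * word w)
        = expectation (derivation (bracket (bracket (proj x) (proj y))) (word w))"
      by (simp add: E_eq proj_bracket \<psi>_bracket)
    ultimately show ?thesis
      using comm by (simp add: expectation_gen_mult derivation_gen_mult expectation_add algebra_simps)
  qed
  from Suc.prems show ?case
  proof (induction rule: ideal_below.induct)
    case (base q u w)
    show ?case
    proof (cases u)
      case (Cons x u')
      then have *: "length u' + length w < n" using base by simp
      have "expectation (ad_proj x (word u' * q * word w)) = 0"
        using Suc.IH derivation_ideal_below[OF base(1) *] by blast
      moreover have "expectation (word u' * q * word w) = 0"
        using Suc.IH ideal_below.base[OF base(1) *] by blast
      ultimately show ?thesis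
        by (simp add: Cons word_Cons mult.assoc expectation_gen_mult)
    next
      case Nil
      then have w: "length w \<le> n" using base by simp
      from base(1) show ?thesis
        by cases (simp_all add: Nil word_Nil left_diff_distrib mult.assoc expectation_diff expectation_scale
            E_add[OF w] E_scale[OF w] E_bracket[OF w])
    qed
  qed (simp_all add: expectation_add expectation_diff)
qed

theorem expectation_relator: "q \<in> relators \<Longrightarrow> expectation (r * q * s) = 0"
proof (induction r rule: free_algebra_induct)
  case (word u)
  then show ?case
  proof (induction s rule: free_algebra_induct)
    case (word w)
    then show ?case
      by (intro expectation_ideal_below[OF ideal_below.base[of _ _ _ "Suc (length u + length w)"]]) auto
  next
    case (add p q)
    then show ?case by (simp add: distrib_left expectation_add)
  next
    case (scale r p)
    then show ?case
      by (simp add: mult_scalar_left expectation_scale)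
  qed
next
  case (add p q)
  then show ?case by (simp add: distrib_right expectation_add)
next
  case (scale r p)
  then show ?case by (simp add: mult.assoc expectation_scale)
qed

text \<open>Removing the first letter y of w lets ad act on w' and on x. The term with [y', x], for
  y' the projection of y, vanishes since the letter lies in the subalgebra and a character kills
  brackets; hence the induction on length runs over all x at once.\<close>

theorem expectation_character:
  assumes "proj x = x" shows "expectation (p * gen x) = \<psi> x * expectation p"
proof (induction p rule: free_algebra_induct)
  case (word w)
  have "expectation (word w * gen x) = \<psi> x * expectation (word w)" if "proj x = x" for x
    using that
  proof (induction "length w" arbitrary: w x)
    case 0
    then show ?case
      using expectation_gen_mult[of x 1] by (simp add: word_Nil)
  next
    case (Suc n)
    then obtain y w' where w: "w = y # w'" "length w' = n"
      by (metis length_Suc_conv)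
    have "expectation (ad_proj y (word w') * gen x) = \<psi> x * expectation (ad_proj y (word w'))"
    proof -
      have "(\<Sum>v\<leftarrow>vs. expectation (word v * gen x)) = \<psi> x * (\<Sum>v\<leftarrow>vs. expectation (word v))"
        if "\<And>v. v \<in> set vs \<Longrightarrow> length v = n" for vs
        using that Suc.hyps(1)[OF _ Suc.prems] by (induction vs) (simp_all add: distrib_left)
      then show ?thesis
        using length_letterwise[of _ _ w', unfolded w(2)]
        by (simp add: derivation_word expectation_sum_list flip: sum_list_mult_const)
    qed
    moreover have "expectation (word w' * gen (bracket (proj y) x)) = 0"
      using Suc.hyps(1)[of w' "bracket (proj y) x"] proj_bracket[of y x] \<psi>_bracket[of y x] w(2) Suc.prems by simp
    moreover have "expectation (word w' * gen x) = \<psi> x * expectation (word w')"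
      using Suc.hyps(1)[of w' x] w(2) Suc.prems by simp
    ultimately show ?case
      by (simp add: w(1) word_Cons mult.assoc expectation_gen_mult derivation_mult expectation_add algebra_simps)
  qed
  then show ?case using assms by blast
next
  case (add p q)
  then show ?case by (simp add: distrib_left distrib_right expectation_add)
next
  case (scale r p)
  then show ?case by (simp add: mult.assoc expectation_scale)
qed

end

section \<open>Induced modules\<close>

locale induced_module_setup = ring A
  for A :: "('r, 's) ring_scheme" and B :: "('q, 'u) ring_scheme" and \<phi> :: "'q \<Rightarrow> 'r"
    and N :: "('q, 'n, 't) module_scheme" +
  assumes \<phi>_closed: "b \<in> carrier B \<Longrightarrow> \<phi> b \<in> carrier A"
    and N_add_closed: "n \<in> carrier N \<Longrightarrow> n' \<in> carrier N \<Longrightarrow> n \<oplus>\<^bsub>N\<^esub> n' \<in> carrier N"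
    and N_smult_closed: "b \<in> carrier B \<Longrightarrow> n \<in> carrier N \<Longrightarrow> b \<odot>\<^bsub>N\<^esub> n \<in> carrier N"
begin

abbreviation "F \<equiv> free_Abelian_group (carrier A \<times> carrier N)"
abbreviation "T \<equiv> tensor_subgroup A B \<phi> N"
abbreviation "V \<equiv> induced_module A B \<phi> N"

sublocale F: comm_group F
  by (rule abelian_free_Abelian_group)

definition left_mult :: "'r \<Rightarrow> ('r \<times> 'n \<Rightarrow>\<^sub>0 int) \<Rightarrow> ('r \<times> 'n \<Rightarrow>\<^sub>0 int)" where
  "left_mult u = frag_extend (\<lambda>(x, n). frag_of (u \<otimes>\<^bsub>A\<^esub> x, n))"

definition coset :: "('r \<times> 'n \<Rightarrow>\<^sub>0 int) \<Rightarrow> ('r \<times> 'n \<Rightarrow>\<^sub>0 int) set" where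
  "coset z = T #>\<^bsub>F\<^esub> z"

lemma relations_carrier: "tensor_relations A B \<phi> N \<subseteq> carrier F"
proof -
  have "frag_of p - frag_of q - frag_of r \<in> carrier F" "frag_of p - frag_of q \<in> carrier F"
    if "p \<in> carrier A \<times> carrier N" "q \<in> carrier A \<times> carrier N" "r \<in> carrier A \<times> carrier N" for p q r
    using that keys_diff[of "frag_of p" "frag_of q"] keys_diff[of "frag_of p - frag_of q" "frag_of r"]
    by (auto simp: carrier_free_Abelian_group_iff simp del: mem_Times_iff)
  then show ?thesis
    unfolding tensor_relations_def
    using \<phi>_closed N_add_closed N_smult_closed by (auto simp del: carrier_free_Abelian_group_iff)
qed

lemma T_subgroup: "subgroup T F"
  unfolding tensor_subgroup_def by (rule F.generate_is_subgroup[OF relations_carrier])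

sublocale T: normal T F
  by (rule F.subgroup_imp_normal[OF T_subgroup])

lemma T_closed: "0 \<in> T" "x \<in> T \<Longrightarrow> y \<in> T \<Longrightarrow> x + y \<in> T" "x \<in> T \<Longrightarrow> - x \<in> T"
proof -
  show "0 \<in> T" "x \<in> T \<Longrightarrow> y \<in> T \<Longrightarrow> x + y \<in> T"
    using T.one_closed T.m_closed[of x y] by auto
  show "- x \<in> T" if "x \<in> T"
  proof -
    have "x \<in> carrier F" using that T.subset by blast
    then show ?thesis using T.m_inv_closed[OF that] by simp
  qed
qed

lemma T_diff: "x \<in> T \<Longrightarrow> y \<in> T \<Longrightarrow> x - y \<in> T"
  using T_closed(2)[OF _ T_closed(3)] by fastforce

lemma T_relations:
  "x \<in> carrier A \<Longrightarrow> y \<in> carrier A \<Longrightarrow> n \<in> carrier N \<Longrightarrow>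
     frag_of (x \<oplus>\<^bsub>A\<^esub> y, n) - frag_of (x, n) - frag_of (y, n) \<in> T"
  "x \<in> carrier A \<Longrightarrow> n \<in> carrier N \<Longrightarrow> n' \<in> carrier N \<Longrightarrow>
     frag_of (x, n \<oplus>\<^bsub>N\<^esub> n') - frag_of (x, n) - frag_of (x, n') \<in> T"
  "x \<in> carrier A \<Longrightarrow> b \<in> carrier B \<Longrightarrow> n \<in> carrier N \<Longrightarrow>
     frag_of (x \<otimes>\<^bsub>A\<^esub> \<phi> b, n) - frag_of (x, b \<odot>\<^bsub>N\<^esub> n) \<in> T"
  unfolding tensor_subgroup_def tensor_relations_def by (rule generate.incl; blast)+

lemma additive_vanishes_on_T:
  fixes f :: "('r \<times> 'n \<Rightarrow>\<^sub>0 int) \<Rightarrow> 'c::ab_group_add"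
  assumes "\<And>x y. f (x + y) = f x + f y" "\<And>h. h \<in> tensor_relations A B \<phi> N \<Longrightarrow> f h = 0"
    and "z \<in> T"
  shows "f z = 0"
proof -
  have f0: "f 0 = 0" using assms(1)[of 0 0] by simp
  have "f (- x) = - f x" for x
    using assms(1)[of x "- x"] f0 by (simp add: eq_neg_iff_add_eq_0 add.commute)
  from assms(3) show ?thesis
    unfolding tensor_subgroup_def
  proof (induction rule: generate.induct)
    case (inv h)
    then have "h \<in> carrier F" using relations_carrier by blast
    then show ?case using inv assms(2) \<open>f (- h) = - f h\<close> by (simp add: inv_free_Abelian_group)
  qed (simp_all add: f0 assms)
qed

lemma coset_eq_iff:
  assumes "x \<in> carrier F" "y \<in> carrier F"
  shows "coset x = coset y \<longleftrightarrow> x - y \<in> T"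
proof -
  have "y \<in> coset y"
    unfolding coset_def by (rule F.rcos_self[OF assms(2) T_subgroup])
  moreover have "x \<in> coset x"
    unfolding coset_def by (rule F.rcos_self[OF assms(1) T_subgroup])
  moreover have "x \<in> coset y \<longleftrightarrow> x - y \<in> T"
    unfolding coset_def using T.rcos_module[OF F.is_group assms(2,1)] assms(2)
    by (simp add: inv_free_Abelian_group)
  ultimately show ?thesis
    using F.repr_independence[OF _ assms(2) T_subgroup, of x] by (metis coset_def)
qed

lemma mem_coset_iff: "y \<in> carrier F \<Longrightarrow> x \<in> coset y \<longleftrightarrow> x - y \<in> T"
  unfolding coset_def r_coset_def by (auto simp: algebra_simps) (metis add.commute diff_add_cancel)

lemma carrier_V: "carrier V = coset ` carrier F"
  by (auto simp: induced_module_def Let_def FactGroup_def RCOSETS_def coset_def)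

lemma coset_carrier: "z \<in> carrier F \<Longrightarrow> coset z \<in> carrier V"
  unfolding carrier_V by blast

lemma zero_V: "\<zero>\<^bsub>V\<^esub> = coset 0"
  using F.coset_mult_one[of T] T.subset
  by (simp add: induced_module_def Let_def FactGroup_def coset_def)

lemma add_V: "x \<in> carrier F \<Longrightarrow> y \<in> carrier F \<Longrightarrow> coset x \<oplus>\<^bsub>V\<^esub> coset y = coset (x + y)"
  using T.rcos_sum[of x y] by (simp add: induced_module_def Let_def FactGroup_def coset_def)

lemma left_mult_add: "left_mult u (x + y) = left_mult u x + left_mult u y"
  by (simp add: left_mult_def frag_extend_add)

lemma left_mult_diff: "left_mult u (x - y) = left_mult u x - left_mult u y"
  by (simp add: left_mult_def frag_extend_diff)

lemma left_mult_frag_of [simp]: "left_mult u (frag_of (x, n)) = frag_of (u \<otimes>\<^bsub>A\<^esub> x, n)"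
  by (simp add: left_mult_def)

lemma left_mult_closed:
  assumes "u \<in> carrier A" "z \<in> carrier F" shows "left_mult u z \<in> carrier F"
  using keys_frag_extend[of "\<lambda>(x, n). frag_of (u \<otimes>\<^bsub>A\<^esub> x, n)" z] assms
  by (fastforce simp: left_mult_def)

lemma left_mult_relation:
  assumes "u \<in> carrier A" "h \<in> tensor_relations A B \<phi> N" shows "left_mult u h \<in> T"
  using assms(2) unfolding tensor_relations_def
proof (elim UnE CollectE exE conjE)
  fix x y n assume "h = frag_of (x \<oplus>\<^bsub>A\<^esub> y, n) - frag_of (x, n) - frag_of (y, n)"
    "x \<in> carrier A" "y \<in> carrier A" "n \<in> carrier N"
  then show ?thesis
    using T_relations(1)[of "u \<otimes>\<^bsub>A\<^esub> x" "u \<otimes>\<^bsub>A\<^esub> y" n] assms(1) by (simp add: left_mult_diff r_distr)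
next
  fix x n n' assume "h = frag_of (x, n \<oplus>\<^bsub>N\<^esub> n') - frag_of (x, n) - frag_of (x, n')"
    "x \<in> carrier A" "n \<in> carrier N" "n' \<in> carrier N"
  then show ?thesis
    using T_relations(2)[of "u \<otimes>\<^bsub>A\<^esub> x" n n'] assms(1) by (simp add: left_mult_diff)
next
  fix x b n assume "h = frag_of (x \<otimes>\<^bsub>A\<^esub> \<phi> b, n) - frag_of (x, b \<odot>\<^bsub>N\<^esub> n)"
    "x \<in> carrier A" "b \<in> carrier B" "n \<in> carrier N"
  then show ?thesis
    using T_relations(3)[of "u \<otimes>\<^bsub>A\<^esub> x" b n] assms(1) \<phi>_closed[of b] by (simp add: left_mult_diff m_assoc)
qed

lemma left_mult_T:
  assumes u: "u \<in> carrier A" and "z \<in> T" shows "left_mult u z \<in> T"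
proof -
  have "z \<in> generate F (tensor_relations A B \<phi> N)"
    using assms(2) by (simp add: tensor_subgroup_def)
  then show ?thesis
  proof (induction rule: generate.induct)
    case one
    then show ?case using T_closed(1) by (simp add: left_mult_def)
  next
    case (incl h)
    then show ?case by (rule left_mult_relation[OF u])
  next
    case (inv h)
    moreover from this have "h \<in> carrier F" using relations_carrier by blast
    ultimately show ?case
      using T_closed(3)[OF left_mult_relation[OF u]] by (simp add: left_mult_def frag_extend_minus)
  next
    case (eng h1 h2)
    then show ?case using T_closed(2) by (simp add: left_mult_add)
  qed
qed

text \<open>The scalar multiplication picks the common value over all representatives; it exists
  because left multiplication maps \<open>T\<close> into itself.\<close>

lemma smult_V:
  assumes u: "u \<in> carrier A" and z: "z \<in> carrier F"
  shows "u \<odot>\<^bsub>V\<^esub> coset z = coset (left_mult u z)"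
proof -
  have "coset (left_mult u y) = coset (left_mult u z)" if "y \<in> coset z" for y
  proof -
    have "y - z \<in> T" using that z by (simp add: mem_coset_iff)
    moreover from this have "y \<in> carrier F"
      using T.subset F.m_closed[of "y - z" z] z by (auto simp del: carrier_free_Abelian_group_iff)
    ultimately show ?thesis
      using u z left_mult_T[of u "y - z"] by (simp add: coset_eq_iff left_mult_closed left_mult_diff del: carrier_free_Abelian_group_iff)
  qed
  moreover have "z \<in> coset z"
    using z T_closed(1) by (simp add: mem_coset_iff del: carrier_free_Abelian_group_iff)
  ultimately have "(\<lambda>z. coset (left_mult u z)) ` coset z = {coset (left_mult u z)}"
    by blast
  then show ?thesis
    by (simp add: induced_module_def Let_def left_mult_def coset_def)
qed

lemma zero_F: "0 \<in> carrier F"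
  by simp

lemma abelian_group_V: "abelian_group V"
proof (rule abelian_groupI)
  show "\<exists>y\<in>carrier V. y \<oplus>\<^bsub>V\<^esub> x = \<zero>\<^bsub>V\<^esub>" if x: "x \<in> carrier V" for x
  proof -
    obtain z where z: "z \<in> carrier F" "x = coset z" using x by (auto simp: carrier_V simp del: carrier_free_Abelian_group_iff)
    then have "- z \<in> carrier F" by simp
    with z show ?thesis
      by (intro bexI[of _ "coset (- z)"]) (simp_all add: add_V zero_V coset_carrier del: carrier_free_Abelian_group_iff)
  qed
qed (auto simp: carrier_V zero_V zero_F add_V add_ac F.m_closed[simplified mult_free_Abelian_group] intro!: imageI simp del: carrier_free_Abelian_group_iff)

lemma left_module_V: "left_module A V"
proof (intro left_module.intro left_module_axioms.intro)
  show "ring A" by (rule ring_axioms)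
  show "abelian_group V" by (rule abelian_group_V)
next
  fix u x assume "u \<in> carrier A" "x \<in> carrier V"
  then show "u \<odot>\<^bsub>V\<^esub> x \<in> carrier V"
    by (auto simp: carrier_V smult_V left_mult_closed intro!: imageI simp del: carrier_free_Abelian_group_iff)
next
  fix u v x assume u: "u \<in> carrier A" "v \<in> carrier A" and "x \<in> carrier V"
  then obtain z where z: "z \<in> carrier F" "x = coset z" by (auto simp: carrier_V simp del: carrier_free_Abelian_group_iff)
  \<comment> \<open>Additivity in the ring element holds only modulo \<open>T\<close>, by the first
    family of relations, and is checked on the free generators.\<close>
  have "left_mult (u \<oplus>\<^bsub>A\<^esub> v) z - (left_mult u z + left_mult v z) \<in> T"
  proof -
    have "Poly_Mapping.keys z \<subseteq> carrier A \<times> carrier N" using z by simp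
    then show ?thesis
    proof (induction z rule: frag_induction)
      case zero
      then show ?case by (simp add: left_mult_def T_closed)
    next
      case (one p)
      then show ?case
        using u T_relations(1)[of "u \<otimes>\<^bsub>A\<^esub> fst p" "v \<otimes>\<^bsub>A\<^esub> fst p" "snd p"]
        by (cases p) (simp add: l_distr algebra_simps)
    next
      case (diff a b)
      then show ?case using T_diff by (fastforce simp: left_mult_diff algebra_simps)
    qed
  qed
  then show "(u \<oplus>\<^bsub>A\<^esub> v) \<odot>\<^bsub>V\<^esub> x = u \<odot>\<^bsub>V\<^esub> x \<oplus>\<^bsub>V\<^esub> v \<odot>\<^bsub>V\<^esub> x"
    using u z F.m_closed[of "left_mult u z" "left_mult v z"]
    by (simp add: smult_V add_V left_mult_closed coset_eq_iff del: carrier_free_Abelian_group_iff)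
next
  fix u x y assume "u \<in> carrier A" "x \<in> carrier V" "y \<in> carrier V"
  then show "u \<odot>\<^bsub>V\<^esub> (x \<oplus>\<^bsub>V\<^esub> y) = u \<odot>\<^bsub>V\<^esub> x \<oplus>\<^bsub>V\<^esub> u \<odot>\<^bsub>V\<^esub> y"
    using F.m_closed
    by (auto simp: carrier_V smult_V add_V left_mult_closed left_mult_add simp del: carrier_free_Abelian_group_iff)
next
  fix u v x assume u: "u \<in> carrier A" "v \<in> carrier A" and "x \<in> carrier V"
  then obtain z where z: "z \<in> carrier F" "x = coset z" by (auto simp: carrier_V simp del: carrier_free_Abelian_group_iff)
  have "left_mult (u \<otimes>\<^bsub>A\<^esub> v) z = left_mult u (left_mult v z)"
  proof -
    have "Poly_Mapping.keys z \<subseteq> carrier A \<times> carrier N" using z by simp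
    then show ?thesis
    proof (induction z rule: frag_induction)
      case (one p)
      then show ?case using u by (cases p) (simp add: m_assoc)
    qed (simp_all add: left_mult_diff, simp add: left_mult_def)
  qed
  then show "(u \<otimes>\<^bsub>A\<^esub> v) \<odot>\<^bsub>V\<^esub> x = u \<odot>\<^bsub>V\<^esub> (v \<odot>\<^bsub>V\<^esub> x)"
    using u z by (simp add: smult_V left_mult_closed del: carrier_free_Abelian_group_iff)
next
  fix x assume "x \<in> carrier V"
  then obtain z where z: "z \<in> carrier F" "x = coset z" by (auto simp: carrier_V simp del: carrier_free_Abelian_group_iff)
  have "left_mult \<one>\<^bsub>A\<^esub> z = z"
  proof -
    have "Poly_Mapping.keys z \<subseteq> carrier A \<times> carrier N" using z by simp
    then show ?thesis
      by (induction z rule: frag_induction) (auto simp: left_mult_diff, simp add: left_mult_def)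
  qed
  then show "\<one>\<^bsub>A\<^esub> \<odot>\<^bsub>V\<^esub> x = x"
    using z by (simp add: smult_V del: carrier_free_Abelian_group_iff)
qed

end

section \<open>Modules induced from a character\<close>

lemma carrier_free_algebra_on: "carrier (free_algebra_on L) = {p. \<forall>w\<in>Poly_Mapping.keys p. set (letters w) \<subseteq> L}"
  by (simp add: free_algebra_on_def)

lemma free_algebra_on_simps [simp]:
  "\<one>\<^bsub>free_algebra_on L\<^esub> = 1" "\<zero>\<^bsub>free_algebra_on L\<^esub> = 0"
  "p \<otimes>\<^bsub>free_algebra_on L\<^esub> q = p * q" "p \<oplus>\<^bsub>free_algebra_on L\<^esub> q = p + q"
  by (simp_all add: free_algebra_on_def)

lemma carrier_free_algebra_on_UNIV [simp]: "p \<in> carrier (free_algebra_on UNIV)"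
  by (simp add: carrier_free_algebra_on)

lemma free_algebra_on_closed:
  assumes "p \<in> carrier (free_algebra_on L)" "q \<in> carrier (free_algebra_on L)"
  shows "p + q \<in> carrier (free_algebra_on L)" "- p \<in> carrier (free_algebra_on L)"
    "p - q \<in> carrier (free_algebra_on L)" "p * q \<in> carrier (free_algebra_on L)"
proof -
  show "p + q \<in> carrier (free_algebra_on L)"
    using assms Poly_Mapping.keys_add[of p q] by (auto simp: carrier_free_algebra_on)
  show "p - q \<in> carrier (free_algebra_on L)"
    using assms keys_diff[of p q] by (auto simp: carrier_free_algebra_on)
  show "- p \<in> carrier (free_algebra_on L)"
    using assms by (simp add: carrier_free_algebra_on)
  show "p * q \<in> carrier (free_algebra_on L)"
    unfolding carrier_free_algebra_on mem_Collect_eq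
  proof
    fix w assume "w \<in> Poly_Mapping.keys (p * q)"
    then obtain u v where "w = u + v" "u \<in> Poly_Mapping.keys p" "v \<in> Poly_Mapping.keys q"
      using keys_mult[of p q] by blast
    then show "set (letters w) \<subseteq> L"
      using assms by (auto simp: carrier_free_algebra_on plus_free_monoid_def)
  qed
qed

lemma free_algebra_on_scalar: "Poly_Mapping.single 0 r \<in> carrier (free_algebra_on L)"
  by (simp add: carrier_free_algebra_on zero_free_monoid_def)

lemma free_algebra_on_basic:
  "0 \<in> carrier (free_algebra_on L)" "1 \<in> carrier (free_algebra_on L)"
  "x \<in> L \<Longrightarrow> gen x \<in> carrier (free_algebra_on L)"
  using free_algebra_on_scalar[of 1 L]
  by (simp_all add: carrier_free_algebra_on gen_def single_one)

lemma ring_free_algebra_on: "ring (free_algebra_on L)"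
proof (rule ringI)
  show "abelian_group (free_algebra_on L)"
  proof (rule abelian_groupI)
    show "\<exists>q\<in>carrier (free_algebra_on L). q \<oplus>\<^bsub>free_algebra_on L\<^esub> p = \<zero>\<^bsub>free_algebra_on L\<^esub>"
      if "p \<in> carrier (free_algebra_on L)" for p
      using free_algebra_on_closed(2)[OF that that] by (intro bexI[of _ "- p"]) simp_all
  qed (auto simp: free_algebra_on_closed free_algebra_on_basic add_ac)
  show "Group.monoid (free_algebra_on L)"
    by (rule Group.monoidI) (auto simp: free_algebra_on_closed free_algebra_on_basic mult.assoc)
qed (auto simp: distrib_left distrib_right)

lemma a_inv_free_algebra_on:
  assumes "p \<in> carrier (free_algebra_on L)" shows "\<ominus>\<^bsub>free_algebra_on L\<^esub> p = - p"
proof -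
  interpret ring "free_algebra_on L" by (rule ring_free_algebra_on)
  show ?thesis
    using assms free_algebra_on_closed(2)[OF assms assms] by (intro minus_equality) simp_all
qed

lemma ideal_free_algebra_onI:
  assumes "K \<subseteq> carrier (free_algebra_on L)" "0 \<in> K" "\<And>p q. p \<in> K \<Longrightarrow> q \<in> K \<Longrightarrow> p + q \<in> K"
    "\<And>p q. p \<in> carrier (free_algebra_on L) \<Longrightarrow> q \<in> K \<Longrightarrow> p * q \<in> K"
    "\<And>p q. p \<in> carrier (free_algebra_on L) \<Longrightarrow> q \<in> K \<Longrightarrow> q * p \<in> K"
  shows "ideal K (free_algebra_on L)"
proof (rule idealI[OF ring_free_algebra_on])
  have neg: "- p \<in> K" if "p \<in> K" for p
    using assms(4)[OF free_algebra_on_scalar[of "-1"] that] by (simp add: single_uminus single_one)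
  show "subgroup K (add_monoid (free_algebra_on L))"
  proof
    fix p assume "p \<in> K"
    then show "inv\<^bsub>add_monoid (free_algebra_on L)\<^esub> p \<in> K"
      using neg a_inv_free_algebra_on[of p L] assms(1) by (auto simp: a_inv_def)
  qed (use assms in auto)
qed (use assms in auto)

section \<open>Enveloping algebras as quotients of free algebras\<close>

context complex_lie_algebra begin

abbreviation "FA \<equiv> free_algebra_on"
abbreviation "EI \<equiv> enveloping_ideal scale bracket"
abbreviation "EA \<equiv> enveloping_algebra scale bracket"

definition envelope_class :: "'g set \<Rightarrow> 'g free_algebra \<Rightarrow> 'g free_algebra set" where
  "envelope_class L p = EI L +>\<^bsub>FA L\<^esub> p"

lemma lie_subalgebra_UNIV: "lie_subalgebra UNIV"
  by (simp add: lie_subalgebra_def)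

context
  fixes L assumes L: "lie_subalgebra L"
begin

lemma enveloping_relations_closed: "enveloping_relations scale bracket L \<subseteq> carrier (FA L)"
  using L unfolding enveloping_relations_def lie_subalgebra_def
  by (auto intro!: free_algebra_on_closed free_algebra_on_basic free_algebra_on_scalar subspace_add subspace_scale)

lemma ideal_EI: "ideal (EI L) (FA L)"
  unfolding enveloping_ideal_def
  by (rule ring.genideal_ideal[OF ring_free_algebra_on enveloping_relations_closed])

lemma EI_relations: "enveloping_relations scale bracket L \<subseteq> EI L"
  unfolding enveloping_ideal_def
  by (rule ring.genideal_self[OF ring_free_algebra_on enveloping_relations_closed])

lemma ring_EA: "ring (EA L)"
  unfolding enveloping_algebra_def by (rule ideal.quotient_is_ring[OF ideal_EI])

lemma carrier_EA: "carrier (EA L) = envelope_class L ` carrier (FA L)"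
  by (auto simp: enveloping_algebra_def envelope_class_def FactRing_def A_RCOSETS_def')

lemma envelope_class_hom:
  assumes "p \<in> carrier (FA L)" "q \<in> carrier (FA L)"
  shows "envelope_class L p \<otimes>\<^bsub>EA L\<^esub> envelope_class L q = envelope_class L (p * q)"
    "envelope_class L p \<oplus>\<^bsub>EA L\<^esub> envelope_class L q = envelope_class L (p + q)"
proof -
  interpret ideal "EI L" "FA L" by (rule ideal_EI)
  show "envelope_class L p \<otimes>\<^bsub>EA L\<^esub> envelope_class L q = envelope_class L (p * q)"
    using rcoset_mult_add[OF assms] by (simp add: enveloping_algebra_def envelope_class_def FactRing_def)
  show "envelope_class L p \<oplus>\<^bsub>EA L\<^esub> envelope_class L q = envelope_class L (p + q)"
    using a_rcos_sum[OF assms] by (simp add: enveloping_algebra_def envelope_class_def FactRing_def)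
qed

lemma mem_envelope_class: "q \<in> envelope_class L p \<longleftrightarrow> q - p \<in> EI L"
  unfolding envelope_class_def a_r_coset_def r_coset_def
  by (auto simp: algebra_simps) (metis add.commute diff_add_cancel)

lemma EI_closed:
  "0 \<in> EI L" "p \<in> EI L \<Longrightarrow> q \<in> EI L \<Longrightarrow> p + q \<in> EI L" "p \<in> EI L \<Longrightarrow> q \<in> EI L \<Longrightarrow> p - q \<in> EI L"
  "p \<in> carrier (FA L) \<Longrightarrow> q \<in> EI L \<Longrightarrow> p * q \<in> EI L"
  "p \<in> carrier (FA L) \<Longrightarrow> q \<in> EI L \<Longrightarrow> q * p \<in> EI L"
proof -
  interpret ideal "EI L" "FA L" by (rule ideal_EI)
  show "0 \<in> EI L" using additive_subgroup.zero_closed[OF is_additive_subgroup] by simp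
  show add: "p \<in> EI L \<Longrightarrow> q \<in> EI L \<Longrightarrow> p + q \<in> EI L" for p q using additive_subgroup.a_closed[OF is_additive_subgroup, of p q] by simp
  show l: "p \<in> carrier (FA L) \<Longrightarrow> q \<in> EI L \<Longrightarrow> p * q \<in> EI L" for p q using I_l_closed[of q p] by simp
  show "p \<in> carrier (FA L) \<Longrightarrow> q \<in> EI L \<Longrightarrow> q * p \<in> EI L" using I_r_closed[of q p] by simp
  show "p - q \<in> EI L" if "p \<in> EI L" "q \<in> EI L"
    using add[OF that(1) l[OF free_algebra_on_scalar[of "-1"] that(2)]] by (simp add: single_uminus single_one)
qed

lemma envelope_class_eq_iff: "envelope_class L p = envelope_class L q \<longleftrightarrow> p - q \<in> EI L"
proof
  assume "envelope_class L p = envelope_class L q"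
  moreover have "p \<in> envelope_class L p" by (simp add: mem_envelope_class EI_closed)
  ultimately show "p - q \<in> EI L" by (simp add: mem_envelope_class)
next
  assume pq: "p - q \<in> EI L"
  have "r - p \<in> EI L \<longleftrightarrow> r - q \<in> EI L" for r
    using EI_closed(2)[OF _ pq, of "r - p"] EI_closed(3)[OF _ pq, of "r - q"] by (auto simp: algebra_simps)
  then show "envelope_class L p = envelope_class L q"
    by (auto simp: mem_envelope_class)
qed

lemma EI_induced:
  assumes "p \<in> EI L" "K \<subseteq> carrier (FA L)" "0 \<in> K" "\<And>p q. p \<in> K \<Longrightarrow> q \<in> K \<Longrightarrow> p + q \<in> K"
    "\<And>p q. p \<in> carrier (FA L) \<Longrightarrow> q \<in> K \<Longrightarrow> p * q \<in> K"
    "\<And>p q. p \<in> carrier (FA L) \<Longrightarrow> q \<in> K \<Longrightarrow> q * p \<in> K"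
    "enveloping_relations scale bracket L \<subseteq> K"
  shows "p \<in> K"
proof -
  have "EI L \<subseteq> K"
    unfolding enveloping_ideal_def
    by (rule ring.genideal_minimal[OF ring_free_algebra_on ideal_free_algebra_onI]) (use assms in auto)
  then show ?thesis using assms(1) by blast
qed

end

lemma EI_subset_UNIV:
  assumes L: "lie_subalgebra L" shows "EI L \<subseteq> EI UNIV"
proof
  note closed = EI_closed[OF lie_subalgebra_UNIV] free_algebra_on_closed free_algebra_on_basic
  have "enveloping_relations scale bracket L \<subseteq> enveloping_relations scale bracket UNIV"
    unfolding enveloping_relations_def by blast
  then have rel: "enveloping_relations scale bracket L \<subseteq> EI UNIV"
    using EI_relations[OF lie_subalgebra_UNIV] by blast
  fix p assume "p \<in> EI L"
  then have "p \<in> EI UNIV \<inter> carrier (FA L)"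
  proof (rule EI_induced[OF L])
    show "enveloping_relations scale bracket L \<subseteq> EI UNIV \<inter> carrier (FA L)"
      using rel enveloping_relations_closed[OF L] by blast
  qed (simp_all add: closed)
  then show "p \<in> EI UNIV" by blast
qed

lemma enveloping_inclusion_class:
  assumes L: "lie_subalgebra L"
  shows "enveloping_inclusion scale bracket UNIV (envelope_class L p) = envelope_class UNIV p"
proof -
  have "envelope_class UNIV q = envelope_class UNIV p" if "q \<in> envelope_class L p" for q
    using that EI_subset_UNIV[OF L]
    by (auto simp: mem_envelope_class[OF L] envelope_class_eq_iff[OF lie_subalgebra_UNIV])
  moreover have "p \<in> envelope_class L p" by (simp add: mem_envelope_class[OF L] EI_closed[OF L])
  ultimately have "envelope_class UNIV ` envelope_class L p = {envelope_class UNIV p}"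
    by blast
  then show ?thesis by (simp add: enveloping_inclusion_def envelope_class_def)
qed

end

context lie_character_extension begin

definition P :: "'g set" where "P = {x. proj x = x}"

lemma P_proj: "x \<in> P \<Longrightarrow> proj x = x"
  by (simp add: P_def)

lemma lie_subalgebra_P: "lie_subalgebra P"
proof -
  have "subspace P"
    by (rule subspaceI) (simp_all add: P_def proj_add proj_scale)
  moreover have "bracket x y \<in> P" if "x \<in> P" "y \<in> P" for x y
    using proj_bracket[of x y] that by (simp add: P_def)
  ultimately show ?thesis by (simp add: lie_subalgebra_def)
qed

lemma \<psi>_P:
  assumes "x \<in> P" "y \<in> P"
  shows "\<psi> (x + y) = \<psi> x + \<psi> y" "\<psi> (scale r x) = r * \<psi> x" "\<psi> (bracket x y) = 0"
  using \<psi>_add[of x y] \<psi>_scale[of r x] \<psi>_bracket[of x y] assms by (simp_all add: P_proj)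

interpretation cplx: complex_vector_space "(*)"
  by (rule complex_vector_space.intro) (rule vector_space_complex)

definition character :: "'g free_algebra \<Rightarrow> complex" where
  "character = linear_extension (*) (\<lambda>w. prod_list (map \<psi> (letters w)))"

lemma character_add: "character (p + q) = character p + character q"
  by (simp add: character_def cplx.linear_extension_add)

lemma character_diff: "character (p - q) = character p - character q"
  by (simp add: character_def cplx.linear_extension_diff)

lemma character_scale: "character (Poly_Mapping.single 0 r * p) = r * character p"
  by (simp add: character_def cplx.linear_extension_scalar_mult)

lemma character_word: "character (word w) = prod_list (map \<psi> w)"
  by (simp add: character_def)

lemma character_gen [simp]: "character (gen x) = \<psi> x"
  using character_word[of "[x]"] by (simp add: gen_def)

lemma character_one [simp]: "character 1 = 1"
  using character_word[of "[]"] by (simp add: word_Nil)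

lemma character_zero [simp]: "character 0 = 0"
  by (simp add: character_def)

lemma character_scalar [simp]: "character (Poly_Mapping.single 0 r) = r"
  using character_scale[of r 1] by simp

lemma character_mult: "character (p * q) = character p * character q"
proof (induction p rule: free_algebra_induct)
  case (word u)
  show ?case
  proof (induction q rule: free_algebra_induct)
    case (word w)
    show ?case by (simp add: character_word flip: word_append)
  qed (simp_all add: distrib_left character_add mult_scalar_left character_scale)
qed (simp_all add: distrib_right character_add mult.assoc character_scale)

lemma free_algebra_action_character:
  "free_algebra_action (*) (\<lambda>x v. \<psi> x * v) p v = character p * v"
proof -
  have "foldr (\<lambda>x v. \<psi> x * v) w v = prod_list (map \<psi> w) * v" for w
    by (induction w) simp_all
  then show ?thesis
    by (simp add: free_algebra_action_def character_def linear_extension_def sum_distrib_right mult.assoc)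
qed

lemma character_EI: "p \<in> EI P \<Longrightarrow> character p = 0"
proof -
  assume "p \<in> EI P"
  then have "p \<in> {p \<in> carrier (FA P). character p = 0}"
  proof (rule EI_induced[OF lie_subalgebra_P])
    show "enveloping_relations scale bracket P \<subseteq> {p \<in> carrier (FA P). character p = 0}"
    proof
      fix p assume p: "p \<in> enveloping_relations scale bracket P"
      then have "character p = 0"
        by (auto simp: enveloping_relations_def character_diff character_mult \<psi>_P)
      then show "p \<in> {p \<in> carrier (FA P). character p = 0}"
        using p enveloping_relations_closed[OF lie_subalgebra_P] by blast
    qed
  qed (auto simp: free_algebra_on_closed free_algebra_on_basic character_add character_mult)
  then show ?thesis by simp
qed

text \<open>The kernel of the functional need not be an ideal; the set used here is the largest
  two-sided ideal contained in it.\<close>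

lemma expectation_EI: "p \<in> EI UNIV \<Longrightarrow> expectation p = 0"
proof -
  assume "p \<in> EI UNIV"
  then have "p \<in> {p. \<forall>r s. expectation (r * p * s) = 0}"
  proof (rule EI_induced[OF lie_subalgebra_UNIV])
    show "enveloping_relations scale bracket UNIV \<subseteq> {p. \<forall>r s. expectation (r * p * s) = 0}"
      unfolding enveloping_relations_relators by (auto simp: expectation_relator)
  next
    fix p q assume "q \<in> {p. \<forall>r s. expectation (r * p * s) = 0}"
    then have *: "expectation (r * q * s) = 0" for r s by blast
    show "p * q \<in> {p. \<forall>r s. expectation (r * p * s) = 0}" "q * p \<in> {p. \<forall>r s. expectation (r * p * s) = 0}"
      using *[of "_ * p"] *[of _ "p * _"] by (simp_all add: mult.assoc)
  qed (auto simp: distrib_left distrib_right expectation_add)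
  from this[unfolded mem_Collect_eq, rule_format, of 1 1] show ?thesis by simp
qed

text \<open>Equivariance for right multiplication by the subalgebra is what the balanced relations
  of the tensor product demand of a functional.\<close>

lemma expectation_mult_character:
  assumes "q \<in> carrier (FA P)" shows "expectation (p * q) = character q * expectation p"
proof -
  have w: "expectation (p * word w) = prod_list (map \<psi> w) * expectation p" if "set w \<subseteq> P" for w p
    using that
  proof (induction w arbitrary: p)
    case (Cons x w)
    then show ?case
      using expectation_character[of x p] P_proj[of x]
      by (simp add: word_Cons flip: mult.assoc)
  qed (simp add: word_Nil)
  have "expectation (p * q) = linear_extension (*) (\<lambda>w. expectation (p * word (letters w))) q"
  proof (rule cplx.linear_extension_linear_id)
    show "expectation (p * Poly_Mapping.single v r) = r * expectation (p * word (letters v))" for v r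
      by (subst single_word) (simp only: mult_scalar_left expectation_scale)
  qed (simp add: distrib_left expectation_add)
  also have "\<dots> = character q * expectation p"
    unfolding linear_extension_def character_def sum_distrib_right
  proof (rule sum.cong[OF refl])
    fix v assume "v \<in> Poly_Mapping.keys q"
    then have "set (letters v) \<subseteq> P" using assms by (auto simp: carrier_free_algebra_on)
    then show "Poly_Mapping.lookup q v * expectation (p * word (letters v))
        = Poly_Mapping.lookup q v * prod_list (map \<psi> (letters v)) * expectation p"
      by (simp only: w mult.assoc)
  qed
  finally show ?thesis .
qed

definition "N = enveloping_module (*) (\<lambda>x v. \<psi> x * v)"

lemma N_simps [simp]: "v \<in> carrier N" "x \<oplus>\<^bsub>N\<^esub> y = x + y"
  by (simp_all add: N_def enveloping_module_def)

lemma smult_N: "envelope_class P p \<odot>\<^bsub>N\<^esub> v = character p * v"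
proof -
  have const: "character q = character p" if "q \<in> envelope_class P p" for q
    using that character_EI[of "q - p"] by (simp add: mem_envelope_class[OF lie_subalgebra_P] character_diff)
  moreover have "p \<in> envelope_class P p"
    by (simp add: mem_envelope_class[OF lie_subalgebra_P] EI_closed[OF lie_subalgebra_P])
  ultimately have "the_elem ((\<lambda>p. character p * v) ` envelope_class P p) = character p * v"
    by (intro the_elem_image_unique) (blast, drule const, simp)
  then show ?thesis
    by (simp add: N_def enveloping_module_def free_algebra_action_character)
qed

lemma inclusion_closed:
  "X \<in> carrier (EA P) \<Longrightarrow> enveloping_inclusion scale bracket UNIV X \<in> carrier (EA UNIV)"
  by (auto simp: carrier_EA[OF lie_subalgebra_P] carrier_EA[OF lie_subalgebra_UNIV]
      enveloping_inclusion_class[OF lie_subalgebra_P])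

sublocale ind: induced_module_setup "EA UNIV" "EA P" "enveloping_inclusion scale bracket UNIV" N
  by (intro induced_module_setup.intro induced_module_setup_axioms.intro)
    (simp_all add: ring_EA[OF lie_subalgebra_UNIV] inclusion_closed)

abbreviation cls :: "'g free_algebra \<Rightarrow> 'g free_algebra set" where
  "cls \<equiv> envelope_class UNIV"

lemmas UNIV_closed = EI_closed[OF lie_subalgebra_UNIV, simplified]

lemma cls_hom:
  "cls p \<otimes>\<^bsub>EA UNIV\<^esub> cls q = cls (p * q)" "cls p \<oplus>\<^bsub>EA UNIV\<^esub> cls q = cls (p + q)"
  by (simp_all add: envelope_class_hom[OF lie_subalgebra_UNIV])

lemma cls_closed [simp]: "cls p \<in> carrier (EA UNIV)"
  by (simp add: carrier_EA[OF lie_subalgebra_UNIV])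

lemma carrier_EA_UNIV: "carrier (EA UNIV) = range cls"
  by (auto simp: carrier_EA[OF lie_subalgebra_UNIV])

definition class_expectation :: "'g free_algebra set \<Rightarrow> complex" where
  "class_expectation X = the_elem (expectation ` X)"

lemma class_expectation: "class_expectation (cls p) = expectation p"
proof -
  have const: "expectation q = expectation p" if "q \<in> cls p" for q
    using that expectation_EI[of "q - p"] by (simp add: mem_envelope_class[OF lie_subalgebra_UNIV] expectation_diff)
  moreover have "p \<in> cls p"
    by (simp add: mem_envelope_class[OF lie_subalgebra_UNIV] UNIV_closed)
  ultimately show ?thesis
    unfolding class_expectation_def by (intro the_elem_image_unique) (blast, rule const)
qed

definition tensor_expectation :: "('g free_algebra set \<times> complex \<Rightarrow>\<^sub>0 int) \<Rightarrow> complex" where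
  "tensor_expectation z = (\<Sum>k\<in>Poly_Mapping.keys z.
     of_int (Poly_Mapping.lookup z k) * (snd k * class_expectation (fst k)))"

lemma tensor_expectation_add: "tensor_expectation (x + y) = tensor_expectation x + tensor_expectation y"
  unfolding tensor_expectation_def
  by (rule Poly_Mapping.setsum_keys_plus_distrib) (simp_all add: distrib_right)

lemma tensor_expectation_diff: "tensor_expectation (x - y) = tensor_expectation x - tensor_expectation y"
  using tensor_expectation_add[of "x - y" y] by simp

lemma tensor_expectation_frag_of [simp]: "tensor_expectation (frag_of (cls p, v)) = v * expectation p"
  by (simp add: tensor_expectation_def class_expectation)

text \<open>Bilinearity settles the first two families of relations,
  \<open>expectation_mult_character\<close> the third.\<close>

lemma tensor_expectation_T: "z \<in> ind.T \<Longrightarrow> tensor_expectation z = 0"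
proof (rule ind.additive_vanishes_on_T[of tensor_expectation, OF tensor_expectation_add])
  fix h assume "h \<in> tensor_relations (EA UNIV) (EA P) (enveloping_inclusion scale bracket UNIV) N"
  then show "tensor_expectation h = 0"
    unfolding tensor_relations_def carrier_EA_UNIV carrier_EA[OF lie_subalgebra_P]
  proof (elim UnE CollectE exE conjE imageE; simp only:)
    fix p q :: "'g free_algebra" and v :: complex
    show "tensor_expectation (frag_of (cls p \<oplus>\<^bsub>EA UNIV\<^esub> cls q, v) - frag_of (cls p, v) - frag_of (cls q, v)) = 0"
      by (simp add: tensor_expectation_diff cls_hom expectation_add distrib_left)
  next
    fix p :: "'g free_algebra" and v v' :: complex
    show "tensor_expectation (frag_of (cls p, v \<oplus>\<^bsub>N\<^esub> v') - frag_of (cls p, v) - frag_of (cls p, v')) = 0"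
      by (simp add: tensor_expectation_diff distrib_right)
  next
    fix p q :: "'g free_algebra" and v :: complex
    assume "q \<in> carrier (FA P)"
    then show "tensor_expectation (frag_of (cls p \<otimes>\<^bsub>EA UNIV\<^esub> enveloping_inclusion scale bracket UNIV (envelope_class P q), v)
        - frag_of (cls p, envelope_class P q \<odot>\<^bsub>N\<^esub> v)) = 0"
      by (simp add: tensor_expectation_diff cls_hom enveloping_inclusion_class[OF lie_subalgebra_P] smult_N
          expectation_mult_character)
  qed
qed

section \<open>The induced module as a quotient of the free algebra\<close>

definition ev :: "'g free_algebra \<Rightarrow> ('g free_algebra set \<times> complex \<Rightarrow>\<^sub>0 int) set" where
  "ev p = ind.coset (frag_of (cls p, 1))"

lemma frag_of_F [simp]: "frag_of (cls p, v) \<in> carrier ind.F"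
  by simp

lemma ev_closed [simp]: "ev p \<in> carrier ind.V"
  unfolding ev_def by (rule ind.coset_carrier) (rule frag_of_F)

lemma ev_add: "ev (p + q) = ev p \<oplus>\<^bsub>ind.V\<^esub> ev q"
proof -
  have "frag_of (cls (p + q), 1) - (frag_of (cls p, 1) + frag_of (cls q, 1)) \<in> ind.T"
    using ind.T_relations(1)[of "cls p" "cls q" 1] by (simp add: cls_hom algebra_simps)
  then show ?thesis
    using ind.F.m_closed[OF frag_of_F frag_of_F, of p 1 q 1]
    by (simp add: ev_def ind.add_V ind.coset_eq_iff del: carrier_free_Abelian_group_iff frag_of_in_free_Abelian_group)
qed

lemma ev_smult: "cls q \<odot>\<^bsub>ind.V\<^esub> ev p = ev (q * p)"
  by (simp add: ev_def ind.smult_V cls_hom del: carrier_free_Abelian_group_iff frag_of_in_free_Abelian_group)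

lemma ev_EI: "p - q \<in> EI UNIV \<Longrightarrow> ev p = ev q"
  by (simp add: ev_def envelope_class_eq_iff[OF lie_subalgebra_UNIV, THEN iffD2])

lemma ev_scalar:
  assumes "q \<in> carrier (FA P)"
  shows "ev (p * q) = ind.coset (frag_of (cls p, character q))"
proof -
  have "envelope_class P q \<in> carrier (EA P)"
    using assms by (simp add: carrier_EA[OF lie_subalgebra_P])
  from ind.T_relations(3)[OF cls_closed this, of 1 p]
  have "frag_of (cls (p * q), 1) - frag_of (cls p, character q) \<in> ind.T"
    by (simp add: enveloping_inclusion_class[OF lie_subalgebra_P] cls_hom smult_N)
  then show ?thesis
    by (simp add: ev_def ind.coset_eq_iff del: carrier_free_Abelian_group_iff frag_of_in_free_Abelian_group)
qed

lemma ev_gen: "x \<in> P \<Longrightarrow> ev (p * gen x) = ev (p * Poly_Mapping.single 0 (\<psi> x))"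
  by (simp add: ev_scalar free_algebra_on_basic free_algebra_on_scalar)

lemma ev_surj: "X \<in> carrier ind.V \<Longrightarrow> \<exists>p. X = ev p"
proof -
  assume "X \<in> carrier ind.V"
  then obtain z where z: "z \<in> carrier ind.F" "X = ind.coset z"
    by (auto simp: ind.carrier_V simp del: carrier_free_Abelian_group_iff)
  have "Poly_Mapping.keys z \<subseteq> carrier (EA UNIV) \<times> carrier N" using z(1) by simp
  then have "\<exists>p. z - frag_of (cls p, 1) \<in> ind.T"
  proof (induction z rule: frag_induction)
    case zero
    have "frag_of (cls 0, 1) \<in> ind.T"
      using ind.T_closed(3)[OF ind.T_relations(1)[of "cls 0" "cls 0" 1]] by (simp add: cls_hom)
    then show ?case using ind.T_closed(3) by (intro exI[of _ 0]) simp
  next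
    case (one x)
    then obtain p v where x: "x = (cls p, v)" by (auto simp: carrier_EA_UNIV)
    \<comment> \<open>The second tensor factor moves into the first: as a scalar, v belongs to the
      enveloping algebra of the subalgebra and acts on 1 as v.\<close>
    have "ev (p * Poly_Mapping.single 0 v) = ind.coset (frag_of (cls p, v))"
      by (simp add: ev_scalar free_algebra_on_scalar)
    then show ?case
      unfolding x ev_def using ind.coset_eq_iff[OF frag_of_F frag_of_F] by metis
  next
    case (diff a b)
    then obtain p q where pq: "a - frag_of (cls p, 1) \<in> ind.T" "b - frag_of (cls q, 1) \<in> ind.T" by blast
    have "frag_of (cls p, 1) - frag_of (cls (p - q), 1) - frag_of (cls q, 1) \<in> ind.T"
      using ind.T_relations(1)[of "cls (p - q)" "cls q" 1] by (simp add: cls_hom)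
    from ind.T_closed(2)[OF this ind.T_diff[OF pq]] show ?case
      by (intro exI[of _ "p - q"]) (simp add: algebra_simps)
  qed
  then show ?thesis
    using z ind.coset_eq_iff[OF z(1) frag_of_F] by (auto simp: ev_def)
qed

lemma ev_zero: "ev 0 = \<zero>\<^bsub>ind.V\<^esub>"
proof -
  interpret V: abelian_group ind.V by (rule ind.abelian_group_V)
  have "ev 0 \<oplus>\<^bsub>ind.V\<^esub> ev 0 = ev 0" using ev_add[of 0 0] by simp
  then show ?thesis using V.add.l_cancel_one[of "ev 0" "ev 0"] by simp
qed

text \<open>The functional induced on the tensor product takes the value 1 on the generator and 0 on
  all relations.\<close>

lemma ev_one_nonzero: "ev 1 \<noteq> \<zero>\<^bsub>ind.V\<^esub>"
proof
  assume "ev 1 = \<zero>\<^bsub>ind.V\<^esub>"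
  then have "frag_of (cls 1, 1) - 0 \<in> ind.T"
    using ind.coset_eq_iff[OF frag_of_F ind.zero_F] by (simp only: ev_def ind.zero_V)
  then show False
    using tensor_expectation_T[of "frag_of (cls 1, 1)"] by simp
qed

definition annihilator :: "'g free_algebra set" where
  "annihilator = {p. ev p = \<zero>\<^bsub>ind.V\<^esub>}"

lemma annihilator_left_ideal:
  "0 \<in> annihilator" "p \<in> annihilator \<Longrightarrow> q \<in> annihilator \<Longrightarrow> p + q \<in> annihilator"
  "p \<in> annihilator \<Longrightarrow> q * p \<in> annihilator"
proof -
  interpret V: left_module "EA UNIV" ind.V by (rule ind.left_module_V)
  show "0 \<in> annihilator" by (simp add: annihilator_def ev_zero)
  show "p \<in> annihilator \<Longrightarrow> q \<in> annihilator \<Longrightarrow> p + q \<in> annihilator"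
    by (simp add: annihilator_def ev_add)
  assume "p \<in> annihilator"
  then have "ev (q * p) = cls q \<odot>\<^bsub>ind.V\<^esub> ev 0"
    by (simp add: annihilator_def ev_zero flip: ev_smult)
  then show "q * p \<in> annihilator"
    unfolding ev_smult by (simp add: annihilator_def ev_zero)
qed

lemma annihilator_EI: "p \<in> EI UNIV \<Longrightarrow> p \<in> annihilator"
  using ev_EI[of p 0] by (simp add: annihilator_def ev_zero)

lemma annihilator_character:
  assumes "x \<in> P" shows "gen x - Poly_Mapping.single 0 (\<psi> x) \<in> annihilator"
proof -
  interpret V: abelian_group ind.V by (rule ind.abelian_group_V)
  let ?s = "Poly_Mapping.single 0 (\<psi> x)"
  have "ev (gen x - ?s) \<oplus>\<^bsub>ind.V\<^esub> ev ?s = ev ?s"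
    using ev_gen[OF assms, of 1] by (simp flip: ev_add)
  then show ?thesis
    by (simp add: annihilator_def)
qed

text \<open>As \<open>ev\<close> is onto, submodules correspond to left ideals of the free algebra
  containing the annihilator of the generator. So it suffices that the annihilator is a maximal left
  ideal.\<close>

theorem irreducible_induced_moduleI:
  assumes "\<And>W. 0 \<in> W \<Longrightarrow> (\<And>p q. p \<in> W \<Longrightarrow> q \<in> W \<Longrightarrow> p + q \<in> W) \<Longrightarrow>
      (\<And>p q. p \<in> W \<Longrightarrow> q * p \<in> W) \<Longrightarrow> annihilator \<subset> W \<Longrightarrow> 1 \<in> W"
  shows "irreducible_left_module (EA UNIV) ind.V"
  unfolding irreducible_left_module_def
proof (intro conjI allI impI)
  show "left_module (EA UNIV) ind.V" by (rule ind.left_module_V)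
  show "carrier ind.V \<noteq> {\<zero>\<^bsub>ind.V\<^esub>}"
    using ev_one_nonzero ev_closed[of 1] by blast
next
  fix H assume "submodule H (EA UNIV) ind.V"
  then interpret H: submodule H "EA UNIV" ind.V .
  define W where "W = {p. ev p \<in> H}"
  have zero: "\<zero>\<^bsub>ind.V\<^esub> \<in> H" using H.one_closed by simp
  have W: "0 \<in> W" "\<And>p q. p \<in> W \<Longrightarrow> q \<in> W \<Longrightarrow> p + q \<in> W" "\<And>p q. p \<in> W \<Longrightarrow> q * p \<in> W"
    using zero H.m_closed H.smult_closed
    by (auto simp: W_def ev_zero ev_add simp flip: ev_smult)
  have HW: "H = ev ` W"
    using H.subset ev_surj by (fastforce simp: W_def)
  have "annihilator \<subseteq> W" using zero by (auto simp: W_def annihilator_def)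
  then consider "W = annihilator" | "annihilator \<subset> W" by blast
  then show "H = {\<zero>\<^bsub>ind.V\<^esub>} \<or> H = carrier ind.V"
  proof cases
    case 1
    then have "H \<subseteq> {\<zero>\<^bsub>ind.V\<^esub>}" unfolding HW by (auto simp: annihilator_def)
    then show ?thesis using zero by blast
  next
    case 2
    then have "1 \<in> W" by (intro assms W)
    then have "p \<in> W" for p using W(3)[of 1 p] by simp
    then have "carrier ind.V \<subseteq> H" using ev_surj by (fastforce simp: W_def)
    then show ?thesis using H.subset by auto
  qed
qed

end

section \<open>The affine Nappi--Witten algebra\<close>

context lie_character_extension begin

text \<open>A basis extension gives a linear retraction g onto the annihilator; \<pi> is the
  identity minus g.\<close>

lemma annihilator_projection:
  "\<exists>\<pi>. Vector_Spaces.linear free_scale free_scale \<pi> \<and> (\<forall>p. p - \<pi> p \<in> annihilator) \<and>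
     (\<forall>p\<in>annihilator. \<pi> p = 0)"
proof -
  interpret pair: vector_space_pair "free_scale :: complex \<Rightarrow> 'g free_algebra \<Rightarrow> _" free_scale
    by unfold_locales
  have sub: "free.subspace annihilator"
    by (rule free.subspaceI) (simp_all add: annihilator_left_ideal free_scale_def)
  have "\<exists>g. g ` UNIV \<subseteq> annihilator \<and> Vector_Spaces.linear free_scale free_scale g \<and>
      (\<forall>p\<in>annihilator. g (id p) = p)"
    by (rule pair.linear_exists_left_inverse_on[OF free.linear_id sub]) simp
  then obtain g where g: "range g \<subseteq> annihilator" "Vector_Spaces.linear free_scale free_scale g"
    "\<And>p. p \<in> annihilator \<Longrightarrow> g p = p" by auto
  have "Vector_Spaces.linear free_scale free_scale (\<lambda>p. id p - g p)"
    by (rule pair.linear_compose_sub[OF free.linear_id g(2)])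
  then show ?thesis
    using g(1,3) by (intro exI[of _ "\<lambda>p. id p - g p"]) auto
qed

end

text \<open>
  A linear complement of the annihilator, the image of \<open>\<pi>\<close>, replaces the quotient by the annihilator,
  which is not available as a type.
\<close>

locale annihilator_complement = lie_character_extension +
  fixes \<pi> :: "'a free_algebra \<Rightarrow> 'a free_algebra"
  assumes \<pi>_linear: "Vector_Spaces.linear free_scale free_scale \<pi>"
    and \<pi>_diff_annihilator: "p - \<pi> p \<in> annihilator"
    and \<pi>_annihilator: "p \<in> annihilator \<Longrightarrow> \<pi> p = 0"
begin

definition rho :: "'a \<Rightarrow> 'a free_algebra \<Rightarrow> 'a free_algebra" where
  "rho x v = \<pi> (gen x * v)"

lemma \<pi>_simps: "\<pi> (p + q) = \<pi> p + \<pi> q" "\<pi> (p - q) = \<pi> p - \<pi> q" "\<pi> (free_scale r p) = free_scale r (\<pi> p)"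
proof -
  interpret \<pi>: Vector_Spaces.linear free_scale free_scale \<pi> by (rule \<pi>_linear)
  show "\<pi> (p + q) = \<pi> p + \<pi> q" "\<pi> (p - q) = \<pi> p - \<pi> q" "\<pi> (free_scale r p) = free_scale r (\<pi> p)"
    by (rule \<pi>.add \<pi>.diff \<pi>.scale)+
qed

lemma \<pi>_scalar: "\<pi> (Poly_Mapping.single 0 r * p) = Poly_Mapping.single 0 r * \<pi> p"
  using \<pi>_simps(3) by (simp add: free_scale_def)

lemma \<pi>_cong: "p - q \<in> annihilator \<Longrightarrow> \<pi> p = \<pi> q"
  using \<pi>_annihilator[of "p - q"] by (simp add: \<pi>_simps)

text \<open>The annihilator is a left ideal, so changing the right factor modulo it is invisible to
  \<pi>. Thus the image of \<pi> carries the module structure of the quotient.\<close>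

lemma \<pi>_mult_\<pi>: "\<pi> (q * \<pi> p) = \<pi> (q * p)"
proof -
  have "\<pi> (q * (p - \<pi> p)) = 0"
    by (rule \<pi>_annihilator) (rule annihilator_left_ideal(3)[OF \<pi>_diff_annihilator])
  then show ?thesis by (simp add: right_diff_distrib \<pi>_simps)
qed

lemma relator_annihilator: "q \<in> relators \<Longrightarrow> q * v \<in> annihilator"
  using EI_relations[OF lie_subalgebra_UNIV] enveloping_relations_relators
  by (intro annihilator_EI EI_closed(5)[OF lie_subalgebra_UNIV]) auto

text \<open>The last three identities are \<pi> applied to a relator times v. Such a product lies in
  the enveloping ideal, hence in the annihilator, for every v, also outside the image of
  \<pi>.\<close>

lemma rho_representation:
  "rho x (u + v) = rho x u + rho x v"
  "rho x (free_scale r v) = free_scale r (rho x v)"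
  "rho (x + y) v = rho x v + rho y v"
  "rho (scale r x) v = free_scale r (rho x v)"
  "rho (bracket x y) v = rho x (rho y v) - rho y (rho x v)"
proof -
  show "rho x (u + v) = rho x u + rho x v"
    by (simp add: rho_def distrib_left \<pi>_simps)
  show "rho x (free_scale r v) = free_scale r (rho x v)"
    by (simp add: rho_def free_scale_def mult_scalar_left \<pi>_scalar)
  have "\<pi> ((gen (x + y) - gen x - gen y) * v) = 0"
    by (intro \<pi>_annihilator relator_annihilator relators.intros)
  then show "rho (x + y) v = rho x v + rho y v"
    by (simp add: rho_def left_diff_distrib \<pi>_simps algebra_simps)
  have "\<pi> ((gen (scale r x) - Poly_Mapping.single 0 r * gen x) * v) = 0"
    by (intro \<pi>_annihilator relator_annihilator relators.intros)
  then show "rho (scale r x) v = free_scale r (rho x v)"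
    by (simp add: rho_def left_diff_distrib \<pi>_simps mult.assoc \<pi>_scalar free_scale_def)
  have "\<pi> ((gen x * gen y - gen y * gen x - gen (bracket x y)) * v) = 0"
    by (intro \<pi>_annihilator relator_annihilator relators.intros)
  then show "rho (bracket x y) v = rho x (rho y v) - rho y (rho x v)"
    by (simp add: rho_def \<pi>_mult_\<pi> left_diff_distrib \<pi>_simps mult.assoc)
qed

lemma rho_vacuum: "x \<in> P \<Longrightarrow> rho x (\<pi> 1) = free_scale (\<psi> x) (\<pi> 1)"
  using \<pi>_cong[OF annihilator_character[of x]]
  using \<pi>_scalar[of "\<psi> x" 1] by (simp add: rho_def \<pi>_mult_\<pi> free_scale_def)

lemma \<pi>_word: "\<pi> (word w) = foldr rho w (\<pi> 1)"
proof (induction w)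
  case (Cons x w)
  then have "foldr rho (x # w) (\<pi> 1) = rho x (\<pi> (word w))" by simp
  also have "\<dots> = \<pi> (word (x # w))" by (simp only: rho_def word_Cons \<pi>_mult_\<pi>)
  finally show ?case ..
qed (simp add: word_Nil)

end

section \<open>Spectral flow\<close>

definition affine_mode :: "nw \<Rightarrow> int \<Rightarrow> affine_nw" where
  "affine_mode x n = (Poly_Mapping.single n x, 0)"

lemma affine_mode_linear:
  "affine_mode (x + y) n = affine_mode x n + affine_mode y n"
  "affine_mode (r *s x) n = affine_scale r (affine_mode x n)"
proof -
  show "affine_mode (x + y) n = affine_mode x n + affine_mode y n"
    by (simp add: affine_mode_def single_add)
  show "affine_mode (r *s x) n = affine_scale r (affine_mode x n)"
    by (rule affine_eqI) (simp_all add: affine_mode_def lookup_single when_def)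
qed

text \<open>The shifts move the bounds -m for a and m for b to 0, so all modes of nonnegative degree
  lie in \<open>affine_sub m\<close>.\<close>

definition flow_mode :: "int \<Rightarrow> nw \<Rightarrow> int \<Rightarrow> affine_nw" where
  "flow_mode m x n = affine_mode (x $ NW_A *s nw_a) (n - m) + affine_mode (x $ NW_B *s nw_b) (n + m)
     + affine_mode (x $ NW_C *s nw_c + x $ NW_D *s nw_d) n"

lemma flow_mode_linear:
  "flow_mode m (x + y) n = flow_mode m x n + flow_mode m y n"
  "flow_mode m (r *s x) n = affine_scale r (flow_mode m x n)"
proof -
  interpret vector_space affine_scale by (rule vector_space_affine)
  have "(x $ i + y $ i) *s (e :: nw) = x $ i *s e + y $ i *s e" "(r * x $ i) *s e = r *s (x $ i *s e)" for i e
    by (simp_all add: vec_eq_iff algebra_simps)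
  then show "flow_mode m (x + y) n = flow_mode m x n + flow_mode m y n"
    "flow_mode m (r *s x) n = affine_scale r (flow_mode m x n)"
    by (simp_all add: flow_mode_def affine_mode_linear scale_right_distrib algebra_simps)
qed

lemma affine_bracket_mode:
  "affine_bracket (affine_mode x n) (affine_mode y q) = affine_mode (nw_bracket x y) (n + q)
     + (0, if n + q = 0 then of_int n * nw_form x y else 0)"
  by (simp add: affine_mode_def affine_bracket_monomials)

text \<open>The central term sees the true degrees: n - m when a stands on the left and n + m when b
  does. The discrepancy is -m times the c-component of [x, y].\<close>

lemma affine_bracket_flow_mode:
  "affine_bracket (flow_mode m x n) (flow_mode m y q) = flow_mode m (nw_bracket x y) (n + q)
     + (0, if n + q = 0 then of_int n * nw_form x y - of_int m * nw_bracket x y $ NW_C else 0)"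
  unfolding flow_mode_def affine_bracket_add_left affine_bracket_add_right affine_bracket_mode
  by (rule affine_eqI)
    (auto simp: affine_mode_def lookup_add lookup_single when_def nw_eq_iff nw_bracket_nth nw_form_sum axis_def algebra_simps)

locale affine_highest_weight = vector_space scale
  for scale :: "complex \<Rightarrow> 'v::ab_group_add \<Rightarrow> 'v" +
  fixes rho :: "affine_nw \<Rightarrow> 'v \<Rightarrow> 'v" and v0 :: 'v and m :: int and z :: complex
  assumes rho_add: "rho x (u + v) = rho x u + rho x v"
    and rho_scale: "rho x (scale r v) = scale r (rho x v)"
    and rho_add_left: "rho (x + y) v = rho x v + rho y v"
    and rho_scale_left: "rho (affine_scale r x) v = scale r (rho x v)"
    and rho_bracket: "rho (affine_bracket x y) v = rho x (rho y v) - rho y (rho x v)"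
    and rho_vacuum: "x \<in> affine_sub m \<Longrightarrow>
      rho x v0 = scale (nw_form (z *s nw_c + of_int m *s nw_d) (Poly_Mapping.lookup (fst x) 0) + snd x) v0"
begin

text \<open>The eigenvalue of the degree-zero flow mode on the generator. Subtracting it makes the
  zero modes kill the generator, and its part at c cancels the discrepancy in
  \<open>affine_bracket_flow_mode\<close>.\<close>

definition weight :: "nw \<Rightarrow> int \<Rightarrow> complex" where
  "weight x n = (if n = 0 then of_int m * x $ NW_C + z * x $ NW_D else 0)"

definition mode :: "nw \<Rightarrow> int \<Rightarrow> 'v \<Rightarrow> 'v" where
  "mode x n v = rho (flow_mode m x n) v - scale (weight x n) v"

text \<open>
  The central element need not act as the identity everywhere: for \<open>rho x v = \<pi> (gen x * v)\<close> it acts as \<open>\<pi>\<close>.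
\<close>

definition M :: "'v set" where "M = {v. rho (0, 1) v = v}"

lemma rho_central: "v \<in> M \<Longrightarrow> rho (0, r) v = scale r v"
proof -
  assume "v \<in> M"
  moreover have "affine_scale r (0, 1) = (0, r)"
    by (rule affine_eqI) simp_all
  ultimately show ?thesis
    using rho_scale_left[of r "(0, 1)" v] by (simp add: M_def)
qed

lemma rho_M: "v \<in> M \<Longrightarrow> rho x v \<in> M"
proof -
  assume "v \<in> M"
  have "rho 0 v = 0" using rho_add_left[of 0 0 v] by simp
  then have "rho (0, 1) (rho x v) = rho x (rho (0, 1) v)"
    using rho_bracket[of "(0, 1)" x v] by simp
  then show ?thesis using \<open>v \<in> M\<close> by (simp add: M_def)
qed

lemma subspace_M: "subspace M"
  by (rule subspaceI) (use rho_scale[of "(0,1)" 0 0] in \<open>simp_all add: M_def rho_add rho_scale\<close>)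

lemma flow_mode_affine_sub: "0 \<le> n \<Longrightarrow> flow_mode m x n \<in> affine_sub m"
  by (auto simp: affine_sub_def flow_mode_def affine_mode_def lookup_add lookup_single when_def axis_def
      split: if_splits)

lemma rho_minus: "rho x (u - v) = rho x u - rho x v"
  using rho_add[of x "u - v" v] by simp

sublocale highest: nw_highest_weight scale mode M v0
proof
  show "subspace M" by (rule subspace_M)
  show "mode x n v \<in> M" if "v \<in> M" for x n v
    using that unfolding mode_def by (intro subspace_diff[OF subspace_M] subspace_scale[OF subspace_M] rho_M)
  show "mode x n (u + v) = mode x n u + mode x n v" for x n u v
    by (simp add: mode_def rho_add scale_right_distrib)
  show "mode x n (scale r v) = scale r (mode x n v)" for x n r v
    by (simp add: mode_def rho_scale scale_right_diff_distrib mult.commute)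
  show "mode (x + y) n v = mode x n v + mode y n v" for x y n v
    by (simp add: mode_def weight_def flow_mode_linear rho_add_left scale_left_distrib algebra_simps)
  show "mode (r *s x) n v = scale r (mode x n v)" for r x n v
    by (simp add: mode_def weight_def flow_mode_linear rho_scale_left scale_right_diff_distrib algebra_simps)
  show "v0 \<in> M"
    using rho_vacuum[of "(0, 1)"] by (simp add: M_def affine_sub_def nw_form_linear)
  show "mode x n v0 = 0" if "0 \<le> n" for x n
  proof -
    have "nw_form (z *s nw_c + of_int m *s nw_d) (Poly_Mapping.lookup (fst (flow_mode m x n)) 0)
        + snd (flow_mode m x n) = weight x n"
      by (simp add: flow_mode_def affine_mode_def weight_def lookup_add lookup_single when_def nw_form_sum axis_def)
    then show ?thesis
      using rho_vacuum[OF flow_mode_affine_sub[OF that, of x]] by (simp add: mode_def)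
  qed
  show "mode x n (mode y q v) = mode y q (mode x n v) + mode (nw_bracket x y) (n + q) v
      + scale (if n + q = 0 then of_int n * nw_form x y else 0) v" if "v \<in> M" for v x n y q
  proof -
    let ?k = "if n + q = 0 then of_int n * nw_form x y - of_int m * nw_bracket x y $ NW_C else 0"
    have "rho (flow_mode m x n) (rho (flow_mode m y q) v) - rho (flow_mode m y q) (rho (flow_mode m x n) v)
        = rho (flow_mode m (nw_bracket x y) (n + q)) v + scale ?k v"
      unfolding rho_bracket[symmetric] affine_bracket_flow_mode rho_add_left rho_central[OF that] ..
    \<comment> \<open>A bracket has no d-component, so in total degree 0 its weight is m times its
      c-component.\<close>
    moreover have "?k = (if n + q = 0 then of_int n * nw_form x y else 0) - weight (nw_bracket x y) (n + q)"
      by (simp add: weight_def nw_bracket_nth(4))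
    ultimately show ?thesis
      by (simp only: mode_def rho_minus rho_scale scale_left_diff_distrib scale_right_diff_distrib)
        (simp add: algebra_simps)
  qed
qed

lemma rho_UN_U:
  assumes "v \<in> (\<Union>s. highest.U s)" shows "rho x v \<in> (\<Union>s. highest.U s)"
proof (induction x rule: affine_induct)
  case (monomial p x)
  have flow: "rho (flow_mode m y n) v \<in> (\<Union>s. highest.U s)" for y n
  proof -
    have "mode y n v \<in> (\<Union>s. highest.U s)"
      using assms highest.X_U by blast
    from subspace_add[OF highest.subspace_UN_U this subspace_scale[OF highest.subspace_UN_U assms, of "weight y n"]]
    show ?thesis by (simp only: mode_def diff_add_cancel)
  qed
  \<comment> \<open>The opposite shifts, applied to each component separately, undo the
    flow.\<close>
  have "(Poly_Mapping.single p x, 0) = flow_mode m (x $ NW_A *s nw_a) (p + m) + flow_mode m (x $ NW_B *s nw_b) (p - m)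
      + flow_mode m (x $ NW_C *s nw_c + x $ NW_D *s nw_d) p"
    by (rule affine_eqI)
      (auto simp: flow_mode_def affine_mode_def lookup_add lookup_single when_def nw_eq_iff axis_def)
  then show ?case
    by (simp only: rho_add_left) (intro subspace_add[OF highest.subspace_UN_U] flow)
next
  case (central r)
  have "v \<in> M" using assms highest.U_subset_M by blast
  then show ?case
    using subspace_scale[OF highest.subspace_UN_U assms] by (simp only: rho_central)
next
  case (add x y)
  then show ?case unfolding rho_add_left by (rule subspace_add[OF highest.subspace_UN_U])
qed

lemma vacuum_UN_U: "v0 \<in> (\<Union>s. highest.U s)"
  using highest.word_vector_U[OF highest.vacuum, of 0] by blast

theorem vacuum_in_submodule:
  assumes W: "subspace W" "\<And>x v. v \<in> W \<Longrightarrow> rho x v \<in> W"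
    and w: "w \<in> W" "w \<in> span (range (\<lambda>xs. foldr rho xs v0))" "w \<noteq> 0"
  shows "v0 \<in> W"
proof -
  have "foldr rho xs v0 \<in> (\<Union>s. highest.U s)" for xs
    by (induction xs) (simp_all only: foldr.simps id_apply o_apply vacuum_UN_U rho_UN_U)
  then have "span (range (\<lambda>xs. foldr rho xs v0)) \<subseteq> (\<Union>s. highest.U s)"
    by (intro span_minimal highest.subspace_UN_U) blast
  then obtain s where "w \<in> highest.U s" using w by blast
  moreover have "mode x n v \<in> W" if "v \<in> W" for x n v
    unfolding mode_def by (intro subspace_diff subspace_scale W that)
  ultimately show ?thesis
    using W(1) w(1,3) by (intro highest.vacuum_in_invariant_subspace)
qed

end

section \<open>Splitting the affine algebra into two subalgebras\<close>

primrec mode_bound :: "int \<Rightarrow> nw_index \<Rightarrow> int" where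
  "mode_bound m NW_A = - m"
| "mode_bound m NW_B = m"
| "mode_bound m NW_C = 0"
| "mode_bound m NW_D = 0"

definition mode_part :: "int \<Rightarrow> int \<Rightarrow> nw \<Rightarrow> nw" where
  "mode_part m n x = (\<chi> i. if mode_bound m i \<le> n then x $ i else 0)"

definition affine_proj :: "int \<Rightarrow> affine_nw \<Rightarrow> affine_nw" where
  "affine_proj m u = (Poly_Mapping.mapp (mode_part m) (fst u), snd u)"

lemma mode_part_nth [simp]: "mode_part m n x $ i = (if mode_bound m i \<le> n then x $ i else 0)"
  by (simp add: mode_part_def)

lemma mode_part_zero [simp]: "mode_part m n 0 = 0"
  by (simp add: vec_eq_iff)

lemma lookup_affine_proj [simp]:
  "Poly_Mapping.lookup (fst (affine_proj m u)) n = mode_part m n (Poly_Mapping.lookup (fst u) n)"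
  by (simp add: affine_proj_def lookup_mapp when_def in_keys_iff)

lemma snd_affine_proj [simp]: "snd (affine_proj m u) = snd u"
  by (simp add: affine_proj_def)

lemma affine_proj_add: "affine_proj m (u + v) = affine_proj m u + affine_proj m v"
  by (rule affine_eqI) (auto simp: lookup_add vec_eq_iff)

lemma affine_proj_scale: "affine_proj m (affine_scale r u) = affine_scale r (affine_proj m u)"
  by (rule affine_eqI) (auto simp: vec_eq_iff)

lemma affine_proj_idem: "affine_proj m (affine_proj m u) = affine_proj m u"
  by (rule affine_eqI) (auto simp: vec_eq_iff)

lemma affine_sub_eq: "affine_sub m = {u. affine_proj m u = u}"
proof -
  have "u \<in> affine_sub m \<longleftrightarrow> (\<forall>n i. Poly_Mapping.lookup (fst u) n $ i \<noteq> 0 \<longrightarrow> mode_bound m i \<le> n)" for u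
  proof -
    have "(\<forall>i. Q i) \<longleftrightarrow> Q NW_A \<and> Q NW_B \<and> Q NW_C \<and> Q NW_D" for Q
      by (auto intro: nw_index.induct)
    then show ?thesis by (auto simp: affine_sub_def)
  qed
  moreover have "affine_proj m u = u \<longleftrightarrow> (\<forall>n i. Poly_Mapping.lookup (fst u) n $ i \<noteq> 0 \<longrightarrow> mode_bound m i \<le> n)" for u
  proof -
    have "affine_proj m u = u \<longleftrightarrow> (\<forall>n. mode_part m n (Poly_Mapping.lookup (fst u) n) = Poly_Mapping.lookup (fst u) n)"
      by (metis affine_eqI lookup_affine_proj snd_affine_proj)
    then show ?thesis by (auto simp: vec_eq_iff)
  qed
  ultimately show ?thesis by blast
qed

text \<open>Degrees in the complement lie strictly below the bounds. The bounds of a and b add up to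
  0 and those of c and d are 0, so brackets stay below the bounds and two elements that pair
  nontrivially have negative total degree, leaving no central term.\<close>

lemma affine_proj_complement_bracket:
  "affine_proj m (affine_bracket (u - affine_proj m u) (v - affine_proj m v)) = 0"
proof -
  let ?u = "u - affine_proj m u" and ?v = "v - affine_proj m v"
  have "affine_proj m (affine_term p q (Poly_Mapping.lookup (fst ?u) p) (Poly_Mapping.lookup (fst ?v) q)) = 0" for p q
  proof -
    define x where "x = Poly_Mapping.lookup (fst ?u) p"
    define y where "y = Poly_Mapping.lookup (fst ?v) q"
    have x: "mode_bound m i \<le> p \<Longrightarrow> x $ i = 0" and y: "mode_bound m i \<le> q \<Longrightarrow> y $ i = 0" for i
      by (simp_all add: x_def y_def lookup_minus)
    note x = x[of NW_A, simplified] x[of NW_B, simplified] x[of NW_C, simplified] x[of NW_D, simplified]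
    note y = y[of NW_A, simplified] y[of NW_B, simplified] y[of NW_C, simplified] y[of NW_D, simplified]
    have "mode_part m (p + q) (nw_bracket x y) = 0"
      unfolding nw_eq_iff using x y
      by (simp add: nw_bracket_nth) (smt (verit) mult_eq_0_iff)
    moreover have "nw_form x y = 0" if "p + q = 0"
      using x y that by (simp add: nw_form_sum) (smt (verit) add_0 mult_eq_0_iff)
    moreover have "affine_proj m (affine_term p q x y) =
        (Poly_Mapping.single (p + q) (mode_part m (p + q) (nw_bracket x y)),
         if p + q = 0 then of_int p * nw_form x y else 0)"
      by (rule affine_eqI) (auto simp: affine_term_def lookup_single when_def)
    ultimately have "affine_proj m (affine_term p q x y) = 0"
      by (simp add: zero_prod_def)
    then show ?thesis
      by (simp only: x_def y_def)
  qed
  moreover have "affine_proj m (\<Sum>i\<in>I. f i) = (\<Sum>i\<in>I. affine_proj m (f i))" for I and f :: "int \<Rightarrow> affine_nw"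
  proof -
    have "affine_proj m 0 = 0" using affine_proj_add[of m 0 0] by simp
    then show ?thesis
      by (induction I rule: infinite_finite_induct) (simp_all add: affine_proj_add)
  qed
  ultimately show ?thesis
    unfolding affine_bracket_superset[OF finite_keys order_refl finite_keys order_refl] by simp
qed

definition affine_weight :: "nw \<Rightarrow> affine_nw \<Rightarrow> complex" where
  "affine_weight \<alpha> u = nw_form \<alpha> (Poly_Mapping.lookup (fst u) 0) + snd u"

lemma affine_lie_character_extension:
  assumes "\<alpha> = z *s nw_c + of_int m *s nw_d"
  shows "lie_character_extension affine_scale affine_bracket (affine_proj m) (affine_weight \<alpha>)"
proof -
  interpret complex_lie_algebra affine_scale affine_bracket by (rule affine_lie_algebra)
  have sub: "affine_proj m u \<in> affine_sub m" for u
    by (simp add: affine_sub_eq affine_proj_idem)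
  have rep: "lie_representation (affine_sub m) (*) (\<lambda>x v. affine_weight \<alpha> x * v)"
    using one_dim_rep_is_representation[of \<alpha> z m 1] assms
    by (simp add: one_dim_rep_def[abs_def] affine_weight_def)
  show ?thesis
  proof
    fix x y r
    have "affine_bracket (affine_proj m x) (affine_proj m y) \<in> affine_sub m"
      using affine_lie_subalgebra[of m] sub unfolding lie_subalgebra_def by blast
    then show "affine_proj m (affine_bracket (affine_proj m x) (affine_proj m y))
        = affine_bracket (affine_proj m x) (affine_proj m y)"
      by (simp add: affine_sub_eq)
    \<comment> \<open>The one-dimensional representation evaluated at the vector 1 is its character;
      the bracket clause becomes a commutator of numbers, which is 0.\<close>
    have r: "affine_weight \<alpha> (u + v) * 1 = affine_weight \<alpha> u * 1 + affine_weight \<alpha> v * 1"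
      "affine_weight \<alpha> (affine_scale r u) * 1 = r * (affine_weight \<alpha> u * 1)"
      "affine_weight \<alpha> (affine_bracket u v) * 1 = affine_weight \<alpha> u * (affine_weight \<alpha> v * 1) - affine_weight \<alpha> v * (affine_weight \<alpha> u * 1)"
      if "u \<in> affine_sub m" "v \<in> affine_sub m" for u v
      using rep that unfolding lie_representation_def by blast+
    show "affine_weight \<alpha> (affine_proj m x + affine_proj m y)
        = affine_weight \<alpha> (affine_proj m x) + affine_weight \<alpha> (affine_proj m y)"
      "affine_weight \<alpha> (affine_scale r (affine_proj m x)) = r * affine_weight \<alpha> (affine_proj m x)"
      "affine_weight \<alpha> (affine_bracket (affine_proj m x) (affine_proj m y)) = 0"
      using r(1)[OF sub sub, of x y] r(2)[OF sub sub, of x] r(3)[OF sub sub, of x y] by simp_all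
  qed (rule affine_proj_add affine_proj_scale affine_proj_idem affine_proj_complement_bracket)+
qed

theorem theorem3p2:
  fixes \<c> \<d> :: complex and m :: int
  assumes "\<c> \<noteq> 0 \<or> \<d> \<noteq> 0"
    and "\<c> = of_int m"
  shows "irreducible_left_module
           (enveloping_algebra affine_scale affine_bracket UNIV)
           (affine_verma 1 m (\<d> *s nw_c + \<c> *s nw_d))"
proof -
  define \<alpha> where "\<alpha> = \<d> *s nw_c + of_int m *s nw_d"
  interpret ext: lie_character_extension affine_scale affine_bracket "affine_proj m" "affine_weight \<alpha>"
    using \<alpha>_def by (rule affine_lie_character_extension)
  have P: "ext.P = affine_sub m"
    by (simp add: ext.P_def affine_sub_eq)
  have "one_dim_rep 1 \<alpha> = (\<lambda>x v. affine_weight \<alpha> x * v)"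
    by (simp add: one_dim_rep_def[abs_def] affine_weight_def)
  then have verma: "affine_verma 1 m (\<d> *s nw_c + \<c> *s nw_d) = ext.ind.V"
    by (simp add: affine_verma_def ext.N_def P assms(2) flip: \<alpha>_def)
  obtain \<pi> where \<pi>: "Vector_Spaces.linear free_scale free_scale \<pi>" "\<And>p. p - \<pi> p \<in> ext.annihilator"
    "\<And>p. p \<in> ext.annihilator \<Longrightarrow> \<pi> p = 0"
    using ext.annihilator_projection by blast
  interpret ac: annihilator_complement affine_scale affine_bracket "affine_proj m" "affine_weight \<alpha>" \<pi>
    by (intro annihilator_complement.intro ext.lie_character_extension_axioms
        annihilator_complement_axioms.intro \<pi>)
  interpret hw: affine_highest_weight free_scale ac.rho "\<pi> 1" m \<d>
    by (intro affine_highest_weight.intro vector_space_free_scale affine_highest_weight_axioms.intro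
        ac.rho_representation)
      (simp add: ac.rho_vacuum P affine_weight_def \<alpha>_def)
  show ?thesis
    unfolding verma
  proof (rule ext.irreducible_induced_moduleI)
    fix W assume W: "0 \<in> W" "\<And>p q. p \<in> W \<Longrightarrow> q \<in> W \<Longrightarrow> p + q \<in> W" "\<And>p q. p \<in> W \<Longrightarrow> q * p \<in> W"
      and ann: "ext.annihilator \<subset> W"
    have sub: "free.subspace W"
      by (rule free.subspaceI) (simp_all add: W free_scale_def)
    \<comment> \<open>\<pi> p differs from p by an element of the annihilator, which W contains. So
      W is stable under \<open>ac.rho\<close> although the latter involves \<pi>.\<close>
    have \<pi>_W: "\<pi> p \<in> W" if "p \<in> W" for p
      using free.subspace_diff[OF sub that, of "p - \<pi> p"] \<pi>(2) ann by auto
    obtain w where w: "w \<in> W" "w \<notin> ext.annihilator" using ann by blast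
    have "\<pi> w \<noteq> 0" using \<pi>(2)[of w] w(2) by auto
    \<comment> \<open>The free algebra is spanned by words, and \<pi> of a word is that word acting
      on \<open>\<pi> 1\<close>; thus the span hypothesis of \<open>hw.vacuum_in_submodule\<close>
      holds for \<pi> w.\<close>
    moreover have "\<pi> p \<in> free.span (range (\<lambda>xs. foldr ac.rho xs (\<pi> 1)))" for p
    proof (induction p rule: free_algebra_induct)
      case (word u)
      show ?case unfolding ac.\<pi>_word by (rule free.span_base) simp
    next
      case (add p q)
      then show ?case by (simp add: ac.\<pi>_simps free.span_add)
    next
      case (scale r p)
      from free.span_scale[OF this, of r] show ?case by (simp only: ac.\<pi>_scalar free_scale_def[of r "\<pi> p"])
    qed
    ultimately have "\<pi> 1 \<in> W"
      by (intro hw.vacuum_in_submodule[OF sub _ \<pi>_W[OF w(1)]]) (simp_all add: ac.rho_def \<pi>_W W(3))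
    moreover have "1 - \<pi> 1 \<in> W" using \<pi>(2) ann by blast
    ultimately show "1 \<in> W" using W(2)[of "1 - \<pi> 1" "\<pi> 1"] by simp
  qed
qed

end
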